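(* Let $G$ be a median graph with $n$ vertices, dimension $d$, and a fixed basepoint $v_0$. There is an algorithm, running in time $\tilde{O}(2^{2d}n)$, which returns the sets $\parallel_{\mathrm{P}}(L,u)$ for all pairs $(L,u)$ where $u$ is a vertex and $L$ is a POF incoming into $u$.
   Context: A finite connected simple graph is median if for every triple of distinct vertices $x,y,z$, $I(x,y)\cap I(y,z)\cap I(z,x)$ is a single vertex, where $I(a,b)=\{w: d(a,w)+d(w,b)=d(a,b)\}$; its dimension $d$ is the largest $k$ with $Q_k$ an induced subgraph. Two edges $uv,xy$ are in relation $\Theta_0$ if $u,v,y,x$ form a 4-cycle with $uv,xy$ opposite; $\Theta$ is the reflexive-transitive closure of $\Theta_0$, with classes called $\Theta$-classes. Two $\Theta$-classes $E_i,E_j$ are orthogonal if there is a 4-cycle $uvyx$ with $uv,xy\in E_i$ and $ux,vy\in E_j$. A POF is a set of pairwise orthogonal $\Theta$-classes. Under the $v_0$-orientation each edge $uv$ is oriented $u\to v$ if $d(v_0,u)<d(v_0,v)$. A POF $L$ is incoming into (resp. outgoing from) $u$ if every class of $L$ has an edge incident to $u$ oriented into (resp. out of) $u$. For a POF $L$ incoming into $u$, $\parallel_{\mathrm{P}}(L,u)$ is the set of POFs $L^+$ outgoing from $u$ such that for every $E_j\in L^+$, $L\cup\{E_j\}$ is not a POF. $\tilde{O}$ suppresses polylogarithmic factors in $n$. *)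

theory Defs
  imports
    Complex_Main
    "HOL-Library.Discrete_Functions"
    "Graph_Theory.Graph_Theory"
begin

section \<open>Median graphs, Theta-classes and POFs\<close>

text \<open>
  A finite simple graph is a \<^locale>\<open>pair_graph\<close>: a finite, loop-free digraph with a symmetric
  arc relation \<^const>\<open>parcs\<close>. An undirected edge is the two-element set of its ends.
\<close>

definition gdist :: "'a pair_pre_digraph \<Rightarrow> 'a \<Rightarrow> 'a \<Rightarrow> nat" where
  "gdist G u v = (LEAST k. (u, v) \<in> parcs G ^^ k)"

definition interval :: "'a pair_pre_digraph \<Rightarrow> 'a \<Rightarrow> 'a \<Rightarrow> 'a set" where
  "interval G a b = {w \<in> pverts G. gdist G a w + gdist G w b = gdist G a b}"

definition median_graph :: "'a pair_pre_digraph \<Rightarrow> bool" where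
  "median_graph G \<longleftrightarrow>
     pair_graph G \<and> Digraph_Component.connected (with_proj G) \<and>
     (\<forall>x \<in> pverts G. \<forall>y \<in> pverts G. \<forall>z \<in> pverts G. x \<noteq> y \<and> y \<noteq> z \<and> x \<noteq> z \<longrightarrow>
        (\<exists>m. interval G x y \<inter> interval G y z \<inter> interval G z x = {m}))"

definition hypercube :: "nat \<Rightarrow> nat set pair_pre_digraph" where
  "hypercube k = \<lparr> pverts = Pow {..<k},
     parcs = {(A, B). A \<subseteq> {..<k} \<and> B \<subseteq> {..<k} \<and> card ((A - B) \<union> (B - A)) = 1} \<rparr>"

definition dimension :: "'a pair_pre_digraph \<Rightarrow> nat" where
  "dimension G = Max {k. \<exists>H. induced_subgraph H (with_proj G) \<and>
                             digraph_iso (with_proj (hypercube k)) H}"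

definition uedges :: "'a pair_pre_digraph \<Rightarrow> 'a set set" where
  "uedges G = {{u, v} | u v. (u, v) \<in> parcs G}"

definition four_cycle :: "'a pair_pre_digraph \<Rightarrow> 'a \<Rightarrow> 'a \<Rightarrow> 'a \<Rightarrow> 'a \<Rightarrow> bool" where
  "four_cycle G a b c d \<longleftrightarrow> distinct [a, b, c, d] \<and>
     (a, b) \<in> parcs G \<and> (b, c) \<in> parcs G \<and> (c, d) \<in> parcs G \<and> (d, a) \<in> parcs G"

definition Theta0 :: "'a pair_pre_digraph \<Rightarrow> 'a set rel" where
  "Theta0 G = {({u, v}, {x, y}) | u v x y. four_cycle G u v y x}"

definition Theta_classes :: "'a pair_pre_digraph \<Rightarrow> 'a set set set" where
  "Theta_classes G = uedges G // (Theta0 G)\<^sup>*"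

definition orthogonal :: "'a pair_pre_digraph \<Rightarrow> 'a set set \<Rightarrow> 'a set set \<Rightarrow> bool" where
  "orthogonal G E F \<longleftrightarrow> (\<exists>u v x y. four_cycle G u v y x \<and>
     {u, v} \<in> E \<and> {x, y} \<in> E \<and> {u, x} \<in> F \<and> {v, y} \<in> F)"

definition POF :: "'a pair_pre_digraph \<Rightarrow> 'a set set set \<Rightarrow> bool" where
  "POF G L \<longleftrightarrow> L \<subseteq> Theta_classes G \<and> pairwise (orthogonal G) L"

definition incoming :: "'a pair_pre_digraph \<Rightarrow> 'a \<Rightarrow> 'a set set set \<Rightarrow> 'a \<Rightarrow> bool" where
  "incoming G v0 L u \<longleftrightarrow>
     (\<forall>E \<in> L. \<exists>w. (w, u) \<in> parcs G \<and> {w, u} \<in> E \<and> gdist G v0 w < gdist G v0 u)"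

definition outgoing :: "'a pair_pre_digraph \<Rightarrow> 'a \<Rightarrow> 'a set set set \<Rightarrow> 'a \<Rightarrow> bool" where
  "outgoing G v0 L u \<longleftrightarrow>
     (\<forall>E \<in> L. \<exists>w. (u, w) \<in> parcs G \<and> {u, w} \<in> E \<and> gdist G v0 u < gdist G v0 w)"

definition parallel_POFs ::
    "'a pair_pre_digraph \<Rightarrow> 'a \<Rightarrow> 'a set set set \<Rightarrow> 'a \<Rightarrow> 'a set set set set" where
  "parallel_POFs G v0 L u =
     {L'. POF G L' \<and> outgoing G v0 L' u \<and> (\<forall>E \<in> L'. \<not> POF G (insert E L))}"


section \<open>A random access machine with logarithmic cost\<close>

text \<open>
  Programs work on natural-number variables and on arrays of naturals with unbounded index range.
  A program mentions finitely many of them, so the arrays could be interleaved into one memory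
  at the price of a constant factor.
  Every read, constant and operation is charged the binary length of the number it produces, and
  array accesses are also charged for the index. Hence large numbers cannot be used to
  hide work.
\<close>

datatype binop = Plus | Minus | Times | Div | Mod | Less | Equal

datatype exp =
    Num nat
  | Var nat
  | Arr nat exp
  | Bin binop exp exp

datatype com =
    Skip
  | Assign nat exp
  | Store nat exp exp
  | Seq com com
  | If exp com com
  | While exp com

record state =
  vars :: "nat \<Rightarrow> nat"
  arrs :: "nat \<Rightarrow> nat \<Rightarrow> nat"

fun binop_val :: "binop \<Rightarrow> nat \<Rightarrow> nat \<Rightarrow> nat" where
  "binop_val Plus x y = x + y"
| "binop_val Minus x y = x - y"
| "binop_val Times x y = x * y"
| "binop_val Div x y = x div y"
| "binop_val Mod x y = x mod y"
| "binop_val Less x y = (if x < y then 1 else 0)"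
| "binop_val Equal x y = (if x = y then 1 else 0)"

fun exp_val :: "exp \<Rightarrow> state \<Rightarrow> nat" where
  "exp_val (Num k) s = k"
| "exp_val (Var x) s = vars s x"
| "exp_val (Arr a i) s = arrs s a (exp_val i s)"
| "exp_val (Bin f e1 e2) s = binop_val f (exp_val e1 s) (exp_val e2 s)"

definition bit_len :: "nat \<Rightarrow> nat" where
  "bit_len k = Suc (floor_log k)"

fun exp_cost :: "exp \<Rightarrow> state \<Rightarrow> nat" where
  "exp_cost (Num k) s = bit_len k"
| "exp_cost (Var x) s = bit_len (vars s x)"
| "exp_cost (Arr a i) s = exp_cost i s + bit_len (exp_val (Arr a i) s)"
| "exp_cost (Bin f e1 e2) s = exp_cost e1 s + exp_cost e2 s + bit_len (exp_val (Bin f e1 e2) s)"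

text \<open>\<open>exec c s t s'\<close>: started in \<open>s\<close>, program \<open>c\<close> halts in \<open>s'\<close> at total cost \<open>t\<close>.\<close>

inductive exec :: "com \<Rightarrow> state \<Rightarrow> nat \<Rightarrow> state \<Rightarrow> bool" where
  Skip: "exec Skip s 1 s"
| Assign: "exec (Assign x e) s (Suc (exp_cost e s)) (s\<lparr>vars := (vars s)(x := exp_val e s)\<rparr>)"
| Store: "exec (Store a i e) s (Suc (exp_cost i s + exp_cost e s))
            (s\<lparr>arrs := (arrs s)(a := (arrs s a)(exp_val i s := exp_val e s))\<rparr>)"
| Seq: "\<lbrakk> exec c1 s t1 s1; exec c2 s1 t2 s2 \<rbrakk> \<Longrightarrow> exec (Seq c1 c2) s (t1 + t2) s2"
| IfTrue: "\<lbrakk> exp_val b s \<noteq> 0; exec c1 s t s' \<rbrakk> \<Longrightarrow>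
            exec (If b c1 c2) s (Suc (exp_cost b s + t)) s'"
| IfFalse: "\<lbrakk> exp_val b s = 0; exec c2 s t s' \<rbrakk> \<Longrightarrow>
            exec (If b c1 c2) s (Suc (exp_cost b s + t)) s'"
| WhileFalse: "exp_val b s = 0 \<Longrightarrow> exec (While b c) s (Suc (exp_cost b s)) s"
| WhileTrue: "\<lbrakk> exp_val b s \<noteq> 0; exec c s t1 s1; exec (While b c) s1 t2 s2 \<rbrakk> \<Longrightarrow>
            exec (While b c) s (Suc (exp_cost b s + t1 + t2)) s2"

inductive_cases exec_cases:
  "exec Skip s t s'" "exec (Assign x e) s t s'" "exec (Store a i e) s t s'"
  "exec (Seq c1 c2) s t s'" "exec (If b c1 c2) s t s'" "exec (While b c) s t s'"

lemma exec_deterministic: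
  "exec c s t s' \<Longrightarrow> exec c s t2 s2 \<Longrightarrow> t2 = t \<and> s2 = s'"
proof (induction arbitrary: t2 s2 rule: exec.induct)
  case (Seq c1 s t1 s1 c2 tt ss)
  from Seq.prems show ?case by (rule exec_cases(4)) (metis Seq.IH)
next
  case (IfTrue b s c1 t s' c2)
  from IfTrue.prems show ?case by (rule exec_cases(5)) (metis IfTrue.IH IfTrue.hyps(1) neq0_conv)+
next
  case (IfFalse b s c2 t s' c1)
  from IfFalse.prems show ?case by (rule exec_cases(5)) (metis IfFalse.IH IfFalse.hyps(1) neq0_conv)+
next
  case (WhileFalse b s c)
  from WhileFalse.prems show ?case by (rule exec_cases(6)) (metis WhileFalse.hyps neq0_conv)+
next
  case (WhileTrue b s c t1 s1 tt ss)
  from WhileTrue.prems show ?case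
    by (rule exec_cases(6)) (metis WhileTrue.IH WhileTrue.hyps(1) neq0_conv)+
qed (erule exec_cases, simp)+


section \<open>Input and output conventions\<close>

definition edge_listing :: "nat pair_pre_digraph \<Rightarrow> (nat \<times> nat) list \<Rightarrow> bool" where
  "edge_listing G es \<longleftrightarrow>
     distinct (map (\<lambda>(u, v). {u, v}) es) \<and> set (map (\<lambda>(u, v). {u, v}) es) = uedges G"

text \<open>
  Input: variables 0, 1, 2 hold the number of vertices, the number of edges and the basepoint;
  arrays 0 and 1 hold the two ends of the listed edges.
\<close>

definition input_state :: "nat \<Rightarrow> (nat \<times> nat) list \<Rightarrow> nat \<Rightarrow> state" where
  "input_state n es v0 = \<lparr>
     vars = (\<lambda>_. 0)(0 := n, 1 := length es, 2 := v0),
     arrs = (\<lambda>_ _. 0)(0 := \<lambda>i. if i < length es then fst (es ! i) else 0,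
                      1 := \<lambda>i. if i < length es then snd (es ! i) else 0) \<rparr>"

text \<open>
  Output: array 2 assigns to each listed edge a number naming its Theta-class. Array 3
  contains a table with one entry \<open>(u, L, Ps)\<close> per pair of a vertex \<open>u\<close> and a POF incoming
  into \<open>u\<close>, where \<open>L\<close> and the members of \<open>Ps\<close> are lists of class numbers. Lists are stored
  with their lengths in front.
\<close>

definition class_naming :: "nat pair_pre_digraph \<Rightarrow> (nat \<times> nat) list \<Rightarrow> (nat \<Rightarrow> nat) \<Rightarrow> bool" where
  "class_naming G es lab \<longleftrightarrow> (\<forall>i < length es. \<forall>j < length es.
     lab i = lab j \<longleftrightarrow> ({fst (es ! i), snd (es ! i)}, {fst (es ! j), snd (es ! j)}) \<in> (Theta0 G)\<^sup>*)"

definition named_class :: "(nat \<times> nat) list \<Rightarrow> (nat \<Rightarrow> nat) \<Rightarrow> nat \<Rightarrow> nat set set" where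
  "named_class es lab c = {{fst (es ! i), snd (es ! i)} | i. i < length es \<and> lab i = c}"

definition named_classes :: "(nat \<times> nat) list \<Rightarrow> (nat \<Rightarrow> nat) \<Rightarrow> nat list \<Rightarrow> nat set set set" where
  "named_classes es lab cs = named_class es lab ` set cs"

type_synonym entry = "nat \<times> nat list \<times> nat list list"

definition enc_list :: "nat list \<Rightarrow> nat list" where
  "enc_list xs = length xs # xs"

definition enc_entry :: "entry \<Rightarrow> nat list" where
  "enc_entry = (\<lambda>(u, L, Ps). u # enc_list L @ length Ps # concat (map enc_list Ps))"

definition enc_table :: "entry list \<Rightarrow> nat list" where
  "enc_table tab = length tab # concat (map enc_entry tab)"

definition parallel_table ::
    "nat pair_pre_digraph \<Rightarrow> nat \<Rightarrow> (nat list \<Rightarrow> nat set set set) \<Rightarrow> entry list \<Rightarrow> bool" where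
  "parallel_table G v0 dec tab \<longleftrightarrow>
     distinct (map (\<lambda>(u, L, Ps). (dec L, u)) tab) \<and>
     set (map (\<lambda>(u, L, Ps). (dec L, u)) tab) =
       {(L, u). u \<in> pverts G \<and> POF G L \<and> incoming G v0 L u} \<and>
     (\<forall>(u, L, Ps) \<in> set tab.
        distinct L \<and> (\<forall>P \<in> set Ps. distinct P) \<and>
        distinct (map dec Ps) \<and> set (map dec Ps) = parallel_POFs G v0 (dec L) u)"

definition returns_parallel_POFs ::
    "nat pair_pre_digraph \<Rightarrow> nat \<Rightarrow> (nat \<times> nat) list \<Rightarrow> state \<Rightarrow> bool" where
  "returns_parallel_POFs G v0 es s \<longleftrightarrow>
     class_naming G es (arrs s 2) \<and>
     (\<exists>tab. (\<forall>i < length (enc_table tab). arrs s 3 i = enc_table tab ! i) \<and>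
            parallel_table G v0 (named_classes es (arrs s 2)) tab)"

end

theory Submission
  imports Defs
begin

text \<open>
  A vertex \<open>u\<close> is determined by the set \<open>X u\<close> of classes that separate it from the basepoint, and
  edges add or remove one class. The classes incoming into a vertex are pairwise orthogonal, and
  every set of them spans a cube below the vertex. Hence a vertex has at most \<open>d\<close> incoming classes,
  the graph has at most \<open>2 ^ d * n\<close> cubes, and these cubes are in bijection with the pairs of a vertex
  and an incoming POF (take the top) as well as with the pairs of a vertex and an outgoing POF (take
  the bottom). A class \<open>E\<close> outgoing along the edge \<open>ux\<close> extends a POF \<open>L\<close> incoming into \<open>u\<close> iff
  \<open>L\<close> is incoming into \<open>x\<close>, which is a local test. So comparing, for all \<open>u\<close>, the cubes with
  top \<open>u\<close> with the cubes with bottom \<open>u\<close> takes at most \<open>2 ^ d * 2 ^ d * n\<close> tests of polylogarithmic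
  cost.

  The classes are computed in breadth-first order: an edge with top \<open>t\<close> inherits the class of the
  opposite edge in a square with top \<open>t\<close>, and it starts a new class if \<open>t\<close> has no other lower
  neighbour.
\<close>

section \<open>Distances and halfspaces in median graphs\<close>

text \<open>\<open>Theta_classes\<close> are generated by squares, whereas a vertex is described by
  the halfspaces that separate it from the basepoint. The bridge is
  \<open>Theta_if_separated\<close>: two edges crossing the same split are joined by a ladder of
  squares. Uniqueness of medians enters through three facts only: bipartiteness
  (\<open>d_edge\<close>), the quadrangle condition (\<open>quadrangle\<close>) and
  \<open>no_double_peak\<close>. The hidden factors are powers of the dimension. They are
  polylogarithmic because a largest cube has \<open>2 ^ d\<close> vertices, so
  \<open>2 ^ d \<le> n\<close>. The factor \<open>2 ^ (2 * d)\<close> is a double count: a vertex is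
  the top of at most \<open>2 ^ d\<close> cubes and every cube has one bottom, so pairing each cube
  with the cubes that start at its top costs just one more factor \<open>2 ^ d\<close> than listing
  all cubes. Time is first counted in steps of unit cost. Since the program never multiplies and
  adds only constants, passing to logarithmic cost is a uniform factor \<open>O(log n)\<close> at
  the end.\<close>

locale median =
  fixes G :: "'a pair_pre_digraph"
  assumes median_graph: "median_graph G"
begin

abbreviation V :: "'a set" where "V \<equiv> pverts G"
abbreviation adj :: "'a \<Rightarrow> 'a \<Rightarrow> bool" (infix "\<sim>" 50) where "u \<sim> v \<equiv> (u, v) \<in> parcs G"
abbreviation d :: "'a \<Rightarrow> 'a \<Rightarrow> nat" where "d \<equiv> gdist G"

lemma pair_graph: "pair_graph G"
  using median_graph by (simp add: median_graph_def)

lemma finite_V: "finite V" and finite_parcs: "finite (parcs G)"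
  using pair_graph
  by (auto simp: pair_graph_def pair_digraph_def pair_fin_digraph_def pair_fin_digraph_axioms_def)

lemma adj_V: "u \<sim> v \<Longrightarrow> u \<in> V" "u \<sim> v \<Longrightarrow> v \<in> V"
proof -
  interpret pair_graph G by (rule pair_graph)
  show "u \<sim> v \<Longrightarrow> u \<in> V" "u \<sim> v \<Longrightarrow> v \<in> V" by (auto dest: in_arcsD1 in_arcsD2)
qed

lemma adj_irrefl: "u \<sim> v \<Longrightarrow> u \<noteq> v"
proof -
  interpret pair_graph G by (rule pair_graph)
  show "u \<sim> v \<Longrightarrow> u \<noteq> v" using pair_no_loops by fastforce
qed

lemma sym_parcs: "sym (parcs G)"
proof -
  interpret pair_graph G by (rule pair_graph)
  show ?thesis using pair_sym_arcs by (simp add: symmetric_def)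
qed

lemma adj_sym: "u \<sim> v \<Longrightarrow> v \<sim> u"
  using sym_parcs by (meson symE)

lemma adj_commute: "u \<sim> v \<longleftrightarrow> v \<sim> u"
  using adj_sym by blast

lemma relpow_sym: "(u, v) \<in> parcs G ^^ k \<Longrightarrow> (v, u) \<in> parcs G ^^ k"
proof (induction k arbitrary: v)
  case (Suc k)
  then obtain w where "(u, w) \<in> parcs G ^^ k" "w \<sim> v" by auto
  then show ?case using Suc.IH adj_sym by (meson relpow_Suc_I2)
qed simp

text \<open>A connected symmetric digraph is strongly connected, so the \<open>LEAST\<close> in
  \<open>gdist\<close> is attained for any two vertices.\<close>

lemma d_path:
  assumes "u \<in> V" "v \<in> V"
  shows "(u, v) \<in> parcs G ^^ d u v"
proof -
  interpret pair_graph G by (rule pair_graph)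
  have "Digraph_Component.connected (with_proj G)"
    using median_graph by (simp add: median_graph_def)
  then have "strongly_connected (with_proj G)"
    using symmetric_connected_imp_strongly_connected[OF sym_arcs] by simp
  then have "(u, v) \<in> (parcs G)\<^sup>*"
    using assms reachable_rtranclI[of "with_proj G" u v] by (auto simp: strongly_connected_def)
  then obtain k where "(u, v) \<in> parcs G ^^ k" using rtrancl_imp_relpow by blast
  then show ?thesis unfolding gdist_def by (rule LeastI)
qed

lemma d_le: "(u, v) \<in> parcs G ^^ k \<Longrightarrow> d u v \<le> k"
  unfolding gdist_def by (rule Least_le)

lemma d_refl [simp]: "d u u = 0"
  using d_le[of u u 0] by simp

lemma d_0: "u \<in> V \<Longrightarrow> v \<in> V \<Longrightarrow> d u v = 0 \<longleftrightarrow> u = v"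
  using d_path[of u v] by auto

lemma d_sym: "u \<in> V \<Longrightarrow> v \<in> V \<Longrightarrow> d u v = d v u"
  using d_path[of u v] d_path[of v u] by (meson d_le relpow_sym le_antisym)

lemma d_triangle:
  assumes "u \<in> V" "v \<in> V" "w \<in> V"
  shows "d u w \<le> d u v + d v w"
proof -
  have "(u, w) \<in> parcs G ^^ (d u v + d v w)"
    unfolding relpow_add using d_path assms by blast
  then show ?thesis by (rule d_le)
qed

lemma adj_iff_d: "u \<in> V \<Longrightarrow> v \<in> V \<Longrightarrow> u \<sim> v \<longleftrightarrow> d u v = 1"
proof
  assume "u \<sim> v" "u \<in> V" "v \<in> V"
  then have "d u v \<le> 1" "d u v \<noteq> 0" using d_le[of u v 1] d_0 adj_irrefl by auto
  then show "d u v = 1" by simp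
next
  assume "d u v = 1" "u \<in> V" "v \<in> V"
  then show "u \<sim> v" using d_path[of u v] by auto
qed

lemma d_adj: "u \<sim> v \<Longrightarrow> d u v = 1"
  using adj_iff_d adj_V by blast

lemma step_towards:
  assumes "u \<in> V" "v \<in> V" "u \<noteq> v"
  obtains w where "u \<sim> w" "d u v = Suc (d w v)"
proof -
  obtain k where k: "d u v = Suc k" using assms d_0 not0_implies_Suc by blast
  have "(u, v) \<in> parcs G ^^ Suc k" using d_path assms k by metis
  then obtain w where w: "u \<sim> w" "(w, v) \<in> parcs G ^^ k" by (meson relpow_Suc_D2)
  then have "d w v \<le> k" using d_le by blast
  moreover have "d u v \<le> d u w + d w v" using d_triangle assms w adj_V by blast
  ultimately show thesis using that w k d_adj[OF w(1)] by simp
qed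

lemma median_unique:
  assumes "x \<in> V" "y \<in> V" "z \<in> V" "x \<noteq> y" "y \<noteq> z" "x \<noteq> z"
  obtains m where "interval G x y \<inter> interval G y z \<inter> interval G z x = {m}"
  using median_graph assms unfolding median_graph_def by blast

text \<open>The median of \<open>u\<close>, \<open>v\<close>, \<open>z\<close> lies in the interval
  of the edge \<open>uv\<close>, so it is one of its ends, and this end lies between
  \<open>z\<close> and the other one. Adjacent vertices are thus never equally far from
  \<open>z\<close>.\<close>

lemma d_edge:
  assumes "u \<sim> v" "z \<in> V"
  shows "d z u = Suc (d z v) \<or> d z v = Suc (d z u)"
proof (cases "z = u \<or> z = v")
  case True
  then show ?thesis using d_adj[OF assms(1)] d_adj[OF adj_sym[OF assms(1)]] by auto
next
  case False
  note V = adj_V[OF assms(1)] assms(2)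
  obtain m where m: "interval G u v \<inter> interval G v z \<inter> interval G z u = {m}"
    using median_unique[of u v z] V False adj_irrefl[OF assms(1)] by metis
  then have "m \<in> interval G u v \<inter> interval G v z \<inter> interval G z u" by blast
  then have *: "m \<in> V" "d u m + d m v = d u v" "d v m + d m z = d v z" "d z m + d m u = d z u"
    by (auto simp: interval_def)
  have "d u m = 0 \<or> d m v = 0" using * d_adj[OF assms(1)] by linarith
  then have "m = u \<or> m = v" using d_0 V * by blast
  then show ?thesis
    using * d_adj[OF assms(1)] d_adj[OF adj_sym[OF assms(1)]] d_sym V by auto
qed

lemma d_common_nbr:
  assumes "p \<sim> t" "t \<sim> q" "p \<noteq> q"
  shows "d p q = 2"
proof -
  have V: "p \<in> V" "t \<in> V" "q \<in> V" using assms adj_V by auto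
  have "d p q \<noteq> 0" using d_0 V assms by blast
  moreover have "d p q = Suc (d p t) \<or> d p t = Suc (d p q)"
    using d_edge[OF assms(2), of p] V by auto
  ultimately show ?thesis using d_adj[OF assms(1)] by auto
qed

text \<open>\<open>p\<close> and \<open>q\<close> have distance 2 and are equally far from
  \<open>z\<close>, so their median with \<open>z\<close> lies halfway between them.\<close>

lemma quadrangle:
  assumes "p \<sim> t" "q \<sim> t" "p \<noteq> q" "z \<in> V" "d z t = Suc (d z p)" "d z t = Suc (d z q)"
  obtains b where "b \<sim> p" "b \<sim> q" "d z p = Suc (d z b)"
proof -
  have V: "p \<in> V" "t \<in> V" "q \<in> V" using assms adj_V by auto
  have pq: "d p q = 2" using d_common_nbr assms adj_sym by blast
  have ne: "p \<noteq> z" "q \<noteq> z" using assms d_0[of z] V by auto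
  obtain m where m: "interval G p q \<inter> interval G q z \<inter> interval G z p = {m}"
    using median_unique[of p q z] V assms ne by metis
  then have "m \<in> interval G p q \<inter> interval G q z \<inter> interval G z p" by blast
  then have *: "m \<in> V" "d p m + d m q = d p q" "d q m + d m z = d q z" "d z m + d m p = d z p"
    by (auto simp: interval_def)
  have s: "d p m = d m p" "d m q = d q m" "d m z = d z m" "d q z = d z q"
    using d_sym V assms * by blast+
  then have "d m p = 1" "d m q = 1" using * pq assms by linarith+
  then show thesis using that[of m] adj_iff_d V * by auto
qed

text \<open>Both \<open>a\<close> and \<open>c\<close> would be medians of \<open>b\<close>,
  \<open>e\<close> and \<open>z\<close>: each lies between \<open>b\<close> and \<open>e\<close>,
  which have distance 2, and is one step closer to \<open>z\<close> than both.\<close>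

lemma no_double_peak:
  assumes "a \<sim> b" "c \<sim> b" "a \<sim> e" "c \<sim> e" "a \<noteq> c" "b \<noteq> e" "z \<in> V"
    and "d z b = Suc (d z a)" "d z b = Suc (d z c)" "d z e = Suc (d z a)"
  shows False
proof -
  have V: "a \<in> V" "b \<in> V" "c \<in> V" "e \<in> V" using assms adj_V by auto
  have be: "d b e = 2" using d_common_nbr assms adj_sym by blast
  have ne: "b \<noteq> z" "e \<noteq> z" using assms d_0[of z] V by auto
  obtain m where m: "interval G b e \<inter> interval G e z \<inter> interval G z b = {m}"
    using median_unique[of b e z] V assms ne by metis
  have 1: "d b a = 1" "d a e = 1" "d b c = 1" "d c e = 1" "d e a = 1" "d e c = 1" "d a b = 1" "d c b = 1"
    using assms d_adj adj_sym by blast+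
  have "d a z = d z a" "d c z = d z c" "d e z = d z e" using d_sym V assms by auto
  then have "a \<in> {m}" "c \<in> {m}"
    unfolding m[symmetric] using V 1 be assms by (auto simp: interval_def)
  then show False using assms by auto
qed

section \<open>Halfspaces of edges\<close>

definition W :: "'a \<Rightarrow> 'a \<Rightarrow> 'a set" where
  "W a b = {z \<in> V. d z a < d z b}"

lemma W_compl: "a \<sim> b \<Longrightarrow> W b a = V - W a b"
  using d_edge[of a b] by (force simp: W_def)

lemma W_ends:
  assumes "a \<sim> b" shows "a \<in> W a b" "b \<notin> W a b" "b \<in> W b a" "a \<notin> W b a"
  using adj_V[OF assms] d_adj[OF assms] d_adj[OF adj_sym[OF assms]] by (auto simp: W_def)

text \<open>If \<open>z\<close> changed sides between the opposite edges, then \<open>b\<close> and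
  \<open>e\<close> would both be peaks over \<open>a\<close> and \<open>c\<close> as seen from
  \<open>z\<close>.\<close>

lemma W_square_sub:
  assumes "a \<sim> b" "b \<sim> c" "c \<sim> e" "e \<sim> a" "a \<noteq> c" "b \<noteq> e"
  shows "W a b \<subseteq> W e c"
proof
  fix z assume "z \<in> W a b"
  then have z: "z \<in> V" "d z a < d z b" by (auto simp: W_def)
  have s: "b \<sim> a" "c \<sim> b" "e \<sim> c" "a \<sim> e" using assms adj_sym by blast+
  have ab: "d z b = Suc (d z a)" using d_edge[OF assms(1) z(1)] z by auto
  show "z \<in> W e c"
  proof (rule ccontr)
    assume "z \<notin> W e c"
    then have ec: "d z e = Suc (d z c)" using d_edge[OF assms(3) z(1)] z by (auto simp: W_def)
    have "d z c = d z a"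
      using d_edge[OF assms(2) z(1)] d_edge[OF assms(4) z(1)] ab ec by linarith
    then have "d z b = Suc (d z c)" "d z e = Suc (d z a)" using ab ec by simp_all
    with assms(1) s(2,4) assms(3,5,6) z(1) ab show False
      using no_double_peak[of a b c e z] by blast
  qed
qed

lemma W_square:
  assumes "four_cycle G a b c e"
  shows "W a b = W e c" "W a e = W b c"
proof -
  have *: "a \<sim> b" "b \<sim> c" "c \<sim> e" "e \<sim> a" "a \<noteq> c" "b \<noteq> e" "b \<sim> a" "c \<sim> b" "e \<sim> c" "a \<sim> e"
    using assms by (auto simp: four_cycle_def adj_commute)
  show "W a b = W e c" using W_square_sub[of a b c e] W_square_sub[of e c b a] * by auto
  show "W a e = W b c" using W_square_sub[of a e c b] W_square_sub[of b c e a] * by auto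
qed

text \<open>An edge is a two-element set without orientation, so the invariant of its class is the
  unordered pair of halfspaces.\<close>

definition sides :: "'a set \<Rightarrow> 'a set set" where
  "sides e = {W a b | a b. e = {a, b} \<and> a \<sim> b}"

lemma sides_edge: "a \<sim> b \<Longrightarrow> sides {a, b} = {W a b, W b a}"
  unfolding sides_def using adj_sym by (auto 0 3 simp: doubleton_eq_iff)

lemma sides_Theta0: "(e, f) \<in> Theta0 G \<Longrightarrow> sides e = sides f"
proof -
  assume "(e, f) \<in> Theta0 G"
  then obtain u v x y where *: "e = {u, v}" "f = {x, y}" "four_cycle G u v y x"
    by (auto simp: Theta0_def)
  then have "u \<sim> v" "x \<sim> y" "four_cycle G v u x y"
    by (auto simp: four_cycle_def adj_commute)
  then show ?thesis
    using * W_square(1)[of u v y x] W_square(1)[of v u x y] by (simp add: sides_edge)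
qed

lemma sides_Theta: "(e, f) \<in> (Theta0 G)\<^sup>* \<Longrightarrow> sides e = sides f"
  by (induction rule: rtrancl_induct) (auto dest: sides_Theta0)

section \<open>Classes of edges and their halfspaces\<close>

lemma Theta0_sym: "sym (Theta0 G)"
proof (rule symI)
  fix e f assume "(e, f) \<in> Theta0 G"
  then obtain u v x y where *: "e = {u, v}" "f = {x, y}" "four_cycle G u v y x"
    by (auto simp: Theta0_def)
  then have "four_cycle G x y v u" by (auto simp: four_cycle_def adj_commute)
  then show "(f, e) \<in> Theta0 G" using * by (auto simp: Theta0_def)
qed

lemma equiv_Theta: "equiv UNIV ((Theta0 G)\<^sup>*)"
  using Theta0_sym by (auto simp: equiv_def refl_on_def intro: sym_rtrancl trans_rtrancl)

abbreviation cls :: "'a set \<Rightarrow> 'a set set" where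
  "cls e \<equiv> (Theta0 G)\<^sup>* `` {e}"

lemma cls_eq_iff: "cls e = cls f \<longleftrightarrow> (e, f) \<in> (Theta0 G)\<^sup>*"
  by (rule eq_equiv_class_iff[OF equiv_Theta]) auto

lemma cls_eqI: "f \<in> cls e \<Longrightarrow> cls f = cls e"
  using cls_eq_iff by blast

lemma Theta0_uedges: "(e, f) \<in> Theta0 G \<Longrightarrow> f \<in> uedges G"
  unfolding Theta0_def four_cycle_def uedges_def using adj_sym by blast

lemma Theta_uedges: "(e, f) \<in> (Theta0 G)\<^sup>* \<Longrightarrow> e \<in> uedges G \<Longrightarrow> f \<in> uedges G"
  by (induction rule: rtrancl_induct) (auto dest: Theta0_uedges)

lemma Theta_classes_iff: "E \<in> Theta_classes G \<longleftrightarrow> (\<exists>a b. a \<sim> b \<and> E = cls {a, b})"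
  by (auto simp: Theta_classes_def quotient_def uedges_def)

lemma mem_class:
  assumes "E \<in> Theta_classes G" "{a, b} \<in> E"
  shows "a \<sim> b" "E = cls {a, b}"
proof -
  obtain x y where xy: "x \<sim> y" "E = cls {x, y}" using assms Theta_classes_iff by blast
  then show "E = cls {a, b}" using cls_eqI[of "{a, b}" "{x, y}"] assms(2) by simp
  have "({x, y}, {a, b}) \<in> (Theta0 G)\<^sup>*" "{x, y} \<in> uedges G"
    using xy assms(2) by (auto simp: uedges_def)
  then have "{a, b} \<in> uedges G" by (rule Theta_uedges)
  then obtain u v where "{a, b} = {u, v}" "u \<sim> v" by (auto simp: uedges_def)
  then show "a \<sim> b" using adj_sym[of u v] by (auto simp: doubleton_eq_iff)
qed

lemma cls_square:
  assumes "four_cycle G a b c e"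
  shows "cls {a, b} = cls {e, c}" "cls {a, e} = cls {b, c}"
proof -
  have "four_cycle G a e c b" using assms by (auto simp: four_cycle_def adj_commute)
  then have "({a, b}, {e, c}) \<in> Theta0 G" "({a, e}, {b, c}) \<in> Theta0 G"
    using assms unfolding Theta0_def by blast+
  then show "cls {a, b} = cls {e, c}" "cls {a, e} = cls {b, c}"
    unfolding cls_eq_iff by auto
qed

text \<open>Converse of the invariance of \<open>sides\<close>: crossing the split of
  \<open>ab\<close> forces membership in the class. A neighbour \<open>a'\<close> of
  \<open>a\<close> closer to \<open>p\<close> and a vertex \<open>b'\<close> given by the quadrangle
  condition complete \<open>ab\<close> to a square, whose opposite edge \<open>a'b'\<close> is
  closer to \<open>pq\<close>.\<close>

lemma Theta_if_separated:
  assumes "a \<sim> b" "p \<sim> q" "p \<in> W a b" "q \<in> W b a"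
  shows "cls {a, b} = cls {p, q}"
  using assms
proof (induction "d p a" arbitrary: a b)
  case (0 a b)
  have V: "a \<in> V" "b \<in> V" "p \<in> V" "q \<in> V"
    using adj_V(1)[OF 0(2)] adj_V(2)[OF 0(2)] adj_V(1)[OF 0(3)] adj_V(2)[OF 0(3)] .
  have pa: "p = a" using 0(1) d_0[OF V(3,1)] by simp
  moreover have "d q b < d q a" using 0(5) by (simp add: W_def)
  moreover have "d q a = 1" using d_adj[OF adj_sym[OF 0(3)]] pa by simp
  ultimately show ?case using d_0[OF V(4,2)] by simp
next
  case (Suc k a b)
  note ab = Suc(3) and pq = Suc(4)
  have V: "a \<in> V" "b \<in> V" "p \<in> V" "q \<in> V"
    using adj_V(1)[OF ab] adj_V(2)[OF ab] adj_V(1)[OF pq] adj_V(2)[OF pq] .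
  have W: "d p a < d p b" "d q b < d q a" using Suc(5,6) by (simp_all add: W_def)
  have pa: "d p a = Suc k" using Suc(2) by simp
  have pb: "d p b = Suc (Suc k)"
    using d_edge[OF ab V(3)] W pa by linarith
  have qa: "d q a = Suc (d q b)"
    using d_edge[OF ab V(4)] W by linarith
  have s: "d a p = d p a" "d b p = d p b" "d a q = d q a" "d b q = d q b" using d_sym V by blast+
  have qb: "d q b = Suc k" "d q a = Suc (Suc k)"
    using d_edge[OF pq V(1)] d_edge[OF pq V(2)] s pa pb qa by linarith+
  have "a \<noteq> p" using pa d_0[OF V(3,1)] by auto
  then obtain a' where a': "a \<sim> a'" "d a p = Suc (d a' p)" using step_towards V by metis
  have V': "a' \<in> V" using adj_V(2)[OF a'(1)] .
  have s': "d a' p = d p a'" "d a' q = d q a'" using d_sym V V' by blast+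
  have pa': "d p a' = k" using a'(2) s s' pa by simp
  have qa': "d q a' = Suc k"
    using d_edge[OF a'(1) V(4)] d_edge[OF pq V'] qb pa' s' by linarith
  have "a' \<noteq> b" using pa' pb by auto
  \<comment> \<open>\<open>a'\<close> and \<open>b\<close> both have distance \<open>Suc k\<close>
    from \<open>q\<close>, one less than their common neighbour \<open>a\<close>.\<close>
  then obtain b' where b': "b' \<sim> a'" "b' \<sim> b" "d q a' = Suc (d q b')"
    using quadrangle[OF adj_sym[OF a'(1)] adj_sym[OF ab] _ V(4)] qa' qb by metis
  have Vb: "b' \<in> V" using adj_V(1)[OF b'(1)] .
  have sb: "d b' p = d p b'" "d b' q = d q b'" using d_sym V Vb by blast+
  have qb': "d q b' = k" using b'(3) qa' by simp
  then have ne: "a \<noteq> b'" "a \<noteq> b" "a \<noteq> a'" "b \<noteq> b'" "b' \<noteq> a'"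
    using qb adj_irrefl[OF ab] adj_irrefl[OF a'(1)] adj_irrefl[OF b'(1)] adj_irrefl[OF b'(2)] by auto
  have "four_cycle G a b b' a'"
    unfolding four_cycle_def
    using ab adj_sym[OF b'(2)] b'(1) adj_sym[OF a'(1)] ne \<open>a' \<noteq> b\<close> by simp
  then have "cls {a, b} = cls {a', b'}" by (rule cls_square)
  moreover have "d p b' = Suc k"
    using d_edge[OF pq Vb] d_edge[OF b'(1) V(3)] d_edge[OF b'(2) V(3)] sb qb' pa' pb by linarith
  then have "p \<in> W a' b'" "q \<in> W b' a'" using V qa' qb' pa' by (simp_all add: W_def)
  ultimately show ?case
    using Suc.hyps(1)[of a' b'] pa' adj_sym[OF b'(1)] pq by simp
qed

text \<open>The halfspaces tell the edges apart: \<open>v\<close> lies in \<open>W u w\<close> but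
  not in \<open>W u v\<close>, and \<open>u\<close> lies in \<open>W u v\<close> but not in
  \<open>W w u\<close>.\<close>

lemma cls_nbr_inj:
  assumes "u \<sim> v" "u \<sim> w" "cls {u, v} = cls {u, w}"
  shows "v = w"
proof (rule ccontr)
  assume "v \<noteq> w"
  have "sides {u, v} = sides {u, w}" using assms(3) sides_Theta cls_eq_iff by blast
  then have "W u v = W u w \<or> W u v = W w u" using sides_edge assms by auto
  moreover have "d v u = 1" "d v w = 2" using d_adj d_common_nbr[of v u w] adj_sym assms \<open>v \<noteq> w\<close> by blast+
  then have "v \<in> W u w" using assms adj_V by (auto simp: W_def)
  ultimately show False using W_ends assms by blast
qed

end

section \<open>Vertices as sets of classes\<close>

locale based_median = median G for G :: "'a pair_pre_digraph" +
  fixes v0 :: 'a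
  assumes v0_V: "v0 \<in> V"
begin

abbreviation lev :: "'a \<Rightarrow> nat" where "lev \<equiv> d v0"

definition lower :: "'a \<Rightarrow> 'a \<Rightarrow> bool" where
  "lower w t \<longleftrightarrow> w \<sim> t \<and> lev w < lev t"

definition X :: "'a \<Rightarrow> 'a set set set" where
  "X u = {E \<in> Theta_classes G. \<exists>a b. {a, b} \<in> E \<and> a \<sim> b \<and> v0 \<in> W a b \<and> u \<in> W b a}"

lemma lowerD:
  assumes "lower w t"
  shows "w \<sim> t" "t \<sim> w" "w \<in> V" "t \<in> V" "lev t = Suc (lev w)" "v0 \<in> W w t" "w \<noteq> t"
proof -
  show *: "w \<sim> t" using assms by (simp add: lower_def)
  show "t \<sim> w" using adj_sym[OF *] .
  show "w \<in> V" "t \<in> V" using adj_V[OF *] .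
  show "lev t = Suc (lev w)" using d_edge[OF * v0_V] assms by (auto simp: lower_def)
  then show "v0 \<in> W w t" using v0_V by (simp add: W_def)
  show "w \<noteq> t" using adj_irrefl[OF *] .
qed

lemma lower_cases:
  assumes "u \<sim> w" obtains "lower u w" | "lower w u"
  using d_edge[OF assms v0_V] adj_sym[OF assms] assms unfolding lower_def by linarith

lemma X_cls:
  assumes "a \<sim> b" "v0 \<in> W a b" "u \<in> V"
  shows "cls {a, b} \<in> X u \<longleftrightarrow> u \<in> W b a"
proof
  assume "cls {a, b} \<in> X u"
  then obtain c e where *: "{c, e} \<in> cls {a, b}" "c \<sim> e" "v0 \<in> W c e" "u \<in> W e c"
    by (auto simp: X_def)
  then have "sides {a, b} = sides {c, e}" using sides_Theta by blast
  then have "W c e = W a b \<or> W c e = W b a"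
    using sides_edge[OF assms(1)] sides_edge[OF *(2)] by auto
  then have "W c e = W a b" using * assms W_compl[OF assms(1)] by auto
  then show "u \<in> W b a" using * W_compl[OF assms(1)] W_compl[OF *(2)] by simp
next
  assume "u \<in> W b a"
  moreover have "cls {a, b} \<in> Theta_classes G" using assms Theta_classes_iff by blast
  ultimately show "cls {a, b} \<in> X u" using assms unfolding X_def by blast
qed

lemma class_oriented:
  assumes "E \<in> Theta_classes G"
  obtains c e where "c \<sim> e" "E = cls {c, e}" "v0 \<in> W c e"
proof -
  obtain a b where *: "a \<sim> b" "E = cls {a, b}" using assms Theta_classes_iff by blast
  show thesis
  proof (cases "v0 \<in> W a b")
    case False
    then have "v0 \<in> W b a" using W_compl[OF *(1)] v0_V by blast
    then show thesis using that[of b a] * adj_sym[OF *(1)] by (simp add: insert_commute)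
  qed (use * that in blast)
qed

lemma X_sub: "X u \<subseteq> Theta_classes G"
  by (auto simp: X_def)

text \<open>A class other than that of \<open>wt\<close> cannot have \<open>w\<close> and
  \<open>t\<close> on different sides, since \<open>wt\<close> would then belong to it by
  \<open>Theta_if_separated\<close>.\<close>

lemma X_lower:
  assumes "lower w t"
  shows "X t = insert (cls {w, t}) (X w)" "cls {w, t} \<notin> X w"
proof -
  note l = lowerD[OF assms]
  show n: "cls {w, t} \<notin> X w"
    using X_cls[OF l(1,6,3)] W_ends[OF l(1)] by blast
  have t: "cls {w, t} \<in> X t"
    using X_cls[OF l(1,6,4)] W_ends[OF l(1)] by blast
  have "E \<in> X t \<longleftrightarrow> E \<in> X w" if E: "E \<in> Theta_classes G" "E \<noteq> cls {w, t}" for E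
  proof -
    obtain c e where *: "c \<sim> e" "E = cls {c, e}" "v0 \<in> W c e" using class_oriented E by blast
    have "E \<in> X t \<longleftrightarrow> t \<in> W e c" "E \<in> X w \<longleftrightarrow> w \<in> W e c"
      using X_cls[OF *(1,3)] * l by blast+
    moreover have "W e c = V - W c e" using W_compl * by blast
    moreover have "\<not> (w \<in> W c e \<and> t \<in> W e c)"
      using Theta_if_separated[OF *(1) l(1)] E * by metis
    moreover have "\<not> (t \<in> W c e \<and> w \<in> W e c)"
      using Theta_if_separated[OF *(1) l(2)] E * by (metis insert_commute)
    ultimately show ?thesis using l by blast
  qed
  then show "X t = insert (cls {w, t}) (X w)" using t X_sub[of t] X_sub[of w] by blast
qed

text \<open>The first edge on a shortest path from \<open>u\<close> to \<open>v\<close> separates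
  the two vertices, so its class lies in exactly one of \<open>X u\<close> and
  \<open>X v\<close>.\<close>

lemma X_inj:
  assumes "u \<in> V" "v \<in> V" "X u = X v"
  shows "u = v"
proof (rule ccontr)
  assume "u \<noteq> v"
  then obtain w where w: "u \<sim> w" "d u v = Suc (d w v)" using step_towards assms by metis
  have wV: "w \<in> V" using adj_V[OF w(1)] by blast
  have "d v w < d v u" using w d_sym[of u v] d_sym[of w v] assms wV by simp
  then have v: "v \<in> W w u" "v \<notin> W u w" using assms by (auto simp: W_def)
  have *: "u \<in> W u w" "u \<notin> W w u" using W_ends[OF w(1)] by auto
  from w(1) show False
  proof (cases rule: lower_cases)
    case 1
    then show False using X_cls[OF lowerD(1,6)] assms v * by blast
  next
    case 2
    then show False using X_cls[OF lowerD(1,6)] assms v * by blast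
  qed
qed

text \<open>Adjacency can be read off from \<open>X\<close>, which turns later arguments about the
  graph into arguments about sets. The first step from \<open>w\<close> towards \<open>u\<close>
  crosses a class separating them; this can only be \<open>E\<close>, so by \<open>X_inj\<close> the
  step already ends in \<open>u\<close>.\<close>

lemma lower_iff_X:
  assumes "u \<in> V" "w \<in> V"
  shows "lower w u \<and> E = cls {w, u} \<longleftrightarrow> X u = insert E (X w) \<and> E \<notin> X w"
proof
  assume *: "X u = insert E (X w) \<and> E \<notin> X w"
  then have "w \<noteq> u" by auto
  then obtain x where x: "w \<sim> x" "d w u = Suc (d x u)" using step_towards assms by metis
  have xV: "x \<in> V" using adj_V[OF x(1)] by blast
  have "d u x < d u w" using x d_sym[of w u] d_sym[of x u] assms xV by simp
  then have u: "u \<in> W x w" "u \<notin> W w x" using assms by (auto simp: W_def)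
  from x(1) show "lower w u \<and> E = cls {w, u}"
  proof (cases rule: lower_cases)
    case 1
    have "cls {w, x} \<in> X u" using X_cls[OF lowerD(1,6)[OF 1] assms(1)] u by blast
    then have "E = cls {w, x}" "X x = X u" using X_lower[OF 1] * by auto
    then show ?thesis using 1 X_inj xV assms by metis
  next
    case 2
    have "cls {x, w} \<notin> X u" using X_cls[OF lowerD(1,6)[OF 2] assms(1)] u by blast
    then show ?thesis using X_lower[OF 2] * by blast
  qed
qed (use X_lower in blast)

section \<open>Incoming and outgoing classes and the cubes they span\<close>

definition In :: "'a \<Rightarrow> 'a set set set" where
  "In t = {E. \<exists>w. lower w t \<and> E = cls {w, t}}"

definition Out :: "'a \<Rightarrow> 'a set set set" where
  "Out u = {E. \<exists>x. lower u x \<and> E = cls {u, x}}"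

lemma In_iff:
  assumes "t \<in> V"
  shows "E \<in> In t \<longleftrightarrow> E \<in> X t \<and> (\<exists>w \<in> V. X w = X t - {E})"
proof -
  have "E \<in> In t \<longleftrightarrow> (\<exists>w \<in> V. X t = insert E (X w) \<and> E \<notin> X w)"
  proof
    assume "E \<in> In t"
    then obtain w where "lower w t" "E = cls {w, t}" by (auto simp: In_def)
    then show "\<exists>w \<in> V. X t = insert E (X w) \<and> E \<notin> X w"
      using X_lower[of w t] lowerD(3)[of w t] by blast
  next
    assume "\<exists>w \<in> V. X t = insert E (X w) \<and> E \<notin> X w"
    then obtain w where "w \<in> V" "X t = insert E (X w) \<and> E \<notin> X w" by blast
    then have "lower w t \<and> E = cls {w, t}" using lower_iff_X[OF assms, of w E] by blast
    then show "E \<in> In t" unfolding In_def by blast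
  qed
  moreover have "X t = insert E (X w) \<and> E \<notin> X w \<longleftrightarrow> E \<in> X t \<and> X w = X t - {E}" for w
    by blast
  ultimately show ?thesis by blast
qed

lemma Out_iff:
  assumes "u \<in> V"
  shows "E \<in> Out u \<longleftrightarrow> E \<notin> X u \<and> (\<exists>x \<in> V. X x = insert E (X u))"
proof
  assume "E \<in> Out u"
  then obtain x where "lower u x" "E = cls {u, x}" by (auto simp: Out_def)
  then show "E \<notin> X u \<and> (\<exists>x \<in> V. X x = insert E (X u))"
    using X_lower[of u x] lowerD(4)[of u x] by blast
next
  assume "E \<notin> X u \<and> (\<exists>x \<in> V. X x = insert E (X u))"
  then obtain x where "x \<in> V" "X x = insert E (X u) \<and> E \<notin> X u" by blast
  then have "lower u x \<and> E = cls {u, x}" using lower_iff_X[of x u E] assms by blast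
  then show "E \<in> Out u" unfolding Out_def by blast
qed

lemma InI: "E \<in> X t \<Longrightarrow> w \<in> V \<Longrightarrow> X w = X t - {E} \<Longrightarrow> t \<in> V \<Longrightarrow> E \<in> In t"
  by (subst In_iff) auto

lemma InE:
  assumes "E \<in> In t" "t \<in> V"
  obtains w where "w \<in> V" "X w = X t - {E}" "E \<in> X t"
  using assms(1) unfolding In_iff[OF assms(2)] by auto

lemma OutI: "E \<notin> X u \<Longrightarrow> x \<in> V \<Longrightarrow> X x = insert E (X u) \<Longrightarrow> u \<in> V \<Longrightarrow> E \<in> Out u"
  by (subst Out_iff) auto

lemma OutE:
  assumes "E \<in> Out u" "u \<in> V"
  obtains x where "x \<in> V" "X x = insert E (X u)" "E \<notin> X u"
  using assms(1) unfolding Out_iff[OF assms(2)] by auto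

lemma In_sub: "In t \<subseteq> X t"
  unfolding In_def using X_lower(1) by blast

lemma cls_lower: "lower w t \<Longrightarrow> cls {w, t} \<in> Theta_classes G"
  using Theta_classes_iff lowerD(1) by blast

lemma In_classes: "In t \<subseteq> Theta_classes G" and Out_classes: "Out u \<subseteq> Theta_classes G"
  using cls_lower by (auto simp: In_def Out_def)

lemma lower_inj: "lower w t \<Longrightarrow> lower r t \<Longrightarrow> cls {w, t} = cls {r, t} \<Longrightarrow> w = r"
  using cls_nbr_inj[of t w r] lowerD(2) by (simp add: insert_commute)

lemma lower_quadrangle:
  assumes "lower w t" "lower r t" "w \<noteq> r"
  obtains b where "lower b w" "lower b r"
proof -
  note w = lowerD[OF assms(1)] and r = lowerD[OF assms(2)]
  obtain b where b: "b \<sim> w" "b \<sim> r" "lev w = Suc (lev b)"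
    using quadrangle[OF w(1) r(1) assms(3) v0_V w(5) r(5)] by blast
  then show thesis using that[of b] w(5) r(5) by (simp add: lower_def)
qed

lemma lower_square:
  assumes "lower w t" "lower r t" "w \<noteq> r" "lower b w" "lower b r"
  shows "four_cycle G t w b r" "cls {w, t} = cls {b, r}" "cls {r, t} = cls {b, w}"
proof -
  note l = lowerD[OF assms(1)] lowerD[OF assms(2)] lowerD[OF assms(4)] lowerD[OF assms(5)]
  have "t \<noteq> b" using l(5,19) by auto
  then show *: "four_cycle G t w b r" using l assms(3) by (auto simp: four_cycle_def)
  show "cls {w, t} = cls {b, r}" "cls {r, t} = cls {b, w}"
    using cls_square[OF *] by (simp_all add: insert_commute)
qed

lemma In_square:
  assumes "E \<in> In t" "F \<in> In t" "E \<noteq> F"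
  shows "\<exists>b \<in> V. X b = X t - {E, F}" "orthogonal G E F"
proof -
  obtain w r where wr: "lower w t" "E = cls {w, t}" "lower r t" "F = cls {r, t}"
    using assms by (auto simp: In_def)
  then have "w \<noteq> r" using assms by blast
  then obtain b where b: "lower b w" "lower b r" using lower_quadrangle wr by blast
  note sq = lower_square[OF wr(1,3) \<open>w \<noteq> r\<close> b]
  have "X b = X t - {E, F}"
    using X_lower[OF wr(1)] X_lower[OF b(1)] sq wr by auto
  then show "\<exists>b \<in> V. X b = X t - {E, F}" using lowerD(3)[OF b(1)] by blast
  have "{t, w} \<in> E" "{r, b} \<in> E" "{t, r} \<in> F" "{w, b} \<in> F"
    using sq(2,3) wr by (auto simp: insert_commute)
  then show "orthogonal G E F" unfolding orthogonal_def using sq(1) by blast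
qed

text \<open>A step down along \<open>E\<close> keeps the other classes of \<open>S\<close> incoming,
  because \<open>In_square\<close> provides the vertex where both are removed. So every subset of
  \<open>In t\<close> spans a cube with top \<open>t\<close>; the vertex found is its
  bottom.\<close>

lemma down:
  assumes "finite S" "S \<subseteq> In t" "t \<in> V"
  shows "\<exists>u \<in> V. X u = X t - S"
  using assms
proof (induction S arbitrary: t rule: finite_induct)
  case (insert E S)
  obtain w where w: "w \<in> V" "X w = X t - {E}"
    by (rule InE[of E t]) (use insert.prems in auto)
  have "S \<subseteq> In w"
  proof
    fix F assume F: "F \<in> S"
    then have "F \<noteq> E" "F \<in> In t" using insert by auto
    then obtain b where "b \<in> V" "X b = X t - {E, F}" "F \<in> X t"
      using In_square(1)[of E t F] insert.prems(1) In_sub[of t] by auto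
    then show "F \<in> In w" using InI[of F w b] w \<open>F \<noteq> E\<close> by auto
  qed
  then obtain u where "u \<in> V" "X u = X w - S" using insert.IH w(1) by blast
  then show ?case using w by blast
qed auto

text \<open>Orthogonality is witnessed by a square anywhere in the graph. As seen from
  \<open>u\<close>, one corner \<open>z\<close> of it lies across both classes, and the quadrangle
  condition towards \<open>z\<close> yields a square at \<open>u\<close> itself.\<close>

lemma orthogonal_corner:
  assumes "orthogonal G E F" "E \<in> Theta_classes G" "F \<in> Theta_classes G"
    and "u \<sim> x" "E = cls {u, x}" "u \<sim> w" "F = cls {u, w}"
  obtains y where "y \<sim> x" "y \<sim> w" "y \<noteq> u" "x \<noteq> w"
proof -
  obtain a b c e where c4: "four_cycle G a b c e"
    and mem: "{a, b} \<in> E" "{e, c} \<in> E" "{a, e} \<in> F" "{b, c} \<in> F"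
    using assms(1) unfolding orthogonal_def by blast
  have cl: "E = cls {a, b}" "F = cls {a, e}" using mem_class(2) assms(2,3) mem by blast+
  have ab: "a \<sim> b" and ae: "a \<sim> e" and ne: "b \<noteq> e" and ec: "e \<sim> c" and bc: "b \<sim> c"
    using c4 adj_sym[of e a] adj_sym[of c e] by (auto simp: four_cycle_def)
  have "E \<noteq> F" using cls_nbr_inj[OF ab ae] ne cl by auto
  then have "x \<noteq> w" using assms by auto
  have sq: "W a b = W e c" "W a e = W b c" using W_square[OF c4] .
  have ends: "a \<in> W a b" "e \<in> W a b" "b \<in> W b a" "c \<in> W b a"
     "a \<in> W a e" "b \<in> W a e" "e \<in> W e a" "c \<in> W e a"
    using W_ends[OF ab] W_ends[OF ae] W_ends[OF ec] W_ends[OF bc] sq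
      W_compl[OF ab] W_compl[OF ae] W_compl[OF ec] W_compl[OF bc] by auto
  have "sides {a, b} = sides {u, x}" "sides {a, e} = sides {u, w}"
    using sides_Theta cl assms(5,7) by blast+
  then have "{W a b, W b a} = {W u x, W x u}" "{W a e, W e a} = {W u w, W w u}"
    using sides_edge ab ae assms(4,6) by metis+
  then have "W x u = W a b \<or> W x u = W b a" "W w u = W a e \<or> W w u = W e a"
    by (metis doubleton_eq_iff)+
  \<comment> \<open>The four corners realise all four combinations of sides.\<close>
  then obtain z where z: "z \<in> W x u" "z \<in> W w u" using ends by blast
  then have zV: "z \<in> V" by (simp add: W_def)
  have "d z u = Suc (d z x)" "d z u = Suc (d z w)"
    using d_edge[OF assms(4) zV] d_edge[OF assms(6) zV] z by (auto simp: W_def)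
  then obtain y where y: "y \<sim> x" "y \<sim> w" "d z x = Suc (d z y)"
    using quadrangle[OF adj_sym[OF assms(4)] adj_sym[OF assms(6)] \<open>x \<noteq> w\<close> zV] by blast
  have "y \<noteq> u" using y \<open>d z u = Suc (d z x)\<close> by auto
  then show thesis using that y \<open>x \<noteq> w\<close> by blast
qed

lemma Out_square:
  assumes "E \<in> Out u" "F \<in> Out u" "orthogonal G E F"
  shows "\<exists>y \<in> V. X y = insert E (insert F (X u))"
proof -
  obtain x w where xw: "lower u x" "E = cls {u, x}" "lower u w" "F = cls {u, w}"
    using assms by (auto simp: Out_def)
  note lx = lowerD[OF xw(1)] and lw = lowerD[OF xw(3)]
  have "E \<in> Theta_classes G" "F \<in> Theta_classes G" using assms Out_classes by blast+
  then obtain y where y: "y \<sim> x" "y \<sim> w" "y \<noteq> u" "x \<noteq> w"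
    using orthogonal_corner[OF assms(3) _ _ lx(1) xw(2) lw(1) xw(4)] by blast
  from y(1) have yx: "lower x y"
  proof (cases rule: lower_cases)
    case 1
    \<comment> \<open>If \<open>y\<close> were below \<open>x\<close>, then \<open>x\<close> and
      \<open>w\<close> would both be peaks over \<open>u\<close> and \<open>y\<close>.\<close>
    then have False
      using no_double_peak[OF lx(1) y(1) lw(1) y(2) _ y(4) v0_V lx(5) _ lw(5)] y(3) lowerD(5) by blast
    then show ?thesis ..
  qed
  have yw: "lower w y"
    using lx(5) lw(5) lowerD(5)[OF yx] adj_sym[OF y(2)] by (simp add: lower_def)
  have "cls {w, y} = cls {u, x}" "cls {x, y} = cls {u, w}"
    using lower_square[OF yx yw y(4) xw(1,3)] by simp_all
  then have "X y = insert E (insert F (X u))"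
    using X_lower(1)[OF yx] X_lower(1)[OF xw(1)] xw by auto
  then show ?thesis using lowerD(4)[OF yx] by blast
qed

text \<open>The square spanned at \<open>u\<close> by \<open>E\<close> and \<open>F\<close> has top
  \<open>x\<close>, and its edge opposite to \<open>wu\<close> enters \<open>x\<close>. This makes
  orthogonality a lookup among the classes incoming into \<open>x\<close>.\<close>

lemma In_Out:
  assumes "E \<in> Out u" "F \<in> In u" "x \<in> V" "u \<in> V" "X x = insert E (X u)"
  shows "orthogonal G E F \<longleftrightarrow> F \<in> In x"
proof
  have "E \<notin> X u" using assms Out_iff by blast
  then have xl: "lower u x" "E = cls {u, x}"
    using lower_iff_X[of x u E] assms by blast+
  obtain w where wl: "lower w u" "F = cls {w, u}" using assms by (auto simp: In_def)
  note lx = lowerD[OF xl(1)] and lw = lowerD[OF wl(1)]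
  {
    assume o: "orthogonal G E F"
    have "E \<in> Theta_classes G" "F \<in> Theta_classes G" "F = cls {u, w}"
      using assms Out_classes[of u] In_classes[of u] wl(2) by (auto simp: insert_commute[of u])
    then obtain y where y: "y \<sim> x" "y \<sim> w" "y \<noteq> u" "x \<noteq> w"
      using orthogonal_corner[OF o _ _ lx(1) xl(2) lw(2)] by blast
    have yx: "lower y x"
      unfolding lower_def
      using d_edge[OF y(1) v0_V] d_edge[OF y(2) v0_V] lx(5) lw(5) y(1) by linarith
    have wy: "lower w y"
      using adj_sym[OF y(2)] lowerD(5)[OF yx] lx(5) lw(5) by (simp add: lower_def)
    have "cls {y, x} = cls {w, u}" using lower_square[OF yx xl(1) y(3) wy wl(1)] by simp
    then show "F \<in> In x" using wl yx by (auto simp: In_def)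
  next
    assume "F \<in> In x"
    moreover have "E \<in> In x" using xl by (auto simp: In_def)
    moreover have "E \<noteq> F" using \<open>E \<notin> X u\<close> assms In_sub by blast
    ultimately show "orthogonal G E F" using In_square(2) by blast
  }
qed

text \<open>Dual to \<open>down\<close>, with \<open>Out_square\<close> in place of
  \<open>In_square\<close>. Outgoing classes need not be orthogonal, whence the assumption.\<close>

lemma up:
  assumes "finite L" "L \<subseteq> Out u" "pairwise (orthogonal G) L" "u \<in> V"
  shows "\<exists>t \<in> V. X t = X u \<union> L"
  using assms
proof (induction L arbitrary: u rule: finite_induct)
  case (insert E L)
  obtain x where x: "x \<in> V" "X x = insert E (X u)"
    by (rule OutE[of E u]) (use insert.prems in auto)
  have "L \<subseteq> Out x"
  proof
    fix F assume F: "F \<in> L"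
    then have "F \<noteq> E" "F \<in> Out u" "F \<notin> X u" using insert Out_iff by auto
    moreover have "orthogonal G E F" using insert.prems(2) F \<open>F \<noteq> E\<close> by (auto simp: pairwise_def)
    ultimately show "F \<in> Out x"
      using Out_square[of E u F] insert.prems x Out_iff by (auto simp: insert_commute)
  qed
  then obtain t where "t \<in> V" "X t = X x \<union> L"

    using insert.IH[OF _ _ x(1)] insert.prems(2) unfolding pairwise_insert by meson
  then show ?case using x by blast
qed auto

lemma finite_Theta_classes: "finite (Theta_classes G)"
proof -
  have "Theta_classes G = (\<lambda>(a, b). cls {a, b}) ` parcs G" using Theta_classes_iff by auto
  then show ?thesis using finite_parcs by simp
qed

lemma finite_In: "finite (In t)" and finite_Out: "finite (Out t)"
  using finite_subset[OF In_classes finite_Theta_classes]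
    finite_subset[OF Out_classes finite_Theta_classes] by simp_all

section \<open>POFs as cubes with a given top or bottom\<close>

lemma POF_In: "L \<subseteq> In t \<Longrightarrow> POF G L"
  unfolding POF_def pairwise_def using In_classes In_square(2) by blast

lemma incoming_iff:
  shows "POF G L \<and> incoming G v0 L u \<longleftrightarrow> L \<subseteq> In u"
proof
  assume *: "POF G L \<and> incoming G v0 L u"
  show "L \<subseteq> In u"
  proof
    fix E assume "E \<in> L"
    then obtain w where "w \<sim> u" "{w, u} \<in> E" "lev w < lev u" "E \<in> Theta_classes G"
      using * by (auto simp: incoming_def POF_def)
    then show "E \<in> In u" using mem_class(2) by (auto simp: In_def lower_def)
  qed
next
  assume *: "L \<subseteq> In u"
  then have "incoming G v0 L u" unfolding incoming_def In_def lower_def by fastforce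
  then show "POF G L \<and> incoming G v0 L u" using POF_In * by blast
qed

lemma outgoing_iff:
  assumes "POF G L"
  shows "outgoing G v0 L u \<longleftrightarrow> L \<subseteq> Out u"
proof
  assume *: "outgoing G v0 L u"
  show "L \<subseteq> Out u"
  proof
    fix E assume "E \<in> L"
    then obtain w where "u \<sim> w" "{u, w} \<in> E" "lev u < lev w" "E \<in> Theta_classes G"
      using * assms by (auto simp: outgoing_def POF_def)
    then show "E \<in> Out u" using mem_class(2) by (auto simp: Out_def lower_def)
  qed
next
  assume *: "L \<subseteq> Out u"
  then show "outgoing G v0 L u" unfolding outgoing_def Out_def lower_def by fastforce
qed

text \<open>An outgoing POF has a top by \<open>up\<close>, and \<open>up\<close> applied to
  \<open>L - {E}\<close> shows that \<open>E\<close> enters this top. Conversely,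
  \<open>down\<close> applied to \<open>L - {E}\<close> gives the edge that leaves \<open>u\<close>
  along \<open>E\<close>.\<close>

lemma outgoing_POF_iff:
  assumes "u \<in> V"
  shows "POF G L \<and> outgoing G v0 L u \<longleftrightarrow> (\<exists>t \<in> V. L \<subseteq> In t \<and> X u = X t - L)"
proof
  assume *: "POF G L \<and> outgoing G v0 L u"
  then have L: "L \<subseteq> Out u" "pairwise (orthogonal G) L" "L \<subseteq> Theta_classes G"
    using outgoing_iff by (auto simp: POF_def)
  have fin: "finite L" using L finite_Theta_classes finite_subset by blast
  obtain t where t: "t \<in> V" "X t = X u \<union> L" using up[OF fin L(1,2) assms] by blast
  have dis: "L \<inter> X u = {}" using L Out_iff[OF assms] by blast
  have "L \<subseteq> In t"
  proof
    fix E assume "E \<in> L"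
    then obtain w where "w \<in> V" "X w = X u \<union> (L - {E})"
      using up[of "L - {E}" u] fin L assms pairwise_subset by (metis Diff_subset finite_Diff subset_trans)
    moreover have "X u \<union> (L - {E}) = X t - {E}" using t dis \<open>E \<in> L\<close> by blast
    ultimately show "E \<in> In t" using InI[of E t w] t \<open>E \<in> L\<close> by simp
  qed
  then show "\<exists>t \<in> V. L \<subseteq> In t \<and> X u = X t - L" using t dis by blast
next
  assume "\<exists>t \<in> V. L \<subseteq> In t \<and> X u = X t - L"
  then obtain t where t: "t \<in> V" "L \<subseteq> In t" "X u = X t - L" by blast
  have "L \<subseteq> Out u"
  proof
    fix E assume E: "E \<in> L"
    have "finite (L - {E})" using t finite_In finite_subset by blast
    then obtain x where "x \<in> V" "X x = X t - (L - {E})" using down[of "L - {E}" t] t by blast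
    moreover have "X t - (L - {E}) = insert E (X u)" using t E In_sub by blast
    ultimately show "E \<in> Out u" using OutI[of E u x] t E assms by simp
  qed
  then show "POF G L \<and> outgoing G v0 L u" using outgoing_iff POF_In t by blast
qed

text \<open>\<open>E\<close> enters \<open>x\<close>. If \<open>L\<close> enters \<open>x\<close> as
  well, then \<open>insert E L\<close> consists of classes incoming into one vertex and is a POF;
  the other direction is \<open>In_Out\<close>.\<close>

lemma POF_insert_iff:
  assumes "u \<in> V" "L \<subseteq> In u" "x \<in> V" "X x = insert E (X u)" "E \<notin> X u"
  shows "POF G (insert E L) \<longleftrightarrow> L \<subseteq> In x"
proof
  have E: "E \<in> Out u" "E \<in> In x"
    by (rule OutI[OF assms(5,3,4,1)]) (rule InI[of E x u], use assms in simp_all)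
  {
    assume "POF G (insert E L)"
    then have "orthogonal G E F" if "F \<in> L" for F
      using that assms(2,5) In_sub[of u] by (auto simp: POF_def pairwise_def)
    then show "L \<subseteq> In x" using In_Out[OF E(1)] assms by blast
  next
    assume "L \<subseteq> In x"
    then show "POF G (insert E L)" using E POF_In[of "insert E L" x] by blast
  }
qed

end

section \<open>Labels of classes, and cubes as induced subgraphs\<close>

context based_median
begin

lemma lowerI: "w \<sim> t \<Longrightarrow> lev t = Suc (lev w) \<Longrightarrow> lower w t"
  by (simp add: lower_def)

lemma X_down: "lower w t \<Longrightarrow> X w = X t - {cls {w, t}}"
  using X_lower by simp

lemma lower_if_X:
  assumes "u \<in> V" "w \<in> V" "X w = X u - {E}" "E \<in> X u"
  shows "lower w u"
proof -
  have "X u = insert E (X w) \<and> E \<notin> X w" using assms(3,4) by (simp add: insert_absorb)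
  then show ?thesis using lower_iff_X[OF assms(1,2)] by blast
qed

text \<open>Neighbouring levels differ by one and the last two assumptions exclude the two
  alternating patterns. What remains has its highest and lowest corner opposite to each other; the
  cases are ordered by the highest corner.\<close>

lemma four_cycle_levels:
  fixes a b c e :: nat
  assumes "a = Suc b \<or> b = Suc a" "b = Suc c \<or> c = Suc b" "c = Suc e \<or> e = Suc c" "e = Suc a \<or> a = Suc e"
    and "\<not> (b = Suc a \<and> b = Suc c \<and> e = Suc a)" "\<not> (a = Suc b \<and> a = Suc e \<and> c = Suc b)"
  obtains "a = Suc b" "a = Suc e" "b = Suc c" "e = Suc c"
  | "b = Suc a" "b = Suc c" "a = Suc e" "c = Suc e"
  | "c = Suc b" "c = Suc e" "b = Suc a" "e = Suc a"
  | "e = Suc a" "e = Suc c" "a = Suc b" "c = Suc b"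
proof -
  consider "a = Suc b" "b = Suc c" | "a = Suc b" "c = Suc b" | "b = Suc a" "b = Suc c" | "b = Suc a" "c = Suc b"
    using assms(1,2) by blast
  then show thesis
  proof cases
    case 1
    then have "e = Suc c" using assms(3,4) by (elim disjE) simp_all
    then show thesis using 1 that(1) by simp
  next
    case 2
    then have "e = Suc a" using assms(4,6) by blast
    then show thesis using 2 that(4) by simp
  next
    case 3
    then have "a = Suc e" using assms(4,5) by blast
    then show thesis using 3 that(2) by simp
  next
    case 4
    then have "e = Suc a" using assms(3,4) by (elim disjE) simp_all
    then show thesis using 4 that(3) by simp
  qed
qed

lemma square_lower:
  assumes "four_cycle G a b c e"
  obtains "lower b a" "lower e a" "lower c b" "lower c e"
  | "lower a b" "lower c b" "lower e a" "lower e c"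
  | "lower b c" "lower e c" "lower a b" "lower a e"
  | "lower a e" "lower c e" "lower b a" "lower b c"
proof -
  have ab: "a \<sim> b" and bc: "b \<sim> c" and ce: "c \<sim> e" and ea: "e \<sim> a" and ne: "a \<noteq> c" "b \<noteq> e"
    using assms by (simp_all add: four_cycle_def)
  note s = adj_sym[OF ab] adj_sym[OF bc] adj_sym[OF ce] adj_sym[OF ea]
  have 1: "\<not> (lev b = Suc (lev a) \<and> lev b = Suc (lev c) \<and> lev e = Suc (lev a))"
    using no_double_peak[OF ab s(2) s(4) ce ne v0_V] by blast
  have 2: "\<not> (lev a = Suc (lev b) \<and> lev a = Suc (lev e) \<and> lev c = Suc (lev b))"
    using no_double_peak[OF s(1) ea bc s(3) ne(2,1) v0_V] by blast
  note d = d_edge[OF ab v0_V] d_edge[OF bc v0_V] d_edge[OF ce v0_V] d_edge[OF ea v0_V]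
  show thesis
  proof (rule four_cycle_levels[OF d 1 2])
    assume l: "lev a = Suc (lev b)" "lev a = Suc (lev e)" "lev b = Suc (lev c)" "lev e = Suc (lev c)"
    show thesis by (rule that(1)[OF lowerI[OF s(1) l(1)] lowerI[OF ea l(2)] lowerI[OF s(2) l(3)] lowerI[OF ce l(4)]])
  next
    assume l: "lev b = Suc (lev a)" "lev b = Suc (lev c)" "lev a = Suc (lev e)" "lev c = Suc (lev e)"
    show thesis by (rule that(2)[OF lowerI[OF ab l(1)] lowerI[OF s(2) l(2)] lowerI[OF ea l(3)] lowerI[OF s(3) l(4)]])
  next
    assume l: "lev c = Suc (lev b)" "lev c = Suc (lev e)" "lev b = Suc (lev a)" "lev e = Suc (lev a)"
    show thesis by (rule that(3)[OF lowerI[OF bc l(1)] lowerI[OF s(3) l(2)] lowerI[OF ab l(3)] lowerI[OF s(4) l(4)]])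
  next
    assume l: "lev e = Suc (lev a)" "lev e = Suc (lev c)" "lev a = Suc (lev b)" "lev c = Suc (lev b)"
    show thesis by (rule that(4)[OF lowerI[OF s(4) l(1)] lowerI[OF ce l(2)] lowerI[OF s(1) l(3)] lowerI[OF bc l(4)]])
  qed
qed

text \<open>
  The labelling rule: an edge with top \<open>t\<close> inherits the label of the opposite edge of some square
  below \<open>t\<close>, if there is one. Confluence follows by completing three edges below \<open>t\<close> to a cube.
\<close>

lemma label_confluent:
  fixes f :: "'a set \<Rightarrow> 'b"
  assumes rule: "\<And>t w. lower w t \<Longrightarrow> (\<forall>r. lower r t \<longrightarrow> r = w) \<or>
      (\<exists>r b. lower r t \<and> r \<noteq> w \<and> lower b w \<and> lower b r \<and> f {w, t} = f {b, r})"
    and "lower w t" "lower r t" "w \<noteq> r" "lower b w" "lower b r"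
  shows "f {w, t} = f {b, r}"
  using assms(2-)
proof (induction "lev t" arbitrary: t w r b rule: less_induct)
  case less
  obtain r' b' where r': "lower r' t" "r' \<noteq> w" "lower b' w" "lower b' r'" "f {w, t} = f {b', r'}"
    using rule[OF less.prems(1)] less.prems(2,3) by blast
  let ?E = "cls {w, t}" let ?F = "cls {r, t}" let ?H = "cls {r', t}"
  note sq = lower_square(2,3)[OF less.prems(1,2,3,4,5)]
  note sq' = lower_square(2,3)[OF less.prems(1) r'(1) r'(2)[symmetric] r'(3,4)]
  note V = lowerD(3)[OF less.prems(1)] lowerD(3)[OF less.prems(2)] lowerD(3)[OF r'(1)]
    lowerD(3)[OF less.prems(4)] lowerD(3)[OF r'(3)] lowerD(4)[OF less.prems(1)]
  show ?case
  proof (cases "r' = r")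
    case True

    \<comment> \<open>Here the two squares share three vertices, and \<open>X\<close> forces the
      fourth.\<close>
    have "X b' = X w - {cls {b', w}}" "X b = X w - {cls {b, w}}"
      using X_down r'(3) less.prems(4) by blast+
    then have "X b' = X b" using sq(2) sq'(2) True by simp
    then show ?thesis using r' True X_inj V by metis
  next
    case False
    have EFH: "?E \<noteq> ?F" "?E \<noteq> ?H" "?F \<noteq> ?H"
      using lower_inj less.prems r' False by metis+
    have mem: "?E \<in> In t" "?F \<in> In t" "?H \<in> In t" using less.prems r' by (auto simp: In_def)
    have Xs: "X w = X t - {?E}" "X r = X t - {?F}" "X r' = X t - {?H}"
      "X b = X t - {?E, ?F}" "X b' = X t - {?E, ?H}"
      using X_down[OF less.prems(1)] X_down[OF less.prems(2)] X_down[OF r'(1)]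
        X_down[OF less.prems(4)] X_down[OF r'(3)] sq(2) sq'(2) by auto
    \<comment> \<open>\<open>c\<close> is the bottom of the cube spanned by the three classes below
      \<open>t\<close>, and \<open>v\<close> is the bottom of the face spanned by \<open>?F\<close>
      and \<open>?H\<close>. Both edges to be compared are opposite to \<open>cv\<close> in squares
      with a lower top, so the induction hypothesis applies to each.\<close>
    have "\<exists>c \<in> V. X c = X t - {?E, ?F, ?H}" "\<exists>v \<in> V. X v = X t - {?F, ?H}"
      by (rule down; use mem V in simp)+
    then obtain c v where c: "c \<in> V" "X c = X t - {?E, ?F, ?H}" and v: "v \<in> V" "X v = X t - {?F, ?H}"
      by blast
    have inX: "?E \<in> X t" "?F \<in> X t" "?H \<in> X t" using mem In_sub by blast+
    have cb: "lower c b"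
      by (rule lower_if_X[of b c ?H]) (use c v V Xs inX EFH in simp_all, blast?)
    have cb': "lower c b'"
      by (rule lower_if_X[of b' c ?F]) (use c v V Xs inX EFH in simp_all, blast?)
    have cv: "lower c v"
      by (rule lower_if_X[of v c ?E]) (use c v V Xs inX EFH in simp_all, blast?)
    have vr: "lower v r"
      by (rule lower_if_X[of r v ?H]) (use c v V Xs inX EFH in simp_all, blast?)
    have vr': "lower v r'"
      by (rule lower_if_X[of r' v ?F]) (use c v V Xs inX EFH in simp_all, blast?)
    have ne: "b' \<noteq> v" "b \<noteq> v"
    proof -
      have "?E \<in> X v" "?E \<notin> X b" "?E \<notin> X b'" using v Xs inX EFH by simp_all
      then show "b' \<noteq> v" "b \<noteq> v" by auto
    qed
    have "f {b', r'} = f {c, v}"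
      using less.hyps[OF _ r'(4) vr' ne(1) cb' cv] lowerD(5)[OF r'(1)] by simp
    moreover have "f {b, r} = f {c, v}"
      using less.hyps[OF _ less.prems(5) vr ne(2) cb cv] lowerD(5)[OF less.prems(2)] by simp
    ultimately show ?thesis using r' by simp
  qed
qed

text \<open>By \<open>square_lower\<close> the opposite edges of any square are placed as in
  \<open>label_confluent\<close>, so \<open>f\<close> agrees along every link of
  \<open>Theta0\<close>. Hence a rule that inspects a single square per edge already labels whole
  classes.\<close>

lemma label_Theta:
  fixes f :: "'a set \<Rightarrow> 'b"
  assumes rule: "\<And>t w. lower w t \<Longrightarrow> (\<forall>r. lower r t \<longrightarrow> r = w) \<or>
      (\<exists>r b. lower r t \<and> r \<noteq> w \<and> lower b w \<and> lower b r \<and> f {w, t} = f {b, r})"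
    and "(e, e') \<in> (Theta0 G)\<^sup>*"
  shows "f e = f e'"
proof -
  have step: "f e = f e'" if Th: "(e, e') \<in> Theta0 G" for e e'
  proof -
    obtain u v x y where *: "e = {u, v}" "e' = {x, y}" and c4: "four_cycle G u v y x"
      using Th by (auto simp: Theta0_def)
    then have ne: "u \<noteq> y" "v \<noteq> x" by (auto simp: four_cycle_def)
    from c4 show ?thesis
    proof (cases rule: square_lower)
      case 1
      show ?thesis using label_confluent[OF rule 1(1,2) ne(2) 1(3,4)] * by (simp add: insert_commute)
    next
      case 2
      show ?thesis using label_confluent[OF rule 2(1,2) ne(1) 2(3,4)] * by (simp add: insert_commute)
    next
      case 3
      show ?thesis using label_confluent[OF rule 3(2,1) ne(2)[symmetric] 3(4,3)] * by (simp add: insert_commute)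
    next
      case 4
      show ?thesis using label_confluent[OF rule 4(2,1) ne(1)[symmetric] 4(4,3)] * by (simp add: insert_commute)
    qed
  qed
  show ?thesis using assms(2) by (induction rule: rtrancl_induct) (auto dest: step)
qed

section \<open>Induced hypercubes and the dimension\<close>

lemma wf_with_proj: "wf_digraph (with_proj G)"
  using adj_V by unfold_locales auto

text \<open>A set \<open>A\<close> of coordinates is sent to the vertex below \<open>t\<close> with
  the classes \<open>h i\<close>, \<open>i\<close> in \<open>A\<close>, removed. Vertices and
  adjacency are both determined by \<open>X\<close>, so the map is injective and its image has
  exactly the edges of the hypercube.\<close>

lemma induced_cube_if_In:
  assumes "t \<in> V" "card (In t) = k"
  shows "\<exists>H. induced_subgraph H (with_proj G) \<and> digraph_iso (with_proj (hypercube k)) H"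
proof -
  obtain h where h: "bij_betw h {..<k} (In t)"
    using assms finite_In ex_bij_betw_nat_finite[of "In t"] by (auto simp: lessThan_atLeast0)
  have inj: "inj_on h {..<k}" and hS: "\<And>A. A \<subseteq> {..<k} \<Longrightarrow> h ` A \<subseteq> In t"
    using h by (auto simp: bij_betw_def)
  have "\<exists>u. u \<in> V \<and> X u = X t - h ` A" if "A \<subseteq> {..<k}" for A
    using down[OF finite_subset[OF hS[OF that] finite_In] hS[OF that] assms(1)] by blast
  then obtain \<phi> where \<phi>: "\<And>A. A \<subseteq> {..<k} \<Longrightarrow> \<phi> A \<in> V \<and> X (\<phi> A) = X t - h ` A" by metis
  have hX: "h ` A \<subseteq> X t" if "A \<subseteq> {..<k}" for A using hS[OF that] In_sub by blast
  have inj\<phi>: "inj_on \<phi> (Pow {..<k})"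
  proof (rule inj_onI, unfold Pow_iff)
    fix A B assume AB: "A \<subseteq> {..<k}" "B \<subseteq> {..<k}" "\<phi> A = \<phi> B"
    then have "X t - h ` A = X t - h ` B" using \<phi> by metis
    then have "h ` A = h ` B" using hX AB by blast
    then show "A = B" using inj_on_image_eq_iff[OF inj] AB by blast
  qed
  have low: "lower (\<phi> A) (\<phi> B) \<longleftrightarrow> (\<exists>i. i \<notin> B \<and> A = insert i B)"
    if AB: "A \<subseteq> {..<k}" "B \<subseteq> {..<k}" for A B
  proof
    assume "lower (\<phi> A) (\<phi> B)"
    from X_lower[OF this] obtain E where E: "X t - h ` B = insert E (X t - h ` A)" "E \<notin> X t - h ` A"
      using \<phi> AB by metis
    have ex: "x \<in> X t \<and> x \<notin> h ` B \<longleftrightarrow> x = E \<or> x \<in> X t \<and> x \<notin> h ` A" for x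
      using E(1) by (metis Diff_iff insert_iff)
    have "E \<in> X t" and EB: "E \<notin> h ` B" using ex[of E] by simp_all
    then have EA: "E \<in> h ` A" using E(2) by simp
    have hA: "h ` A = insert E (h ` B)"
    proof (rule set_eqI)
      fix x show "x \<in> h ` A \<longleftrightarrow> x \<in> insert E (h ` B)"
        using ex[of x] EA EB subsetD[OF hX[OF AB(1)], of x] subsetD[OF hX[OF AB(2)], of x] by (cases "x = E") auto
    qed
    obtain i where i: "i \<in> A" "E = h i" using EA by blast
    then have "h ` A = h ` insert i B" using hA by simp
    then have "A = insert i B" using inj_on_image_eq_iff[OF inj, of A "insert i B"] AB i by blast
    then show "\<exists>i. i \<notin> B \<and> A = insert i B" using i EB by blast
  next
    assume "\<exists>i. i \<notin> B \<and> A = insert i B"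
    then obtain i where i: "i \<notin> B" "A = insert i B" by blast
    then have ik: "i < k" using AB by auto
    then have "h i \<notin> h ` B" using inj_on_image_mem_iff[OF inj _ AB(2)] i by auto
    moreover have "h i \<in> X t" using hX[of "{i}"] ik by auto
    ultimately have "X (\<phi> B) = insert (h i) (X (\<phi> A)) \<and> h i \<notin> X (\<phi> A)"
      using \<phi>[OF AB(1)] \<phi>[OF AB(2)] i by auto
    then show "lower (\<phi> A) (\<phi> B)"
      by (rule conjunct1[OF iffD2[OF lower_iff_X[OF conjunct1[OF \<phi>[OF AB(2)]] conjunct1[OF \<phi>[OF AB(1)]]]]])
  qed
  have sd: "card ((A - B) \<union> (B - A)) = 1 \<longleftrightarrow>
      (\<exists>i. i \<notin> B \<and> A = insert i B) \<or> (\<exists>i. i \<notin> A \<and> B = insert i A)" for A B :: "nat set"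
  proof
    assume "card ((A - B) \<union> (B - A)) = 1"
    then obtain i where "(A - B) \<union> (B - A) = {i}" by (auto simp: card_1_singleton_iff)
    then have el: "x \<in> A - B \<or> x \<in> B - A \<longleftrightarrow> x = i" for x by (metis UnE UnI1 UnI2 singletonD singletonI)
    have "i \<notin> B \<and> A = insert i B \<or> i \<notin> A \<and> B = insert i A"
    proof (cases "i \<in> A")
      case True
      have "x \<in> A \<longleftrightarrow> x \<in> insert i B" for x using el[of x] True by auto
      then show ?thesis using el[of i] True by blast
    next
      case False
      have "x \<in> B \<longleftrightarrow> x \<in> insert i A" for x using el[of x] el[of i] False by auto
      then show ?thesis using False by blast
    qed
    then show "(\<exists>i. i \<notin> B \<and> A = insert i B) \<or> (\<exists>i. i \<notin> A \<and> B = insert i A)" by metis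
  next
    assume "(\<exists>i. i \<notin> B \<and> A = insert i B) \<or> (\<exists>i. i \<notin> A \<and> B = insert i A)"
    then have "\<exists>i. (A - B) \<union> (B - A) = {i}" by auto
    then show "card ((A - B) \<union> (B - A)) = 1" by (simp add: card_1_singleton_iff)
  qed
  have adj: "\<phi> A \<sim> \<phi> B \<longleftrightarrow> card ((A - B) \<union> (B - A)) = 1"
    if AB: "A \<subseteq> {..<k}" "B \<subseteq> {..<k}" for A B
  proof -
    have "\<phi> A \<sim> \<phi> B \<longleftrightarrow> lower (\<phi> A) (\<phi> B) \<or> lower (\<phi> B) (\<phi> A)"
      using lower_cases lowerD(1,2) by metis
    then show ?thesis unfolding sd low[OF AB] low[OF AB(2,1)] .
  qed
  let ?hom = "\<lparr>iso_verts = \<phi>, iso_arcs = map_prod \<phi> \<phi>, iso_head = snd, iso_tail = fst\<rparr>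
    :: (nat set, nat set \<times> nat set, 'a, 'a \<times> 'a) digraph_isomorphism"
  let ?H = "app_iso ?hom (with_proj (hypercube k))"
  have arcs_sub: "parcs (hypercube k) \<subseteq> Pow {..<k} \<times> Pow {..<k}"
    by (auto simp: hypercube_def)
  have wfc: "wf_digraph (with_proj (hypercube k))"
    using arcs_sub by unfold_locales (auto simp: hypercube_def)
  have iso: "pre_digraph.digraph_isomorphism (with_proj (hypercube k)) ?hom"
    unfolding pre_digraph.digraph_isomorphism_def
    using wfc inj\<phi> inj_on_subset[OF map_prod_inj_on[OF inj\<phi> inj\<phi>] arcs_sub]
    by (auto simp: hypercube_def)
  have verts: "verts ?H = \<phi> ` Pow {..<k}" by (simp add: hypercube_def)
  have arcs: "arcs ?H = {e \<in> parcs G. fst e \<in> \<phi> ` Pow {..<k} \<and> snd e \<in> \<phi> ` Pow {..<k}}"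
  proof -
    have "arcs ?H = {(\<phi> A, \<phi> B) | A B. A \<subseteq> {..<k} \<and> B \<subseteq> {..<k} \<and> card ((A - B) \<union> (B - A)) = 1}"
      unfolding arcs_app_iso by (auto simp: hypercube_def)
    also have "\<dots> = {(\<phi> A, \<phi> B) | A B. A \<subseteq> {..<k} \<and> B \<subseteq> {..<k} \<and> \<phi> A \<sim> \<phi> B}"
      by (simp add: adj cong: conj_cong)
    also have "\<dots> = {e \<in> parcs G. fst e \<in> \<phi> ` Pow {..<k} \<and> snd e \<in> \<phi> ` Pow {..<k}}"
      by auto blast
    finally show ?thesis .
  qed
  have "wf_digraph ?H" by (rule wf_digraph.wf_digraphI_app_iso[OF wfc iso])
  then have "subgraph ?H (with_proj G)"
    unfolding subgraph_def using wf_with_proj arcs verts \<phi> by (auto simp: compatible_def)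
  then have "induced_subgraph ?H (with_proj G)"
    unfolding induced_subgraph_def using arcs verts by auto
  then show ?thesis using iso unfolding digraph_iso_def by blast
qed

lemma induced_cube_card:
  assumes "induced_subgraph H (with_proj G)" "digraph_iso (with_proj (hypercube k)) H"
  shows "2 ^ k \<le> card V"
proof -
  obtain h where h: "pre_digraph.digraph_isomorphism (with_proj (hypercube k)) h"
    "H = app_iso h (with_proj (hypercube k))" using assms(2) by (auto simp: digraph_iso_def)
  then have "verts H = iso_verts h ` Pow {..<k}" "inj_on (iso_verts h) (Pow {..<k})"
    by (auto simp: pre_digraph.digraph_isomorphism_def hypercube_def)
  then have "card (verts H) = 2 ^ k" by (simp add: card_image card_Pow)
  moreover have "verts H \<subseteq> V" using assms(1) by (auto simp: induced_subgraph_def subgraph_def)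
  ultimately show ?thesis using card_mono[OF finite_V] by metis
qed

text \<open>This makes \<open>Max\<close> in \<open>dimension\<close> meaningful: a cube with
  \<open>2 ^ k\<close> vertices fits into \<open>V\<close> only if
  \<open>k \<le> card V\<close>.\<close>

lemma finite_cube_dims: "finite {k. \<exists>H. induced_subgraph H (with_proj G) \<and>
                             digraph_iso (with_proj (hypercube k)) H}"
proof (rule finite_subset)
  show "{k. \<exists>H. induced_subgraph H (with_proj G) \<and> digraph_iso (with_proj (hypercube k)) H}
      \<subseteq> {..card V}"
    using induced_cube_card less_exp le_trans less_imp_le by (smt (verit) atMost_iff mem_Collect_eq subsetI)
qed simp

lemma card_In_le: "t \<in> V \<Longrightarrow> card (In t) \<le> dimension G"
  unfolding dimension_def using induced_cube_if_In finite_cube_dims by (intro Max_ge) auto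

lemma two_pow_dimension_le: "2 ^ dimension G \<le> card V"
proof -
  have "dimension G \<in> {k. \<exists>H. induced_subgraph H (with_proj G) \<and>
                             digraph_iso (with_proj (hypercube k)) H}"
    unfolding dimension_def using finite_cube_dims induced_cube_if_In[OF v0_V]
    by (intro Max_in) auto
  then show ?thesis using induced_cube_card by blast
qed

end

section \<open>Counting steps of programs\<close>

text \<open>The same runs as in \<open>exec\<close>, but every elementary action costs 1 whatever
  the size of its operands.\<close>

inductive steps :: "com \<Rightarrow> state \<Rightarrow> nat \<Rightarrow> state \<Rightarrow> bool" where
  "steps Skip s 1 s"
| "steps (Assign x e) s 1 (s\<lparr>vars := (vars s)(x := exp_val e s)\<rparr>)"
| "steps (Store a i e) s 1 (s\<lparr>arrs := (arrs s)(a := (arrs s a)(exp_val i s := exp_val e s))\<rparr>)"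
| "\<lbrakk> steps c1 s t1 s1; steps c2 s1 t2 s2 \<rbrakk> \<Longrightarrow> steps (Seq c1 c2) s (t1 + t2) s2"
| "\<lbrakk> exp_val b s \<noteq> 0; steps c1 s t s' \<rbrakk> \<Longrightarrow> steps (If b c1 c2) s (Suc t) s'"
| "\<lbrakk> exp_val b s = 0; steps c2 s t s' \<rbrakk> \<Longrightarrow> steps (If b c1 c2) s (Suc t) s'"
| "exp_val b s = 0 \<Longrightarrow> steps (While b c) s 1 s"
| "\<lbrakk> exp_val b s \<noteq> 0; steps c s t1 s1; steps (While b c) s1 t2 s2 \<rbrakk> \<Longrightarrow>
     steps (While b c) s (Suc (t1 + t2)) s2"

inductive_cases steps_cases:
  "steps Skip s t s'" "steps (Assign x e) s t s'" "steps (Store a i e) s t s'"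
  "steps (Seq c1 c2) s t s'" "steps (If b c1 c2) s t s'"

fun esize :: "exp \<Rightarrow> nat" where
  "esize (Num k) = 1"
| "esize (Var x) = 1"
| "esize (Arr a i) = Suc (esize i)"
| "esize (Bin f e1 e2) = Suc (esize e1 + esize e2)"

text \<open>Bounds by how much a value can exceed every number in the state. The \<open>Suc\<close>
  accounts for comparisons, which produce 1 even if the state contains only zeros.\<close>

fun egrow :: "exp \<Rightarrow> nat" where
  "egrow (Num k) = k"
| "egrow (Var x) = 0"
| "egrow (Arr a i) = egrow i"
| "egrow (Bin f e1 e2) = Suc (egrow e1 + egrow e2)"

text \<open>
  Simple expressions exceed the largest number in the state by a constant at most. So all numbers
  of a run are bounded linearly in its length, and it suffices to count steps: every step then
  costs \<open>O(log)\<close> of that bound.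
\<close>

fun esimple :: "exp \<Rightarrow> bool" where
  "esimple (Num k) \<longleftrightarrow> True"
| "esimple (Var x) \<longleftrightarrow> True"
| "esimple (Arr a i) \<longleftrightarrow> esimple i"
| "esimple (Bin f e1 e2) \<longleftrightarrow> esimple e1 \<and> esimple e2 \<and>
     (case f of Plus \<Rightarrow> (case e2 of Num k \<Rightarrow> True | _ \<Rightarrow> False) | Minus \<Rightarrow> True | Less \<Rightarrow> True | Equal \<Rightarrow> True
      | Times \<Rightarrow> False | Div \<Rightarrow> False | Mod \<Rightarrow> False)"

fun csize :: "com \<Rightarrow> nat" where
  "csize Skip = 0"
| "csize (Assign x e) = esize e"
| "csize (Store a i e) = esize i + esize e"
| "csize (Seq c1 c2) = csize c1 + csize c2"
| "csize (If b c1 c2) = esize b + csize c1 + csize c2"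
| "csize (While b c) = esize b + csize c"

fun cgrow :: "com \<Rightarrow> nat" where
  "cgrow Skip = 0"
| "cgrow (Assign x e) = egrow e"
| "cgrow (Store a i e) = egrow i + egrow e"
| "cgrow (Seq c1 c2) = cgrow c1 + cgrow c2"
| "cgrow (If b c1 c2) = egrow b + cgrow c1 + cgrow c2"
| "cgrow (While b c) = egrow b + cgrow c"

fun csimple :: "com \<Rightarrow> bool" where
  "csimple Skip \<longleftrightarrow> True"
| "csimple (Assign x e) \<longleftrightarrow> esimple e"
| "csimple (Store a i e) \<longleftrightarrow> esimple i \<and> esimple e"
| "csimple (Seq c1 c2) \<longleftrightarrow> csimple c1 \<and> csimple c2"
| "csimple (If b c1 c2) \<longleftrightarrow> esimple b \<and> csimple c1 \<and> csimple c2"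
| "csimple (While b c) \<longleftrightarrow> esimple b \<and> csimple c"

section \<open>Size of the numbers and cost of a run\<close>

definition bounded :: "nat \<Rightarrow> state \<Rightarrow> bool" where
  "bounded M s \<longleftrightarrow> (\<forall>x. vars s x \<le> M) \<and> (\<forall>a i. arrs s a i \<le> M)"

lemma bounded_mono: "bounded M s \<Longrightarrow> M \<le> N \<Longrightarrow> bounded N s"
  by (meson bounded_def le_trans)

lemma bit_len_mono: "x \<le> y \<Longrightarrow> bit_len x \<le> bit_len y"
  by (simp add: bit_len_def floor_log_le_iff)

lemma exp_val_le: "esimple e \<Longrightarrow> bounded M s \<Longrightarrow> exp_val e s \<le> M + egrow e"
proof (induction e)
  case (Bin f e1 e2)
  then show ?case by (cases f) (auto split: exp.splits)
qed (auto simp: bounded_def trans_le_add1)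

lemma exp_cost_le:
  "esimple e \<Longrightarrow> bounded M s \<Longrightarrow> M + egrow e \<le> R \<Longrightarrow> exp_cost e s \<le> esize e * bit_len R"
proof (induction e)
  case (Num k)
  then show ?case by (auto intro: bit_len_mono)
next
  case (Var x)
  then show ?case using exp_val_le[of "Var x" M s] by (auto intro!: bit_len_mono intro: order_trans)
next
  case (Arr a i)
  have "bit_len (exp_val (Arr a i) s) \<le> bit_len R"
    using exp_val_le[OF Arr.prems(1,2)] Arr.prems(3) by (intro bit_len_mono) simp
  then show ?case using Arr by simp
next
  case (Bin f e1 e2)
  have "bit_len (exp_val (Bin f e1 e2) s) \<le> bit_len R"
    using exp_val_le[OF Bin.prems(1,2)] Bin.prems(3) by (intro bit_len_mono) simp
  moreover have "exp_cost e1 s \<le> esize e1 * bit_len R" "exp_cost e2 s \<le> esize e2 * bit_len R"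
    using Bin by auto
  ultimately show ?case by (simp add: algebra_simps)
qed

text \<open>Each step writes at most one value, and this exceeds the current bound by at most the
  constant \<open>K\<close>.\<close>

lemma steps_bounded:
  "steps c s k s' \<Longrightarrow> csimple c \<Longrightarrow> bounded M s \<Longrightarrow> cgrow c \<le> K \<Longrightarrow> bounded (M + k * K) s'"
proof (induction arbitrary: M rule: steps.induct)
  case (2 x e s)
  have "exp_val e s \<le> M + K" using exp_val_le[of e M s] 2 by simp
  then show ?case using 2 by (auto simp: bounded_def trans_le_add1)
next
  case (3 a i e s)
  have "exp_val e s \<le> M + K" using exp_val_le[of e M s] 3 by simp
  then show ?case using 3 by (auto simp: bounded_def trans_le_add1)
next
  case (4 c1 s t1 s1 c2 t2 s2)
  then have "bounded (M + t1 * K + t2 * K) s2" by simp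
  then show ?case by (simp add: algebra_simps)
next
  case (5 b s c1 t s' c2)
  then have "bounded (M + t * K) s'" by simp
  then show ?case by (rule bounded_mono) simp
next
  case (6 b s c2 t s' c1)
  then have "bounded (M + t * K) s'" by simp
  then show ?case by (rule bounded_mono) simp
next
  case (8 b s c t1 s1 t2 s2)
  then have "bounded (M + t1 * K + t2 * K) s2" by simp
  then show ?case by (rule bounded_mono) (simp add: algebra_simps)
qed (auto simp: bounded_def trans_le_add1)

text \<open>\<open>R\<close> bounds the numbers of the entire run, so one bit length serves for all
  steps, and each step evaluates expressions of total size at most \<open>B\<close>.\<close>

lemma steps_exec:
  "steps c s k s' \<Longrightarrow> csimple c \<Longrightarrow> bounded M s \<Longrightarrow> cgrow c \<le> K \<Longrightarrow> csize c \<le> B \<Longrightarrow> M + k * K \<le> R \<Longrightarrow>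
    \<exists>t. exec c s t s' \<and> t \<le> k * Suc (B * bit_len R)"
proof (induction arbitrary: M rule: steps.induct)
  case (1 s)
  then show ?case using exec.Skip by fastforce
next
  case (2 x e s)
  have "exp_cost e s \<le> esize e * bit_len R" using exp_cost_le[of e M s R] 2 by simp
  also have "\<dots> \<le> B * bit_len R" using 2 by (intro mult_right_mono) auto
  finally show ?case using exec.Assign[of x e s] by fastforce
next
  case (3 a i e s)
  have "exp_cost i s \<le> esize i * bit_len R" "exp_cost e s \<le> esize e * bit_len R"
    using exp_cost_le[of _ M s R] 3 by simp_all
  then have "exp_cost i s + exp_cost e s \<le> (esize i + esize e) * bit_len R" by (simp add: algebra_simps)
  also have "\<dots> \<le> B * bit_len R" using 3 by (intro mult_right_mono) auto
  finally show ?case using exec.Store[of a i e s] by fastforce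
next
  case (4 c1 s t1 s1 c2 t2 s2)
  have "bounded (M + t1 * K) s1" using steps_bounded[OF 4(1)] 4 by simp
  then have "\<exists>t. exec c2 s1 t s2 \<and> t \<le> t2 * Suc (B * bit_len R)"
    using 4 by (intro "4.IH"(2)) (auto simp: algebra_simps)
  moreover have "\<exists>t. exec c1 s t s1 \<and> t \<le> t1 * Suc (B * bit_len R)"
    using 4 by (intro "4.IH"(1)) (auto simp: algebra_simps)
  ultimately show ?case using exec.Seq by (metis add_mono distrib_right)
next
  case (5 b s c1 t s' c2)
  have "\<exists>t'. exec c1 s t' s' \<and> t' \<le> t * Suc (B * bit_len R)" using 5 by (intro "5.IH") auto
  then obtain t' where t': "exec c1 s t' s'" "t' \<le> t * Suc (B * bit_len R)" by blast
  have "exp_cost b s \<le> esize b * bit_len R" using exp_cost_le[of b M s R] 5 by simp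
  also have "\<dots> \<le> B * bit_len R" using 5 by (intro mult_right_mono) auto
  finally have "Suc (exp_cost b s + t') \<le> Suc t * Suc (B * bit_len R)" using t' by simp
  then show ?case using exec.IfTrue[OF 5(1) t'(1)] by blast
next
  case (6 b s c2 t s' c1)
  have "\<exists>t'. exec c2 s t' s' \<and> t' \<le> t * Suc (B * bit_len R)" using 6 by (intro "6.IH") auto
  then obtain t' where t': "exec c2 s t' s'" "t' \<le> t * Suc (B * bit_len R)" by blast
  have "exp_cost b s \<le> esize b * bit_len R" using exp_cost_le[of b M s R] 6 by simp
  also have "\<dots> \<le> B * bit_len R" using 6 by (intro mult_right_mono) auto
  finally have "Suc (exp_cost b s + t') \<le> Suc t * Suc (B * bit_len R)" using t' by simp
  then show ?case using exec.IfFalse[OF 6(1) t'(1)] by blast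
next
  case (7 b s c)
  have "exp_cost b s \<le> esize b * bit_len R" using exp_cost_le[of b M s R] 7 by simp
  also have "\<dots> \<le> B * bit_len R" using 7 by (intro mult_right_mono) auto
  finally show ?case using exec.WhileFalse[OF 7(1)] by fastforce
next
  case (8 b s c t1 s1 t2 s2)
  have "bounded (M + t1 * K) s1" using steps_bounded[OF 8(2)] 8 by simp
  then have "\<exists>t. exec (While b c) s1 t s2 \<and> t \<le> t2 * Suc (B * bit_len R)"
    using 8 by (intro "8.IH"(2)) (auto simp: algebra_simps)
  moreover have "\<exists>t. exec c s t s1 \<and> t \<le> t1 * Suc (B * bit_len R)"
    using 8 by (intro "8.IH"(1)) (auto simp: algebra_simps)
  ultimately obtain t1' t2' where t': "exec c s t1' s1" "t1' \<le> t1 * Suc (B * bit_len R)"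
    "exec (While b c) s1 t2' s2" "t2' \<le> t2 * Suc (B * bit_len R)" by blast
  have "exp_cost b s \<le> esize b * bit_len R" using exp_cost_le[of b M s R] 8 by simp
  also have "\<dots> \<le> B * bit_len R" using 8 by (intro mult_right_mono) auto
  finally have "Suc (exp_cost b s + t1' + t2') \<le> Suc (t1 + t2) * Suc (B * bit_len R)"
    using t' by (simp add: algebra_simps)
  then show ?case using exec.WhileTrue[OF 8(1) t'(1,3)] by blast
qed

section \<open>Frames and correctness with step counts\<close>

fun wvars :: "com \<Rightarrow> nat set" where
  "wvars Skip = {}"
| "wvars (Assign x e) = {x}"
| "wvars (Store a i e) = {}"
| "wvars (Seq c1 c2) = wvars c1 \<union> wvars c2"
| "wvars (If b c1 c2) = wvars c1 \<union> wvars c2"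
| "wvars (While b c) = wvars c"

fun warrs :: "com \<Rightarrow> nat set" where
  "warrs Skip = {}"
| "warrs (Assign x e) = {}"
| "warrs (Store a i e) = {a}"
| "warrs (Seq c1 c2) = warrs c1 \<union> warrs c2"
| "warrs (If b c1 c2) = warrs c1 \<union> warrs c2"
| "warrs (While b c) = warrs c"

text \<open>The written variables and arrays are found syntactically, so loop invariants need to
  mention only what the loop changes.\<close>

definition frame :: "com \<Rightarrow> state \<Rightarrow> state \<Rightarrow> bool" where
  "frame c s s' \<longleftrightarrow> (\<forall>x. x \<notin> wvars c \<longrightarrow> vars s' x = vars s x) \<and> (\<forall>a. a \<notin> warrs c \<longrightarrow> arrs s' a = arrs s a)"

lemma frame_refl: "frame c s s"
  by (simp add: frame_def)

lemma frame_trans: "frame c s s1 \<Longrightarrow> frame c s1 s2 \<Longrightarrow> frame c s s2"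
  by (simp add: frame_def)

lemma frame_vars: "frame c s s' \<Longrightarrow> x \<notin> wvars c \<Longrightarrow> vars s' x = vars s x"
  and frame_arrs: "frame c s s' \<Longrightarrow> a \<notin> warrs c \<Longrightarrow> arrs s' a = arrs s a"
  by (simp_all add: frame_def)

lemma steps_frame: "steps c s k s' \<Longrightarrow> frame c s s'"
  by (induction rule: steps.induct) (auto simp: frame_def)

text \<open>Total correctness with time: the postcondition also receives the number of
  steps.\<close>

definition runs :: "com \<Rightarrow> state \<Rightarrow> (nat \<Rightarrow> state \<Rightarrow> bool) \<Rightarrow> bool" where
  "runs c s Q \<longleftrightarrow> (\<exists>k s'. steps c s k s' \<and> Q k s')"

text \<open>Weakest-precondition equations for everything but loops; with them the simplifier
  executes straight-line code symbolically.\<close>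

lemma runs_simps [simp]:
  "runs Skip s Q \<longleftrightarrow> Q 1 s"
  "runs (Assign x e) s Q \<longleftrightarrow> Q 1 (s\<lparr>vars := (vars s)(x := exp_val e s)\<rparr>)"
  "runs (Store a i e) s Q \<longleftrightarrow> Q 1 (s\<lparr>arrs := (arrs s)(a := (arrs s a)(exp_val i s := exp_val e s))\<rparr>)"
  "runs (Seq c1 c2) s Q \<longleftrightarrow> runs c1 s (\<lambda>k1 s1. runs c2 s1 (\<lambda>k2 s2. Q (k1 + k2) s2))"
  "runs (If b c1 c2) s Q \<longleftrightarrow> (if exp_val b s \<noteq> 0 then runs c1 s (\<lambda>k. Q (Suc k)) else runs c2 s (\<lambda>k. Q (Suc k)))"
proof -
  show "runs Skip s Q \<longleftrightarrow> Q 1 s"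
    unfolding runs_def by (auto elim!: steps_cases intro!: exI steps.intros)
  show "runs (Assign x e) s Q \<longleftrightarrow> Q 1 (s\<lparr>vars := (vars s)(x := exp_val e s)\<rparr>)"
    unfolding runs_def by (auto elim!: steps_cases intro!: exI steps.intros)
  show "runs (Store a i e) s Q \<longleftrightarrow> Q 1 (s\<lparr>arrs := (arrs s)(a := (arrs s a)(exp_val i s := exp_val e s))\<rparr>)"
    unfolding runs_def by (auto elim!: steps_cases intro!: exI steps.intros)
  show "runs (Seq c1 c2) s Q \<longleftrightarrow> runs c1 s (\<lambda>k1 s1. runs c2 s1 (\<lambda>k2 s2. Q (k1 + k2) s2))"
    unfolding runs_def by (metis steps_cases(4) steps.intros(4))
  show "runs (If b c1 c2) s Q \<longleftrightarrow> (if exp_val b s \<noteq> 0 then runs c1 s (\<lambda>k. Q (Suc k)) else runs c2 s (\<lambda>k. Q (Suc k)))"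
    unfolding runs_def using steps.intros(5)[of b s c1 _ _ c2] steps.intros(6)[of b s c2 _ _ c1]
    by (auto elim!: steps_cases(5)) blast+
qed

lemma runs_cons:
  assumes "runs c s R" "\<And>k s'. R k s' \<Longrightarrow> frame c s s' \<Longrightarrow> Q k s'"
  shows "runs c s Q"
  using assms steps_frame unfolding runs_def by blast

text \<open>The number of rounds is fixed in advance, so the invariant is indexed by the round. A
  separate bound \<open>T i\<close> for each round allows amortised sums such as the total
  degree.\<close>

lemma runs_while:
  assumes "I 0 s0"
    and body: "\<And>i s. i < n \<Longrightarrow> I i s \<Longrightarrow> frame (While b c) s0 s \<Longrightarrow>
      exp_val b s \<noteq> 0 \<and> runs c s (\<lambda>k s'. k \<le> T i \<and> I (Suc i) s')"
    and exit: "\<And>s. I n s \<Longrightarrow> frame (While b c) s0 s \<Longrightarrow> exp_val b s = 0"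
  shows "runs (While b c) s0 (\<lambda>k s'. k \<le> Suc (\<Sum>i<n. Suc (T i)) \<and> I n s')"
proof -
  \<comment> \<open>Induction on the number \<open>m\<close> of rounds still to come.\<close>
  have "\<exists>k s'. steps (While b c) s k s' \<and> k \<le> Suc (\<Sum>i=n-m..<n. Suc (T i)) \<and> I n s'"
    if "I (n - m) s" "frame (While b c) s0 s" "m \<le> n" for m s
    using that
  proof (induction m arbitrary: s)
    case 0
    then show ?case using exit steps.intros(7)[of b s c] by auto
  next
    case (Suc m)
    then have i: "n - Suc m < n" "Suc (n - Suc m) = n - m" by auto
    obtain k1 s1 where 1: "exp_val b s \<noteq> 0" "steps c s k1 s1" "k1 \<le> T (n - Suc m)" "I (n - m) s1"
      using body[OF i(1) Suc.prems(1,2)] i(2) by (auto simp: runs_def)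
    have "frame (While b c) s s1" using steps_frame[OF 1(2)] by (simp add: frame_def)
    then have f: "frame (While b c) s0 s1" using Suc.prems(2) frame_trans by blast
    obtain k2 s2 where 2: "steps (While b c) s1 k2 s2" "k2 \<le> Suc (\<Sum>i=n-m..<n. Suc (T i))" "I n s2"
      using Suc.IH[OF 1(4) f] Suc.prems(3) by auto
    have "(\<Sum>i=n-Suc m..<n. Suc (T i)) = Suc (T (n - Suc m)) + (\<Sum>i=n-m..<n. Suc (T i))"
      using sum.atLeast_Suc_lessThan[OF i(1), of "\<lambda>i. Suc (T i)"] i(2) by simp
    then show ?case using steps.intros(8)[OF 1(1,2) 2(1)] 1(3) 2(2,3) by (intro exI[of _ "Suc (k1 + k2)"] exI[of _ s2]) auto
  qed
  from this[of n s0] show ?thesis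
    using assms(1) frame_refl unfolding runs_def by (auto simp: lessThan_atLeast0)
qed

definition For :: "nat \<Rightarrow> exp \<Rightarrow> exp \<Rightarrow> com \<Rightarrow> com" where
  "For x lo hi c = Seq (Assign x lo) (While (Bin Less (Var x) hi) (Seq c (Assign x (Bin Plus (Var x) (Num 1)))))"

lemma wvars_For [simp]: "wvars (For x lo hi c) = insert x (wvars c)"
  and warrs_For [simp]: "warrs (For x lo hi c) = warrs c"
  by (auto simp: For_def)

text \<open>\<open>hi\<close> is evaluated anew in every round and must keep the value
  \<open>z\<close>. The invariant refers to the state whose counter has already been advanced. Test
  and increment account for 2 steps per round, initial assignment and last test for the 2 in
  front.\<close>

lemma runs_For:
  fixes a z :: nat
  assumes lo: "exp_val lo s0 = a" and az: "a \<le> z"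
    and init: "I a (s0\<lparr>vars := (vars s0)(x := a)\<rparr>)"
    and hi: "\<And>i s. a \<le> i \<Longrightarrow> i \<le> z \<Longrightarrow> I i s \<Longrightarrow> vars s x = i \<Longrightarrow> frame (For x lo hi c) s0 s \<Longrightarrow> exp_val hi s = z"
    and body: "\<And>i s. a \<le> i \<Longrightarrow> i < z \<Longrightarrow> I i s \<Longrightarrow> vars s x = i \<Longrightarrow> frame (For x lo hi c) s0 s \<Longrightarrow>
      runs c s (\<lambda>k s'. k \<le> T i \<and> vars s' x = i \<and> I (Suc i) (s'\<lparr>vars := (vars s')(x := Suc i)\<rparr>))"
  shows "runs (For x lo hi c) s0 (\<lambda>k s'. k \<le> 2 + (\<Sum>i=a..<z. 2 + T i) \<and> I z s' \<and> vars s' x = z)"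
proof -
  let ?s = "s0\<lparr>vars := (vars s0)(x := a)\<rparr>"
  let ?w = "While (Bin Less (Var x) hi) (Seq c (Assign x (Bin Plus (Var x) (Num 1))))"
  have fr: "frame (For x lo hi c) s0 s" if "frame ?w ?s s" for s
    using that by (auto simp: frame_def)
  have "runs ?w ?s (\<lambda>k s'. k \<le> Suc (\<Sum>i<z - a. Suc (Suc (T (i + a)))) \<and> (I (z - a + a) s' \<and> vars s' x = z - a + a))"
  proof (rule runs_while)
    show "I (0 + a) ?s \<and> vars ?s x = 0 + a" using init by simp
  next
    fix i s assume "i < z - a" and I: "I (i + a) s \<and> vars s x = i + a" and "frame ?w ?s s"
    then have i: "a \<le> i + a" "i + a < z" "i + a \<le> z" and fs: "frame (For x lo hi c) s0 s" using fr by auto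
    have "exp_val hi s = z" using hi[OF i(1,3) conjunct1[OF I] conjunct2[OF I] fs] .
    then show "exp_val (Bin Less (Var x) hi) s \<noteq> 0 \<and>
      runs (Seq c (Assign x (Bin Plus (Var x) (Num 1)))) s (\<lambda>k s'. k \<le> Suc (T (i + a)) \<and> (I (Suc i + a) s' \<and> vars s' x = Suc i + a))"
      using I i by (auto intro!: runs_cons[OF body[OF i(1,2) conjunct1[OF I] conjunct2[OF I] fs]])
  next
    fix s assume I: "I (z - a + a) s \<and> vars s x = z - a + a" and "frame ?w ?s s"
    then have "exp_val hi s = z" using hi[of z s] fr az by simp
    then show "exp_val (Bin Less (Var x) hi) s = 0" using I az by simp
  qed
  moreover have "(\<Sum>i<z - a. Suc (Suc (T (i + a)))) = (\<Sum>i=a..<z. 2 + T i)"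
    using sum.shift_bounds_nat_ivl[of "\<lambda>i. 2 + T i" 0 a "z - a"] az by (simp add: lessThan_atLeast0)
  ultimately show ?thesis
    unfolding For_def using lo az by (auto elim!: runs_cons)
qed

section \<open>Linked lists in arrays\<close>

fun chain :: "(nat \<Rightarrow> nat) \<Rightarrow> nat \<Rightarrow> nat list \<Rightarrow> bool" where
  "chain nx p [] \<longleftrightarrow> p = 0"
| "chain nx p (x # xs) \<longleftrightarrow> p = x \<and> x \<noteq> 0 \<and> chain nx (nx x) xs"

text \<open>A family of linked lists that share one pool of cells with numbers up to
  \<open>K\<close>; cell \<open>Suc K\<close> is then fresh, and using it disturbs none of the
  lists.\<close>

definition lists :: "(nat \<Rightarrow> nat) \<Rightarrow> (nat \<Rightarrow> nat) \<Rightarrow> (nat \<Rightarrow> 'b) \<Rightarrow> nat \<Rightarrow> (nat \<Rightarrow> 'b list) \<Rightarrow> bool" where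
  "lists hd0 nx f K L \<longleftrightarrow> (\<forall>u. \<exists>ps. chain nx (hd0 u) ps \<and> set ps \<subseteq> {..K} \<and> map f ps = L u)"

lemma chain_cong: "(\<And>x. x \<in> set ps \<Longrightarrow> nx x = nx' x) \<Longrightarrow> chain nx p ps \<longleftrightarrow> chain nx' p ps"
  by (induction ps arbitrary: p) auto

lemma lists_push:
  assumes "lists hd0 nx f K L" "\<And>p. p \<le> K \<Longrightarrow> g p = f p" "g (Suc K) = y"
  shows "lists (hd0(u := Suc K)) (nx(Suc K := hd0 u)) g (Suc K) (L(u := y # L u))"
  unfolding lists_def
proof
  fix v
  obtain ps where ps: "chain nx (hd0 v) ps" "set ps \<subseteq> {..K}" "map f ps = L v"
    using assms(1) by (auto simp: lists_def)
  have "Suc K \<notin> set ps" using ps(2) by auto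
  then have c: "chain (nx(Suc K := hd0 u)) (hd0 v) ps"
    using ps(1) by (subst chain_cong[of ps _ nx]) auto
  have "map g ps = map f ps" using ps(2) assms(2) by (intro map_cong) auto
  then have m: "map g ps = L v" using ps(3) by simp
  show "\<exists>ps. chain (nx(Suc K := hd0 u)) ((hd0(u := Suc K)) v) ps \<and> set ps \<subseteq> {..Suc K} \<and> map g ps = (L(u := y # L u)) v"
  proof (cases "v = u")
    case True
    then show ?thesis using c m ps assms(3) by (intro exI[of _ "Suc K # ps"]) auto
  next
    case False
    then show ?thesis using c m ps by (intro exI[of _ ps]) auto
  qed
qed

text \<open>The body may change anything but the cursor and the links, so the chain present at the
  start is the one that is followed.\<close>

lemma runs_chain:
  assumes ps: "chain nx (vars s0 p) ps" and init: "I 0 s0"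
    and nx: "\<And>i s. I i s \<Longrightarrow> frame (While (Var p) (Seq c (Assign p (Arr a (Var p))))) s0 s \<Longrightarrow> arrs s a = nx"
    and body: "\<And>i s. i < length ps \<Longrightarrow> I i s \<Longrightarrow> vars s p = ps ! i \<Longrightarrow> ps ! i \<noteq> 0 \<Longrightarrow>
      frame (While (Var p) (Seq c (Assign p (Arr a (Var p))))) s0 s \<Longrightarrow>
      runs c s (\<lambda>k s'. k \<le> T i \<and> vars s' p = vars s p \<and> arrs s' a = nx \<and> I (Suc i) (s'\<lparr>vars := (vars s')(p := nx (ps ! i))\<rparr>))"
  shows "runs (While (Var p) (Seq c (Assign p (Arr a (Var p))))) s0 (\<lambda>k s'. k \<le> Suc (\<Sum>i<length ps. 2 + T i) \<and> I (length ps) s')"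
proof -
  let ?w = "While (Var p) (Seq c (Assign p (Arr a (Var p))))"
  have "runs ?w s0 (\<lambda>k s'. k \<le> Suc (\<Sum>i<length ps. Suc (Suc (T i))) \<and> (I (length ps) s' \<and> chain nx (vars s' p) (drop (length ps) ps)))"
  proof (rule runs_while)
    show "I 0 s0 \<and> chain nx (vars s0 p) (drop 0 ps)" using ps init by simp
  next
    fix i s assume i: "i < length ps" and I: "I i s \<and> chain nx (vars s p) (drop i ps)" and f: "frame ?w s0 s"
    have d: "drop i ps = ps ! i # drop (Suc i) ps" using i by (simp add: Cons_nth_drop_Suc)
    then have p: "vars s p = ps ! i" "ps ! i \<noteq> 0" "chain nx (nx (ps ! i)) (drop (Suc i) ps)" using I by auto
    show "exp_val (Var p) s \<noteq> 0 \<and>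
      runs (Seq c (Assign p (Arr a (Var p)))) s (\<lambda>k s'. k \<le> Suc (T i) \<and> (I (Suc i) s' \<and> chain nx (vars s' p) (drop (Suc i) ps)))"
      using p by (auto intro!: runs_cons[OF body[OF i conjunct1[OF I] p(1,2) f]])
  next
    fix s assume "I (length ps) s \<and> chain nx (vars s p) (drop (length ps) ps)"
    then show "exp_val (Var p) s = 0" by simp
  qed
  then show ?thesis by (rule runs_cons) simp
qed

section \<open>Adjacency lists and breadth-first search\<close>

locale problem =
  fixes G :: "nat pair_pre_digraph" and n :: nat and es :: "(nat \<times> nat) list" and v0 :: nat
  assumes is_median: "median_graph G" and verts: "pverts G = {..<n}"
    and listing: "edge_listing G es" and base: "v0 \<in> pverts G"

sublocale problem \<subseteq> based_median G v0
  using is_median base by unfold_locales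

context problem
begin

abbreviation m :: nat where "m \<equiv> length es"
abbreviation endA :: "nat \<Rightarrow> nat" where "endA i \<equiv> (if i < m then fst (es ! i) else 0)"
abbreviation endB :: "nat \<Rightarrow> nat" where "endB i \<equiv> (if i < m then snd (es ! i) else 0)"
abbreviation edge :: "nat \<Rightarrow> nat set" where "edge i \<equiv> {fst (es ! i), snd (es ! i)}"

lemma edge_adj: "e < m \<Longrightarrow> fst (es ! e) \<sim> snd (es ! e)"
proof -
  assume "e < m"
  then have "edge e \<in> set (map (\<lambda>(u, v). {u, v}) es)" by (force simp: case_prod_beta)
  then have "edge e \<in> uedges G" using listing by (simp add: edge_listing_def)
  then obtain u v where "edge e = {u, v}" "u \<sim> v" by (auto simp: uedges_def)
  then show ?thesis by (metis adj_sym doubleton_eq_iff)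
qed

lemma edge_exists: "a \<sim> b \<Longrightarrow> \<exists>e<m. edge e = {a, b}"
proof -
  assume "a \<sim> b"
  then have "{a, b} \<in> set (map (\<lambda>(u, v). {u, v}) es)"
    using listing by (auto simp: edge_listing_def uedges_def)
  then obtain i where "i < m" "map (\<lambda>(u, v). {u, v}) es ! i = {a, b}" unfolding in_set_conv_nth by auto
  then show ?thesis by (auto simp: case_prod_beta)
qed

lemma edge_inj: "e < m \<Longrightarrow> e' < m \<Longrightarrow> edge e = edge e' \<Longrightarrow> e = e'"
  using listing nth_eq_iff_index_eq[of "map (\<lambda>(u, v). {u, v}) es" e e']
  by (auto simp: edge_listing_def case_prod_beta)

lemma edge_lt: "e < m \<Longrightarrow> fst (es ! e) < n" "e < m \<Longrightarrow> snd (es ! e) < n"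
  "e < m \<Longrightarrow> fst (es ! e) \<noteq> snd (es ! e)"
  using adj_V[OF edge_adj] adj_irrefl[OF edge_adj] verts by auto

lemma lower_lt: "lower w t \<Longrightarrow> w < n" "lower w t \<Longrightarrow> t < n"
  using lowerD(3,4) verts by auto

section \<open>Adjacency lists and the number of edges\<close>

primrec adjl :: "nat \<Rightarrow> nat \<Rightarrow> (nat \<times> nat) list" where
  "adjl 0 = (\<lambda>_. [])"
| "adjl (Suc e) = (let L = (adjl e)(endA e := (endB e, e) # adjl e (endA e))
     in L(endB e := (endA e, e) # L (endB e)))"

lemma adjl_Suc:
  "e < m \<Longrightarrow> adjl (Suc e) u = (if u = endB e then [(endA e, e)] else if u = endA e then [(endB e, e)] else []) @ adjl e u"
  using edge_lt(3)[of e] by (auto simp: Let_def)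

lemma set_adjl: "k \<le> m \<Longrightarrow> set (adjl k u) = {(w, e). e < k \<and> edge e = {u, w}}"
proof (induction k)
  case (Suc k)
  then have km: "k < m" by simp
  define a b where "a = fst (es ! k)" and "b = snd (es ! k)"
  have ab: "a \<noteq> b" using edge_lt(3)[OF km] by (simp add: a_def b_def)
  have 1: "adjl (Suc k) u = (if u = b then [(a, k)] else if u = a then [(b, k)] else []) @ adjl k u"
    unfolding adjl_Suc[OF km] using km by (simp add: a_def b_def)
  have 2: "{a, b} = {u, w} \<longleftrightarrow> u = b \<and> w = a \<or> u = a \<and> w = b" for w
    unfolding doubleton_eq_iff by blast
  have 3: "(w, e) \<in> set (adjl (Suc k) u) \<longleftrightarrow> e = k \<and> {a, b} = {u, w} \<or> e < k \<and> edge e = {u, w}" for w e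
    unfolding 1 2 set_append Un_iff using Suc ab by auto
  have "(w, e) \<in> set (adjl (Suc k) u) \<longleftrightarrow> e < Suc k \<and> edge e = {u, w}" for w e
    unfolding 3 by (cases "e = k") (simp_all add: a_def b_def less_Suc_eq)
  then show ?case by (auto simp del: adjl.simps)
qed simp

lemma distinct_adjl: "k \<le> m \<Longrightarrow> distinct (adjl k u)"
proof (induction k)
  case (Suc k)
  then have "k < m" by simp
  then show ?case unfolding adjl_Suc[OF \<open>k < m\<close>] using Suc set_adjl[of k u] by auto
qed simp

lemma nbrs_adjl: "fst ` set (adjl m u) = {w. u \<sim> w}"
proof -
  have "(\<exists>e<m. edge e = {u, w}) \<longleftrightarrow> u \<sim> w" for w
    using edge_exists edge_adj adj_sym by (metis doubleton_eq_iff)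
  then show ?thesis unfolding set_adjl[OF order_refl] by (force simp: image_iff)
qed

lemma sum_adjl: "k \<le> m \<Longrightarrow> (\<Sum>u<n. length (adjl k u)) = 2 * k"
proof (induction k)
  case (Suc k)
  then have k: "k < m" by simp
  have "length (adjl (Suc k) u) = (if u = endB k then 1 else 0) + (if u = endA k then 1 else 0) + length (adjl k u)" for u
    unfolding adjl_Suc[OF k] using edge_lt(3)[OF k] k by auto
  then show ?case using Suc edge_lt(1,2)[OF k] k by (simp add: sum.distrib)
qed simp

lemma card_lower: "card {w. lower w t} = card (In t)"
proof -
  have "inj_on (\<lambda>w. cls {w, t}) {w. lower w t}" using lower_inj by (auto intro: inj_onI)
  moreover have "In t = (\<lambda>w. cls {w, t}) ` {w. lower w t}" by (auto simp: In_def)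
  ultimately show ?thesis by (simp add: card_image)
qed

abbreviation dm :: nat where "dm \<equiv> dimension G"

lemma card_lower_le: "t < n \<Longrightarrow> card {w. lower w t} \<le> dm"
  using card_lower card_In_le verts by simp

lemma finite_lower: "finite {w. lower w t}"
  by (rule finite_subset[OF _ finite_V]) (auto dest: lowerD)

text \<open>Charge every edge to its upper end; a vertex has at most \<open>dm\<close> lower
  neighbours.\<close>

lemma m_le: "m \<le> n * dm"
proof -
  \<comment> \<open>\<open>f e\<close> lists the ends of the edge with the upper one in
    front.\<close>
  define f where "f e = (if lower (fst (es ! e)) (snd (es ! e)) then (snd (es ! e), fst (es ! e)) else (fst (es ! e), snd (es ! e)))" for e
  have f: "edge e = {fst (f e), snd (f e)}" "lower (snd (f e)) (fst (f e))" if "e < m" for e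
    using lower_cases[OF edge_adj[OF that]] by (auto simp: f_def)
  have "inj_on f {..<m}"
    by (rule inj_onI) (metis f(1) edge_inj lessThan_iff)
  moreover have "f ` {..<m} \<subseteq> (SIGMA t:{..<n}. {w. lower w t})"
    using f(2) lower_lt(2) by (auto simp: mem_Sigma_iff) (metis fst_conv snd_conv lower_lt(2))+
  ultimately have "card {..<m} \<le> card (SIGMA t:{..<n}. {w. lower w t})"
    using finite_lower by (intro card_inj_on_le) auto
  also have "\<dots> \<le> (\<Sum>t<n. dm)"
    using card_lower_le finite_lower by (subst card_SigmaI) (auto intro!: sum_mono simp del: sum_constant)
  finally show ?thesis by simp
qed

section \<open>Breadth-first order of the vertices\<close>

definition addnew :: "nat list \<Rightarrow> nat list \<Rightarrow> nat list" where
  "addnew = foldl (\<lambda>q w. if w \<in> set q then q else q @ [w])"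

lemma addnew_simps: "addnew q [] = q" "addnew q (ws @ [w]) = (if w \<in> set (addnew q ws) then addnew q ws else addnew q ws @ [w])"
  by (simp_all add: addnew_def)

lemma set_addnew: "set (addnew q ws) = set q \<union> set ws"
  by (induction ws rule: rev_induct) (auto simp: addnew_simps)

lemma distinct_addnew: "distinct q \<Longrightarrow> distinct (addnew q ws)"
  by (induction ws rule: rev_induct) (auto simp: addnew_simps)

lemma addnew_prefix: "\<exists>zs. addnew q ws = q @ zs"
  by (induction ws rule: rev_induct) (auto simp: addnew_simps)

lemma sorted_addnew:
  fixes f :: "nat \<Rightarrow> nat"
  assumes "sorted (map f q)" "\<forall>x \<in> set q. f x \<le> c" "\<forall>w \<in> set ws. w \<notin> set q \<longrightarrow> f w = c"
  shows "sorted (map f (addnew q ws))"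
  using assms(3)
proof (induction ws rule: rev_induct)
  case (snoc w ws)
  have "f x \<le> c" if "x \<in> set (addnew q ws)" for x
    using that snoc.prems assms(2) by (cases "x \<in> set q") (auto simp: set_addnew)
  moreover have "f w = c" if "w \<notin> set (addnew q ws)"
    using that snoc.prems by (auto simp: set_addnew)
  ultimately show ?case using snoc by (auto simp: addnew_simps sorted_append)
qed (simp add: addnew_simps assms)

text \<open>The queue of the breadth-first search once the first \<open>h\<close> of its entries have been expanded.\<close>

primrec bq :: "nat \<Rightarrow> nat list" where
  "bq 0 = [v0]"
| "bq (Suc h) = addnew (bq h) (map fst (adjl m (bq h ! h)))"

declare bq.simps(2) [simp del]

text \<open>On a shortest path from \<open>v0\<close> to \<open>v\<close> every vertex before
  \<open>v\<close> has level below \<open>k\<close>, so the path cannot leave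
  \<open>S\<close>.\<close>

lemma closed_reach:
  assumes "v0 \<in> S" "\<And>w v. w \<in> S \<Longrightarrow> lev w < k \<Longrightarrow> w \<sim> v \<Longrightarrow> v \<in> S" "v \<in> V" "lev v \<le> k"
  shows "v \<in> S"
  using assms(3,4)
proof (induction "lev v" arbitrary: v rule: less_induct)
  case less
  show ?case
  proof (cases "v = v0")
    case False
    then obtain w where w: "v \<sim> w" "d v v0 = Suc (d w v0)" using step_towards less.prems v0_V by metis
    have "w \<in> V" using adj_V(2)[OF w(1)] .
    then have l: "lev v = Suc (lev w)" using w(2) d_sym v0_V less.prems(1) by metis
    then have "lev w < lev v" "lev w \<le> k" "lev w < k" using less.prems(2) by linarith+
    then show ?thesis using less.hyps[of w] \<open>w \<in> V\<close> assms(2)[of w v] adj_sym[OF w(1)] by blast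
  qed (use assms in simp)
qed

text \<open>The queue is sorted by level, so every entry below the level of \<open>q ! h\<close> has
  been expanded. By \<open>closed_reach\<close> all vertices up to this level are in the queue; what
  \<open>q ! h\<close> adds is exactly one level higher, which keeps the queue sorted.\<close>

lemma queue_near:
  assumes q: "set q = insert v0 {w. \<exists>i<h. q ! i \<sim> w}" "sorted (map lev q)" "h < length q"
  shows "x \<in> set q \<Longrightarrow> lev x \<le> Suc (lev (q ! h))"
    and "q ! h \<sim> w \<Longrightarrow> w \<notin> set q \<Longrightarrow> lev w = Suc (lev (q ! h))"
proof -
  define u where "u = q ! h"
  have closed: "v \<in> set q" if "w \<in> set q" "lev w < lev u" "w \<sim> v" for w v
  proof -
    obtain i where i: "i < length q" "w = q ! i" using \<open>w \<in> set q\<close> by (auto simp: in_set_conv_nth)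
    have "i < h"
    proof (rule ccontr)
      assume "\<not> i < h"
      then have "lev u \<le> lev w" using sorted_nth_mono[OF q(2), of h i] i by (simp add: u_def)
      then show False using that by simp
    qed
    then show ?thesis using q(1) i that by auto
  qed
  have near: "v \<in> set q" if "v \<in> V" "lev v \<le> lev u" for v
    using closed_reach[of "set q" "lev u" v] closed that q(1) by blast
  have le: "lev x \<le> Suc (lev u)" if x: "x \<in> set q" for x
  proof -
    consider "x = v0" | i where "i < h" "q ! i \<sim> x" using x unfolding q(1) by blast
    then show ?thesis
    proof cases
      case 2
      have "lev (q ! i) \<le> lev u" using sorted_nth_mono[OF q(2), of i h] 2 q(3) by (simp add: u_def)
      moreover have "lev x \<le> Suc (lev (q ! i))" using d_edge[OF 2(2) v0_V] by linarith
      ultimately show ?thesis by linarith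
    qed simp
  qed
  have new: "lev w = Suc (lev u)" if "u \<sim> w" "w \<notin> set q" for w
    using near[of w] that adj_V(2)[OF that(1)] d_edge[OF that(1) v0_V] by linarith
  show "x \<in> set q \<Longrightarrow> lev x \<le> Suc (lev (q ! h))"
    "q ! h \<sim> w \<Longrightarrow> w \<notin> set q \<Longrightarrow> lev w = Suc (lev (q ! h))"
    using le new unfolding u_def by blast+
qed

text \<open>The last conjunct says that the queue does not run dry early: a completely expanded
  queue is closed under adjacency and therefore contains all of \<open>V\<close>.\<close>

lemma bq_inv:
  "h \<le> n \<Longrightarrow> distinct (bq h) \<and> set (bq h) = insert v0 {w. \<exists>i<h. bq h ! i \<sim> w} \<and> set (bq h) \<subseteq> V \<and>
    sorted (map lev (bq h)) \<and> h \<le> length (bq h) \<and> (h < n \<longrightarrow> h < length (bq h))"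
proof (induction h)
  case 0
  then show ?case using v0_V by auto
next
  case (Suc h)
  let ?q = "bq h"
  have ih: "distinct ?q" "set ?q = insert v0 {w. \<exists>i<h. ?q ! i \<sim> w}" "set ?q \<subseteq> V" "sorted (map lev ?q)" "h < length ?q"
    using Suc by auto
  define u where "u = ?q ! h"
  have u: "u \<in> set ?q" "u \<in> V"
    unfolding u_def using nth_mem[OF ih(5)] ih(3) by blast+
  note le = queue_near(1)[OF ih(2,4,5), folded u_def] and new = queue_near(2)[OF ih(2,4,5), folded u_def]
  have nb: "set (map fst (adjl m u)) = {w. u \<sim> w}" using nbrs_adjl by simp
  have q': "bq (Suc h) = addnew ?q (map fst (adjl m u))" by (simp add: u_def bq.simps)
  obtain zs where zs: "bq (Suc h) = ?q @ zs" using addnew_prefix unfolding q' by blast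
  have D: "distinct (bq (Suc h))" unfolding q' using distinct_addnew ih by blast
  have S: "set (bq (Suc h)) = insert v0 {w. \<exists>i<Suc h. bq (Suc h) ! i \<sim> w}"
  proof -
    have nth: "bq (Suc h) ! i = ?q ! i" if "i < Suc h" for i using zs that ih(5) by (simp add: nth_append)
    have "set (bq (Suc h)) = set ?q \<union> {w. u \<sim> w}" unfolding q' set_addnew nb ..
    also have "\<dots> = insert v0 {w. \<exists>i<Suc h. ?q ! i \<sim> w}"
      unfolding ih(2) less_Suc_eq u_def by blast
    finally show ?thesis using nth by auto
  qed
  have V: "set (bq (Suc h)) \<subseteq> V" unfolding q' set_addnew nb using ih(3) adj_V(2) by blast
  have so: "sorted (map lev (bq (Suc h)))"
    unfolding q' by (rule sorted_addnew[OF ih(4)]) (use le new nb in auto)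
  have len: "Suc h \<le> length (bq (Suc h))" using zs ih(5) by simp
  have "Suc h < length (bq (Suc h))" if "Suc h < n"
  proof (rule ccontr)
    assume "\<not> Suc h < length (bq (Suc h))"
    then have l: "length (bq (Suc h)) = Suc h" using len by simp
    have "v \<in> set (bq (Suc h))" if "v \<in> V" for v
    proof (rule closed_reach[of _ "lev v"])
      show "v0 \<in> set (bq (Suc h))" unfolding S by simp
      show "y \<in> set (bq (Suc h))" if "w \<in> set (bq (Suc h))" "w \<sim> y" for w y
        using that unfolding in_set_conv_nth[of w] l by (subst S) blast
    qed (use that in auto)
    then have "V = set (bq (Suc h))" using V by blast
    then have "n = Suc h" using distinct_card[OF D] l verts by (metis card_lessThan)
    then show False using that by simp
  qed
  then show ?case using D S V so len by blast
qed

definition ord :: "nat list" where "ord = bq n"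

lemma bq_mono: "h \<le> h' \<Longrightarrow> \<exists>zs. bq h' = bq h @ zs"
proof (induction h' rule: dec_induct)
  case (step k)
  then show ?case using addnew_prefix[of "bq k" "map fst (adjl m (bq k ! k))"] by (auto simp: bq.simps(2))
qed simp

lemma ord: "distinct ord" "set ord = {..<n}" "length ord = n" "sorted (map lev ord)"
proof -
  have 1: "distinct ord" "set ord \<subseteq> {..<n}" "sorted (map lev ord)" "n \<le> length ord"
    using bq_inv[of n] verts by (auto simp: ord_def)
  show "distinct ord" "sorted (map lev ord)" using 1 by auto
  have "card (set ord) = length ord" using 1 distinct_card by blast
  then show "length ord = n" "set ord = {..<n}"
    using 1 card_mono[OF _ 1(2)] card_subset_eq[OF _ 1(2)] by auto
qed

lemma bq_ord: "h < n \<Longrightarrow> bq h ! h = ord ! h"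
  using bq_mono[of h n] bq_inv[of h] by (auto simp: ord_def nth_append)

end

notation Seq (infixr ";;" 60)

abbreviation inc :: "nat \<Rightarrow> com" where
  "inc x \<equiv> Assign x (Bin Plus (Var x) (Num 1))"

text \<open>
  Arrays: 4 list heads and 5 links of the half-edge lists, with 6 the other end and 7 the edge
  of a half-edge; 8 level plus one (0 if unvisited); 9 queue; 10 and 11 bounds of the block of
  edges below a vertex, with 12 the lower end and 13 the edge of a block entry; 14 top, 15 bottom,
  16 parent, 17 last class and 18 dimension of a cube; 19 list heads and 20 links of the lists of
  cubes with a given bottom; 21 class flags. Indices of half-edges and cubes start at 1, so that 0
  is the null link.
\<close>

lemma state_update_commute [simp]:
  "s\<lparr>vars := v, arrs := a\<rparr> = s\<lparr>arrs := a, vars := v\<rparr>"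
  by simp

definition push_half :: "nat \<Rightarrow> nat \<Rightarrow> com" where
  "push_half a b = inc 4 ;; Store 6 (Var 4) (Arr b (Var 3)) ;; Store 7 (Var 4) (Var 3) ;;
     Store 5 (Var 4) (Arr 4 (Arr a (Var 3))) ;; Store 4 (Arr a (Var 3)) (Var 4)"

definition build_adjacency :: com where
  "build_adjacency = For 3 (Num 0) (Var 1) (push_half 0 1 ;; push_half 1 0)"

definition visit :: com where
  "visit = Assign 9 (Arr 6 (Var 8)) ;; If (Bin Equal (Arr 8 (Var 9)) (Num 0))
     (Store 8 (Var 9) (Bin Plus (Arr 8 (Var 7)) (Num 1)) ;; Store 9 (Var 6) (Var 9) ;; inc 6) Skip"

definition expand :: com where
  "expand = Assign 7 (Arr 9 (Var 5)) ;; Assign 8 (Arr 4 (Var 7)) ;;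
     While (Var 8) (visit ;; Assign 8 (Arr 5 (Var 8)))"

definition search :: com where
  "search = Store 8 (Var 2) (Num 1) ;; Store 9 (Num 0) (Var 2) ;; Assign 6 (Num 1) ;;
     For 5 (Num 0) (Var 0) expand"

definition collect :: com where
  "collect = If (Bin Less (Arr 8 (Arr 6 (Var 8))) (Arr 8 (Var 7)))
     (Store 12 (Var 10) (Arr 6 (Var 8)) ;; Store 13 (Var 10) (Arr 7 (Var 8)) ;; inc 10) Skip"

definition in_list :: com where
  "in_list = Store 10 (Var 7) (Var 10) ;; Assign 8 (Arr 4 (Var 7)) ;;
     While (Var 8) (collect ;; Assign 8 (Arr 5 (Var 8))) ;; Store 11 (Var 7) (Var 10)"

definition in_lists :: com where
  "in_lists = For 7 (Num 0) (Var 0) in_list"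

lemma wvars_phase1 [simp]:
  "wvars (push_half a b) = {4}" "wvars visit = {6, 9}" "wvars expand = {6, 7, 8, 9}"
  "wvars collect = {10}" "wvars in_list = {8, 10}"
  "wvars build_adjacency = {3, 4}" "wvars search = {5, 6, 7, 8, 9}" "wvars in_lists = {7, 8, 10}"
  by (auto simp: push_half_def visit_def expand_def collect_def in_list_def build_adjacency_def
      search_def in_lists_def)

lemma warrs_phase1 [simp]:
  "warrs (push_half a b) = {4, 5, 6, 7}" "warrs visit = {8, 9}" "warrs expand = {8, 9}"
  "warrs collect = {12, 13}" "warrs in_list = {10, 11, 12, 13}"
  "warrs build_adjacency = {4, 5, 6, 7}" "warrs search = {8, 9}" "warrs in_lists = {10, 11, 12, 13}"
  by (auto simp: push_half_def visit_def expand_def collect_def in_list_def build_adjacency_def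
      search_def in_lists_def)

section \<open>The programs for adjacency lists and search\<close>

definition adj_lists :: "state \<Rightarrow> (nat \<Rightarrow> (nat \<times> nat) list) \<Rightarrow> bool" where
  "adj_lists s L \<longleftrightarrow> lists (arrs s 4) (arrs s 5) (\<lambda>p. (arrs s 6 p, arrs s 7 p)) (vars s 4) L"

lemma runs_push_half:
  assumes "adj_lists s L" "a \<in> {0, 1}" "b \<in> {0, 1}"
  shows "runs (push_half a b) s (\<lambda>k s'. k = 5 \<and>
    adj_lists s' (L(arrs s a (vars s 3) := (arrs s b (vars s 3), vars s 3) # L (arrs s a (vars s 3)))))"
proof -
  have ab: "a \<noteq> 4" "a \<noteq> 5" "a \<noteq> 6" "a \<noteq> 7" "b \<noteq> 4" "b \<noteq> 5" "b \<noteq> 6" "b \<noteq> 7" using assms by auto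
  have "lists ((arrs s 4)(arrs s a (vars s 3) := Suc (vars s 4))) ((arrs s 5)(Suc (vars s 4) := arrs s 4 (arrs s a (vars s 3))))
    (\<lambda>p. (((arrs s 6)(Suc (vars s 4) := arrs s b (vars s 3))) p, ((arrs s 7)(Suc (vars s 4) := vars s 3)) p)) (Suc (vars s 4))
    (L(arrs s a (vars s 3) := (arrs s b (vars s 3), vars s 3) # L (arrs s a (vars s 3))))"
    by (rule lists_push[OF assms(1)[unfolded adj_lists_def]]) auto
  then show ?thesis unfolding push_half_def adj_lists_def using ab by (simp del: fun_upd_apply add: fun_upd_same fun_upd_other)
qed

context problem
begin

lemma runs_build_adjacency:
  assumes "vars s 1 = m" "arrs s 0 = endA" "arrs s 1 = endB" "adj_lists s (adjl 0)"
  shows "runs build_adjacency s (\<lambda>k s'. k \<le> 2 + 12 * m \<and> adj_lists s' (adjl m))"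
proof -
  have "runs build_adjacency s (\<lambda>k s'. k \<le> 2 + (\<Sum>i=0..<m. 2 + 10) \<and> adj_lists s' (adjl m) \<and> vars s' 3 = m)"
    unfolding build_adjacency_def
  proof (rule runs_For[where I = "\<lambda>e s. adj_lists s (adjl e)"])
    fix e s' assume "adj_lists s' (adjl e)" "vars s' 3 = e"
      and f: "frame (For 3 (Num 0) (Var 1) (push_half 0 1 ;; push_half 1 0)) s s'"
    then have *: "adj_lists s' (adjl e)" "vars s' 3 = e" "arrs s' 0 = endA" "arrs s' 1 = endB"
      using frame_arrs[OF f] assms by auto
    show "runs (push_half 0 1 ;; push_half 1 0) s' (\<lambda>k s'. k \<le> 10 \<and> vars s' 3 = e \<and>
        adj_lists (s'\<lparr>vars := (vars s')(3 := Suc e)\<rparr>) (adjl (Suc e)))"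
      unfolding runs_simps
    proof (rule runs_cons[OF runs_push_half[OF *(1)]], simp, simp)
      fix k1 :: nat and s1 assume 1: "k1 = 5 \<and> adj_lists s1 ((adjl e)(arrs s' 0 (vars s' 3) := (arrs s' 1 (vars s' 3), vars s' 3) # adjl e (arrs s' 0 (vars s' 3))))"
        and f1: "frame (push_half 0 1) s' s1"
      have e1: "vars s1 3 = e" "arrs s1 0 = endA" "arrs s1 1 = endB"
        using frame_vars[OF f1, of 3] frame_arrs[OF f1, of 0] frame_arrs[OF f1, of 1] * by simp_all
      show "runs (push_half 1 0) s1 (\<lambda>k2 s2. k1 + k2 \<le> 10 \<and> vars s2 3 = e \<and> adj_lists (s2\<lparr>vars := (vars s2)(3 := Suc e)\<rparr>) (adjl (Suc e)))"
      proof (rule runs_cons[OF runs_push_half[OF conjunct2[OF 1]]], simp, simp)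
        fix k2 :: nat and s2 assume 2: "k2 = 5 \<and> adj_lists s2 (((adjl e)(arrs s' 0 (vars s' 3) := (arrs s' 1 (vars s' 3), vars s' 3) # adjl e (arrs s' 0 (vars s' 3))))
          (arrs s1 1 (vars s1 3) := (arrs s1 0 (vars s1 3), vars s1 3) # ((adjl e)(arrs s' 0 (vars s' 3) := (arrs s' 1 (vars s' 3), vars s' 3) # adjl e (arrs s' 0 (vars s' 3)))) (arrs s1 1 (vars s1 3))))"
          and f2: "frame (push_half 1 0) s1 s2"
        have "adj_lists s2 (adjl (Suc e))" using 2 unfolding *(2,3,4) e1 adjl.simps Let_def by blast
        then have "adj_lists (s2\<lparr>vars := (vars s2)(3 := Suc e)\<rparr>) (adjl (Suc e))" by (simp add: adj_lists_def)
        moreover have "vars s2 3 = e" using frame_vars[OF f2, of 3] e1 by simp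
        ultimately show "k1 + k2 \<le> 10 \<and> vars s2 3 = e \<and> adj_lists (s2\<lparr>vars := (vars s2)(3 := Suc e)\<rparr>) (adjl (Suc e))"
          using 1 2 by simp
      qed
    qed
  qed (use assms in \<open>auto simp: adj_lists_def frame_def\<close>)
  then show ?thesis by (rule runs_cons) auto
qed

definition bfs_state :: "nat list \<Rightarrow> state \<Rightarrow> bool" where
  "bfs_state q s \<longleftrightarrow> vars s 6 = length q \<and> (\<forall>i<length q. arrs s 9 i = q ! i) \<and>
     (\<forall>w. arrs s 8 w = (if w \<in> set q then Suc (lev w) else 0))"

lemma runs_visit:
  assumes "bfs_state q s" "u \<in> set q" "vars s 7 = u" "w = arrs s 6 (vars s 8)"
    and new: "w \<notin> set q \<Longrightarrow> lev w = Suc (lev u)"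
  shows "runs visit s (\<lambda>k s'. k \<le> 6 \<and> bfs_state (if w \<in> set q then q else q @ [w]) s')"
proof -
  have D: "arrs s 8 u = Suc (lev u)" "arrs s 8 w = (if w \<in> set q then Suc (lev w) else 0)"
    using assms(1,2) by (auto simp: bfs_state_def)
  show ?thesis
  proof (cases "w \<in> set q")
    case True
    then show ?thesis using D assms by (simp add: visit_def) (simp add: bfs_state_def)
  next
    case False
    then show ?thesis using D assms new by (simp add: visit_def) (auto simp: bfs_state_def nth_append)
  qed
qed

lemma runs_expand:
  assumes adj: "adj_lists s (adjl m)" and h: "h < n" "vars s 5 = h" and q: "bfs_state (bq h) s"
  shows "runs expand s (\<lambda>k s'. k \<le> 3 + 8 * length (adjl m (ord ! h)) \<and> bfs_state (bq (Suc h)) s')"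
proof -
  let ?u = "bq h ! h"
  have inv: "set (bq h) = insert v0 {w. \<exists>i<h. bq h ! i \<sim> w}" "sorted (map lev (bq h))" "h < length (bq h)"
    using bq_inv[of h] h by auto
  have u: "arrs s 9 h = ?u" "?u \<in> set (bq h)" using q inv(3) nth_mem[OF inv(3)] by (auto simp: bfs_state_def)
  define s1 where "s1 = s\<lparr>vars := (vars s)(7 := ?u, 8 := arrs s 4 ?u)\<rparr>"
  obtain ps where ps: "chain (arrs s 5) (arrs s 4 ?u) ps" "map (\<lambda>p. (arrs s 6 p, arrs s 7 p)) ps = adjl m ?u"
    using adj by (auto simp: adj_lists_def lists_def)
  let ?ws = "map fst (adjl m ?u)"
  have ws: "?ws = map (arrs s 6) ps" unfolding ps(2)[symmetric] by simp
  have len: "length ps = length (adjl m ?u)" unfolding ps(2)[symmetric] by simp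
  have "runs (While (Var 8) (visit ;; Assign 8 (Arr 5 (Var 8)))) s1
    (\<lambda>k s'. k \<le> Suc (\<Sum>i<length ps. 2 + 6) \<and> bfs_state (addnew (bq h) (take (length ps) ?ws)) s')"
  proof (rule runs_chain[where nx = "arrs s 5" and I = "\<lambda>i. bfs_state (addnew (bq h) (take i ?ws))"])
    show "chain (arrs s 5) (vars s1 8) ps" using ps by (simp add: s1_def)
    show "bfs_state (addnew (bq h) (take 0 ?ws)) s1" using q by (simp add: s1_def addnew_simps bfs_state_def)
  next
    fix i s' assume f: "frame (While (Var 8) (visit ;; Assign 8 (Arr 5 (Var 8)))) s1 s'"
    show "arrs s' 5 = arrs s 5" using frame_arrs[OF f, of 5] by (simp add: s1_def)
  next
    fix i s' assume i: "i < length ps" and b: "bfs_state (addnew (bq h) (take i ?ws)) s'" and p: "vars s' 8 = ps ! i"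
      and f: "frame (While (Var 8) (visit ;; Assign 8 (Arr 5 (Var 8)))) s1 s'"
    have fr: "vars s' 7 = ?u" "arrs s' 5 = arrs s 5" "arrs s' 6 = arrs s 6"
      using frame_vars[OF f, of 7] frame_arrs[OF f, of 5] frame_arrs[OF f, of 6] by (auto simp: s1_def)
    let ?w = "?ws ! i"
    have w: "arrs s' 6 (vars s' 8) = ?w" using i by (simp add: ws fr p)
    have "?w \<in> set ?ws" using i len by simp
    then have "?u \<sim> ?w" using nbrs_adjl[of ?u] by auto
    \<comment> \<open>A vertex missing from the extended queue is missing from the old one, so
      \<open>queue_near\<close> gives its level.\<close>
    then have new: "?w \<notin> set (addnew (bq h) (take i ?ws)) \<Longrightarrow> lev ?w = Suc (lev ?u)"
      using queue_near(2)[OF inv] by (auto simp: set_addnew)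
    have t: "take (Suc i) ?ws = take i ?ws @ [?w]" using i len by (simp add: take_Suc_conv_app_nth)
    show "runs visit s' (\<lambda>k s''. k \<le> 6 \<and> vars s'' 8 = vars s' 8 \<and> arrs s'' 5 = arrs s 5 \<and>
       bfs_state (addnew (bq h) (take (Suc i) ?ws)) (s''\<lparr>vars := (vars s'')(8 := arrs s 5 (ps ! i))\<rparr>))"
    proof (rule runs_cons[OF runs_visit[OF b _ fr(1) w[symmetric] new]])
      show "?u \<in> set (addnew (bq h) (take i ?ws))" using u by (simp add: set_addnew)
      fix k s'' assume 1: "k \<le> 6 \<and> bfs_state (if ?w \<in> set (addnew (bq h) (take i ?ws)) then addnew (bq h) (take i ?ws) else addnew (bq h) (take i ?ws) @ [?w]) s''"
        and f2: "frame visit s' s''"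
      then have "bfs_state (addnew (bq h) (take (Suc i) ?ws)) s''" unfolding t addnew_simps by simp
      then show "k \<le> 6 \<and> vars s'' 8 = vars s' 8 \<and> arrs s'' 5 = arrs s 5 \<and>
       bfs_state (addnew (bq h) (take (Suc i) ?ws)) (s''\<lparr>vars := (vars s'')(8 := arrs s 5 (ps ! i))\<rparr>)"
        using 1 frame_vars[OF f2, of 8] frame_arrs[OF f2, of 5] fr by (simp add: bfs_state_def)
    qed
  qed
  moreover have "runs expand s Q \<longleftrightarrow> runs (While (Var 8) (visit ;; Assign 8 (Arr 5 (Var 8)))) s1 (\<lambda>k. Q (Suc (Suc k)))" for Q
    using u h by (simp add: expand_def s1_def)
  ultimately show ?thesis
    using bq_ord[OF h(1)] by (simp add: len bq.simps) (erule runs_cons, simp)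
qed

lemma runs_search:
  assumes adj: "adj_lists s (adjl m)" and "vars s 0 = n" "vars s 2 = v0" "arrs s 8 = (\<lambda>_. 0)"
  shows "runs search s (\<lambda>k s'. k \<le> 5 + (\<Sum>h<n. 5 + 8 * length (adjl m (ord ! h))) \<and> bfs_state ord s')"
proof -
  define s1 where "s1 = s\<lparr>vars := (vars s)(6 := 1),
    arrs := (arrs s)(8 := (arrs s 8)(v0 := 1), 9 := (arrs s 9)(0 := v0))\<rparr>"
  have "runs (For 5 (Num 0) (Var 0) expand) s1 (\<lambda>k s'. k \<le> 2 + (\<Sum>h=0..<n. 2 + (3 + 8 * length (adjl m (ord ! h)))) \<and>
    bfs_state (bq n) s' \<and> vars s' 5 = n)"
  proof (rule runs_For)
    show "bfs_state (bq 0) (s1\<lparr>vars := (vars s1)(5 := 0)\<rparr>)"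
      using assms by (simp add: s1_def bfs_state_def)
  next
    fix h s' assume "h < n" "bfs_state (bq h) s'" "vars s' 5 = h" and f: "frame (For 5 (Num 0) (Var 0) expand) s1 s'"
    moreover have "adj_lists s' (adjl m)"
      using adj frame_vars[OF f, of 4] frame_arrs[OF f, of 4] frame_arrs[OF f, of 5] frame_arrs[OF f, of 6] frame_arrs[OF f, of 7]
      by (simp add: adj_lists_def s1_def)
    ultimately show "runs expand s' (\<lambda>k s''. k \<le> 3 + 8 * length (adjl m (ord ! h)) \<and> vars s'' 5 = h \<and>
      bfs_state (bq (Suc h)) (s''\<lparr>vars := (vars s'')(5 := Suc h)\<rparr>))"
      by (auto intro!: runs_cons[OF runs_expand] dest!: frame_vars[of _ _ _ 5] simp: bfs_state_def)
  next
    fix i s' assume f: "frame (For 5 (Num 0) (Var 0) expand) s1 s'"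
    show "exp_val (Var 0) s' = n" using frame_vars[OF f, of 0] assms by (simp add: s1_def)
  qed simp_all
  moreover have "runs search s Q \<longleftrightarrow> runs (For 5 (Num 0) (Var 0) expand) s1 (\<lambda>k. Q (Suc (Suc (Suc k))))" for Q
    using assms by (simp add: search_def s1_def)
  ultimately show ?thesis
    by (simp add: ord_def lessThan_atLeast0) (erule runs_cons, simp)
qed

section \<open>Blocks of lower neighbours\<close>

definition inl :: "nat \<Rightarrow> (nat \<times> nat) list" where
  "inl u = filter (\<lambda>(w, e). lev w < lev u) (adjl m u)"

text \<open>Finished blocks end at or before the fill mark \<open>vars s 10\<close>, so later writes
  at the mark leave them intact.\<close>

definition collected :: "nat \<Rightarrow> state \<Rightarrow> bool" where
  "collected u s \<longleftrightarrow> (\<forall>x<u. arrs s 10 x \<le> arrs s 11 x \<and> arrs s 11 x \<le> vars s 10 \<and>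
     map (\<lambda>i. (arrs s 12 i, arrs s 13 i)) [arrs s 10 x..<arrs s 11 x] = inl x)"

lemma map_upt_cong: "b \<le> c \<Longrightarrow> (\<And>i. i < c \<Longrightarrow> f i = g i) \<Longrightarrow> map f [a..<b] = map g [a..<b]"
  by simp

lemma runs_in_list:
  assumes adj: "adj_lists s (adjl m)" and u: "u < n" "vars s 7 = u" and D: "\<And>w. w < n \<Longrightarrow> arrs s 8 w = Suc (lev w)"
    and c: "collected u s"
  shows "runs in_list s (\<lambda>k s'. k \<le> 4 + 7 * length (adjl m u) \<and> collected (Suc u) s')"
proof -
  define k0 where "k0 = vars s 10"
  define s1 where "s1 = s\<lparr>arrs := (arrs s)(10 := (arrs s 10)(u := k0)), vars := (vars s)(8 := arrs s 4 u)\<rparr>"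
  obtain ps where ps: "chain (arrs s 5) (arrs s 4 u) ps" "map (\<lambda>p. (arrs s 6 p, arrs s 7 p)) ps = adjl m u"
    using adj by (auto simp: adj_lists_def lists_def)
  have len: "length ps = length (adjl m u)" unfolding ps(2)[symmetric] by simp
  define P where "P = (\<lambda>(w, e::nat). lev w < lev u)"
  define J where "J = (\<lambda>i (s' :: state). k0 \<le> vars s' 10 \<and>
    map (\<lambda>i. (arrs s' 12 i, arrs s' 13 i)) [k0..<vars s' 10] = filter P (take i (adjl m u)) \<and>
    (\<forall>i<k0. arrs s' 12 i = arrs s 12 i \<and> arrs s' 13 i = arrs s 13 i))"
  have J: "runs (While (Var 8) (collect ;; Assign 8 (Arr 5 (Var 8)))) s1
    (\<lambda>k s'. k \<le> Suc (\<Sum>i<length ps. 2 + 5) \<and> J (length ps) s')"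
  proof (rule runs_chain[where nx = "arrs s 5"])
    show "chain (arrs s 5) (vars s1 8) ps" using ps by (simp add: s1_def)
    show "J 0 s1" by (simp add: s1_def J_def k0_def)
  next
    fix i s' assume f: "frame (While (Var 8) (collect ;; Assign 8 (Arr 5 (Var 8)))) s1 s'"
    show "arrs s' 5 = arrs s 5" using frame_arrs[OF f, of 5] by (simp add: s1_def)
  next
    fix i s' assume i: "i < length ps" and j: "J i s'" and p: "vars s' 8 = ps ! i"
      and f: "frame (While (Var 8) (collect ;; Assign 8 (Arr 5 (Var 8)))) s1 s'"
    have fr: "vars s' 7 = u" "arrs s' 5 = arrs s 5" "arrs s' 6 = arrs s 6" "arrs s' 7 = arrs s 7" "arrs s' 8 = arrs s 8"
      using frame_vars[OF f, of 7] frame_arrs[OF f, of 5] frame_arrs[OF f, of 6] frame_arrs[OF f, of 7] frame_arrs[OF f, of 8] u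
      by (auto simp: s1_def)
    obtain w e where we: "adjl m u ! i = (w, e)" by fastforce
    have "adjl m u ! i = (arrs s 6 (ps ! i), arrs s 7 (ps ! i))" unfolding ps(2)[symmetric] using i by simp
    then have tg: "arrs s 6 (ps ! i) = w" "arrs s 7 (ps ! i) = e" using we by auto
    have "w \<in> fst ` set (adjl m u)" using we i len by (metis fst_conv image_eqI nth_mem)
    then have w: "w < n" using nbrs_adjl adj_V(2) verts by auto
    have t: "take (Suc i) (adjl m u) = take i (adjl m u) @ [(w, e)]" using i len we by (simp add: take_Suc_conv_app_nth)
    have D': "arrs s 8 w = Suc (lev w)" "arrs s 8 u = Suc (lev u)" using D w u by auto
    have j': "k0 \<le> vars s' 10" "map (\<lambda>i. (arrs s' 12 i, arrs s' 13 i)) [k0..<vars s' 10] = filter P (take i (adjl m u))"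
      "\<forall>i<k0. arrs s' 12 i = arrs s 12 i \<and> arrs s' 13 i = arrs s 13 i" using j by (auto simp: J_def)
    have m: "map (\<lambda>i. (((arrs s' 12)(vars s' 10 := w)) i, ((arrs s' 13)(vars s' 10 := e)) i)) [k0..<vars s' 10] =
      map (\<lambda>i. (arrs s' 12 i, arrs s' 13 i)) [k0..<vars s' 10]" by simp
    show "runs collect s' (\<lambda>k s''. k \<le> 5 \<and> vars s'' 8 = vars s' 8 \<and> arrs s'' 5 = arrs s 5 \<and>
       J (Suc i) (s''\<lparr>vars := (vars s'')(8 := arrs s 5 (ps ! i))\<rparr>))"
    proof (cases "lev w < lev u")
      case True
      then show ?thesis
        by (simp add: collect_def fr p tg D' del: fun_upd_apply add: fun_upd_same fun_upd_other)
          (use j' m in \<open>auto simp: J_def t P_def fr\<close>)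
    next
      case False
      then show ?thesis using j' by (simp add: collect_def fr p tg D') (simp add: J_def t P_def)
    qed
  qed
  have eq: "runs in_list s Q \<longleftrightarrow> runs (While (Var 8) (collect ;; Assign 8 (Arr 5 (Var 8))) ;; Store 11 (Var 7) (Var 10)) s1 (\<lambda>k. Q (Suc (Suc k)))" for Q
    using u by (simp add: in_list_def s1_def k0_def)
  show ?thesis
    unfolding eq runs_simps
  proof (rule runs_cons[OF J])
    fix k s' assume j: "k \<le> Suc (\<Sum>i<length ps. 2 + 5) \<and> J (length ps) s'"
      and f: "frame (While (Var 8) (collect ;; Assign 8 (Arr 5 (Var 8)))) s1 s'"
    have fr: "vars s' 7 = u" "arrs s' 10 = (arrs s 10)(u := k0)" "arrs s' 11 = arrs s 11"
      using frame_vars[OF f, of 7] frame_arrs[OF f, of 10] frame_arrs[OF f, of 11] u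
      by (auto simp: s1_def)
    define s2 where "s2 = s'\<lparr>arrs := (arrs s')(11 := (arrs s' 11)(vars s' 7 := vars s' 10))\<rparr>"
    have s2: "arrs s2 10 = (arrs s 10)(u := k0)" "arrs s2 11 = (arrs s 11)(u := vars s' 10)"
      "arrs s2 12 = arrs s' 12" "arrs s2 13 = arrs s' 13" "vars s2 10 = vars s' 10" by (simp_all add: s2_def fr)
    have j': "k0 \<le> vars s' 10" "map (\<lambda>i. (arrs s' 12 i, arrs s' 13 i)) [k0..<vars s' 10] = inl u"
      "\<forall>i<k0. arrs s' 12 i = arrs s 12 i \<and> arrs s' 13 i = arrs s 13 i"
      using j len by (auto simp: J_def inl_def P_def)
    have "arrs s2 10 x \<le> arrs s2 11 x \<and> arrs s2 11 x \<le> vars s2 10 \<and>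
      map (\<lambda>i. (arrs s2 12 i, arrs s2 13 i)) [arrs s2 10 x..<arrs s2 11 x] = inl x" if x: "x < Suc u" for x
    proof (cases "x = u")
      case True
      then show ?thesis using j' by (simp add: s2)
    next
      case False
      then have "arrs s 10 x \<le> arrs s 11 x" "arrs s 11 x \<le> k0"
        "map (\<lambda>i. (arrs s 12 i, arrs s 13 i)) [arrs s 10 x..<arrs s 11 x] = inl x"
        using c x by (auto simp: collected_def k0_def)
      moreover have "map (\<lambda>i. (arrs s' 12 i, arrs s' 13 i)) [arrs s 10 x..<arrs s 11 x] =
        map (\<lambda>i. (arrs s 12 i, arrs s 13 i)) [arrs s 10 x..<arrs s 11 x]"
        using j'(3) calculation(2) by (intro map_upt_cong[of _ k0]) auto
      ultimately show ?thesis using False j'(1) by (simp add: s2)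
    qed
    then have "collected (Suc u) s2" by (simp add: collected_def)
    then show "Suc (Suc (k + 1)) \<le> 4 + 7 * length (adjl m u) \<and> collected (Suc u)
       (s'\<lparr>arrs := (arrs s')(11 := (arrs s' 11)(exp_val (Var 7) s' := exp_val (Var 10) s'))\<rparr>)"
      using j len by (simp add: s2_def)
  qed
qed

lemma runs_in_lists:
  assumes adj: "adj_lists s (adjl m)" and "vars s 0 = n" and D: "\<And>w. w < n \<Longrightarrow> arrs s 8 w = Suc (lev w)"
  shows "runs in_lists s (\<lambda>k s'. k \<le> 2 + (\<Sum>u<n. 6 + 7 * length (adjl m u)) \<and> collected n s')"
proof -
  have "runs in_lists s (\<lambda>k s'. k \<le> 2 + (\<Sum>u=0..<n. 2 + (4 + 7 * length (adjl m u))) \<and> collected n s' \<and> vars s' 7 = n)"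
    unfolding in_lists_def
  proof (rule runs_For)
    show "collected 0 (s\<lparr>vars := (vars s)(7 := 0)\<rparr>)" by (simp add: collected_def)
  next
    fix u s' assume *: "u < n" "collected u s'" "vars s' 7 = u" and f: "frame (For 7 (Num 0) (Var 0) in_list) s s'"
    have adj': "adj_lists s' (adjl m)"
      using adj frame_vars[OF f, of 4] frame_arrs[OF f, of 4] frame_arrs[OF f, of 5] frame_arrs[OF f, of 6] frame_arrs[OF f, of 7]
      by (simp add: adj_lists_def)
    have D': "arrs s' 8 w = Suc (lev w)" if "w < n" for w
      using D[OF that] frame_arrs[OF f, of 8] by simp
    show "runs in_list s' (\<lambda>k s''. k \<le> 4 + 7 * length (adjl m u) \<and> vars s'' 7 = u \<and>
      collected (Suc u) (s''\<lparr>vars := (vars s'')(7 := Suc u)\<rparr>))"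
      by (rule runs_cons[OF runs_in_list[OF adj' *(1,3) D' *(2)]])
        (use *(3) in \<open>auto simp: collected_def dest: frame_vars[of _ _ _ 7]\<close>)
  next
    fix i s' assume f: "frame (For 7 (Num 0) (Var 0) in_list) s s'"
    show "exp_val (Var 0) s' = n" using frame_vars[OF f, of 0] assms by simp
  qed simp_all
  then show ?thesis by (rule runs_cons) (simp add: lessThan_atLeast0)
qed

text \<open>A description of arrays 10 to 13 that mentions no state: the later phases only read
  them, so they can become locale parameters.\<close>

definition in_ok :: "(nat \<Rightarrow> nat) \<Rightarrow> (nat \<Rightarrow> nat) \<Rightarrow> (nat \<Rightarrow> nat) \<Rightarrow> (nat \<Rightarrow> nat) \<Rightarrow> bool" where
  "in_ok st en lo ie \<longleftrightarrow> (\<forall>u<n. st u \<le> en u \<and> en u - st u \<le> dm \<and> inj_on lo {st u..<en u} \<and>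
     (\<forall>k \<in> {st u..<en u}. lower (lo k) u \<and> ie k < m \<and> edge (ie k) = {lo k, u}) \<and>
     (\<forall>w. lower w u \<longrightarrow> (\<exists>k \<in> {st u..<en u}. lo k = w)))"

lemma set_inl: "set (inl u) = {(w, e). lower w u \<and> e < m \<and> edge e = {w, u}}"
proof -
  have "(w, e) \<in> set (inl u) \<longleftrightarrow> lower w u \<and> e < m \<and> edge e = {w, u}" for w e
  proof -
    have "(w, e) \<in> set (inl u) \<longleftrightarrow> lev w < lev u \<and> e < m \<and> edge e = {u, w}"
      by (auto simp: inl_def set_adjl)
    moreover have "w \<sim> u" if "e < m" "edge e = {u, w}"
      using edge_adj[OF that(1)] that(2) adj_sym by (metis doubleton_eq_iff)
    ultimately show ?thesis by (auto simp: lower_def insert_commute)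
  qed
  then show ?thesis by auto
qed

lemma distinct_fst_inl: "distinct (map fst (inl u))"
proof -
  have "inj_on fst (set (inl u))"
    unfolding set_inl using edge_inj by (auto intro!: inj_onI)
  moreover have "distinct (inl u)" using distinct_adjl by (simp add: inl_def)
  ultimately show ?thesis by (simp add: distinct_map)
qed

lemma collected_in_ok:
  assumes "collected n s"
  shows "in_ok (arrs s 10) (arrs s 11) (arrs s 12) (arrs s 13)"
  unfolding in_ok_def
proof (intro allI impI)
  fix u assume u: "u < n"
  let ?I = "{arrs s 10 u..<arrs s 11 u}"
  have le: "arrs s 10 u \<le> arrs s 11 u"
    and eq: "map (\<lambda>i. (arrs s 12 i, arrs s 13 i)) [arrs s 10 u..<arrs s 11 u] = inl u"
    using assms u by (auto simp: collected_def)
  have lo: "map fst (inl u) = map (arrs s 12) [arrs s 10 u..<arrs s 11 u]" unfolding eq[symmetric] by simp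
  have s: "set (inl u) = (\<lambda>i. (arrs s 12 i, arrs s 13 i)) ` ?I" unfolding eq[symmetric] by simp
  have inj: "inj_on (arrs s 12) ?I" using distinct_fst_inl[of u] unfolding lo by (simp add: distinct_map)
  have mem: "lower (arrs s 12 k) u \<and> arrs s 13 k < m \<and> edge (arrs s 13 k) = {arrs s 12 k, u}" if "k \<in> ?I" for k
    using s that unfolding set_inl by blast
  have ex: "\<exists>k \<in> ?I. arrs s 12 k = w" if w: "lower w u" for w
  proof -
    obtain e where "e < m" "edge e = {w, u}" using edge_exists[OF lowerD(1)[OF w]] by blast
    then have "(w, e) \<in> set (inl u)" unfolding set_inl using w by blast
    then show ?thesis unfolding s by auto
  qed
  have "card (arrs s 12 ` ?I) \<le> card {w. lower w u}" using mem finite_lower by (intro card_mono) auto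
  then have "arrs s 11 u - arrs s 10 u \<le> dm" using card_lower_le[OF u] card_image[OF inj] by simp
  then show "arrs s 10 u \<le> arrs s 11 u \<and> arrs s 11 u - arrs s 10 u \<le> dm \<and> inj_on (arrs s 12) ?I \<and>
     (\<forall>k \<in> ?I. lower (arrs s 12 k) u \<and> arrs s 13 k < m \<and> edge (arrs s 13 k) = {arrs s 12 k, u}) \<and>
     (\<forall>w. lower w u \<longrightarrow> (\<exists>k \<in> ?I. arrs s 12 k = w))" using le inj mem ex by blast
qed

end

section \<open>Computing the classes\<close>

text \<open>Four nested loops search for squares below the vertex in variable 7. Variable 20 is the
  edge to be labelled, 21 the second edge below the same top, and 23 and 24 are edges below the two
  lower ends that have to meet in one vertex. The edge at 24 is the one opposite to the edge at 20,
  so its label is copied. Exhaustive search costs only a power of the dimension per vertex.\<close>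

definition label_j :: com where
  "label_j = For 24 (Arr 10 (Arr 12 (Var 21))) (Arr 11 (Arr 12 (Var 21)))
     (If (Bin Equal (Arr 12 (Var 23)) (Arr 12 (Var 24))) (Store 2 (Arr 13 (Var 20)) (Arr 2 (Arr 13 (Var 24)))) Skip)"

definition label_i :: com where
  "label_i = For 23 (Arr 10 (Arr 12 (Var 20))) (Arr 11 (Arr 12 (Var 20))) label_j"

definition label_k2 :: com where
  "label_k2 = For 21 (Arr 10 (Var 7)) (Arr 11 (Var 7)) (If (Bin Equal (Var 20) (Var 21)) Skip label_i)"

definition label_k :: com where
  "label_k = For 20 (Arr 10 (Var 7)) (Arr 11 (Var 7)) (Store 2 (Arr 13 (Var 20)) (Arr 13 (Var 20)) ;; label_k2)"

definition label_edges :: com where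
  "label_edges = For 5 (Num 0) (Var 0) (Assign 7 (Arr 9 (Var 5)) ;; label_k)"

lemma wvars_label [simp]:
  "wvars label_j = {24}" "wvars label_i = {23, 24}" "wvars label_k2 = {21, 23, 24}"
  "wvars label_k = {20, 21, 23, 24}" "wvars label_edges = {5, 7, 20, 21, 23, 24}"
  by (auto simp: label_j_def label_i_def label_k2_def label_k_def label_edges_def)

lemma warrs_label [simp]:
  "warrs label_j = {2}" "warrs label_i = {2}" "warrs label_k2 = {2}" "warrs label_k = {2}"
  "warrs label_edges = {2}"
  by (auto simp: label_j_def label_i_def label_k2_def label_k_def label_edges_def)

locale in_listing = problem +
  fixes st en lo ie :: "nat \<Rightarrow> nat"
  assumes in_ok: "in_ok st en lo ie"
begin

abbreviation rg :: "nat \<Rightarrow> nat set" where "rg u \<equiv> {st u..<en u}"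

lemma rg:
  assumes "u < n"
  shows "st u \<le> en u" "en u - st u \<le> dm" "inj_on lo (rg u)"
    and "k \<in> rg u \<Longrightarrow> lower (lo k) u" "k \<in> rg u \<Longrightarrow> ie k < m" "k \<in> rg u \<Longrightarrow> edge (ie k) = {lo k, u}"
    and "lower w u \<Longrightarrow> \<exists>k \<in> rg u. lo k = w"
  using in_ok assms unfolding in_ok_def by blast+

lemma lo_lt: "u < n \<Longrightarrow> k \<in> rg u \<Longrightarrow> lo k < n"
  using rg(4) lower_lt(1) by blast

text \<open>An edge has only one upper end. Blocks of different vertices therefore list different
  edges, and labelling one block leaves the others alone.\<close>

lemma ie_top:
  assumes "u < n" "w < n" "k \<in> rg u" "j \<in> rg w" "ie k = ie j"
  shows "u = w"
proof -
  have "{lo k, u} = {lo j, w}" using rg(6) assms by metis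
  moreover have "lev (lo k) < lev u" "lev (lo j) < lev w" using rg(4) assms by (auto simp: lower_def)
  ultimately show ?thesis by (auto simp: doubleton_eq_iff)
qed

lemma ie_inj: "u < n \<Longrightarrow> inj_on ie (rg u)"
proof (rule inj_onI)
  fix k j assume *: "u < n" "k \<in> rg u" "j \<in> rg u" "ie k = ie j"
  then have "{lo k, u} = {lo j, u}" using rg(6) by metis
  then have "lo k = lo j" by (auto simp: doubleton_eq_iff)
  then show "k = j" using inj_onD[OF rg(3)[OF *(1)] _ *(2,3)] by blast
qed

definition env :: "state \<Rightarrow> bool" where
  "env s \<longleftrightarrow> arrs s 10 = st \<and> arrs s 11 = en \<and> arrs s 12 = lo \<and> arrs s 13 = ie"

lemma env_frame: "frame c s s' \<Longrightarrow> {10, 11, 12, 13} \<inter> warrs c = {} \<Longrightarrow> env s \<Longrightarrow> env s'"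
  by (auto simp: env_def frame_arrs)

section \<open>Squares below a vertex and inherited labels\<close>

text \<open>A triple names a square with top \<open>u\<close>: its middle vertices are
  \<open>lo k\<close> and \<open>lo k2\<close>, its bottom is \<open>lo i = lo j\<close>, and
  \<open>ie j\<close> is the edge opposite to \<open>ie k\<close>.\<close>

definition matches :: "nat \<Rightarrow> nat \<Rightarrow> (nat \<times> nat \<times> nat) set" where
  "matches u k = {(k2, i, j). k2 \<in> rg u \<and> k2 \<noteq> k \<and> i \<in> rg (lo k) \<and> j \<in> rg (lo k2) \<and> lo i = lo j}"

text \<open>\<open>P\<close> collects the triples examined so far. Later matches may overwrite
  earlier ones, so all that is kept is that the label stems from some match, or is still the initial
  one and no match has been met.\<close>

definition found :: "nat \<Rightarrow> nat \<Rightarrow> (nat \<Rightarrow> nat) \<Rightarrow> (nat \<times> nat \<times> nat) set \<Rightarrow> (nat \<Rightarrow> nat) \<Rightarrow> bool" where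
  "found u k lab0 P lab \<longleftrightarrow> (\<exists>v. lab = lab0(ie k := v) \<and>
     (v = ie k \<and> P \<inter> matches u k = {} \<or> (\<exists>(k2, i, j) \<in> matches u k. v = lab0 (ie j))))"

text \<open>The opposite edge has top \<open>lo k2\<close>, strictly below \<open>u\<close>, so its
  label is not changed while the block of \<open>u\<close> is processed.\<close>

lemma ie_match:
  assumes "u < n" "k \<in> rg u" "k' \<in> rg u" "(k2, i, j) \<in> matches u k'"
  shows "ie j \<noteq> ie k"
proof
  assume eq: "ie j = ie k"
  have k2: "k2 \<in> rg u" "j \<in> rg (lo k2)" using assms by (auto simp: matches_def)
  then have "lo k2 = u" using ie_top[OF lo_lt[OF assms(1)] assms(1)] eq assms by metis
  then show False using rg(4)[OF assms(1) k2(1)] lowerD(7) by blast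
qed

lemma sum_ran_le:
  fixes c :: nat
  shows "u < n \<Longrightarrow> (\<Sum>i=st u..<en u. c) \<le> dm * c"
  using rg(2)[of u] by simp

text \<open>One more loop of at most \<open>d\<close> rounds raises the exponent by one and the
  constant by \<open>a + 2\<close>. In this way the constant 6 of \<open>label_j\<close> becomes 10,
  15 and 20 in the enclosing loops.\<close>

lemma loop_bound:
  fixes d :: nat
  assumes "T \<le> 2 + d * (a + b * Suc d ^ p)" "q = Suc p"
  shows "T \<le> (a + b + 2) * Suc d ^ q"
proof -
  have X: "1 \<le> Suc d ^ p" by simp
  have "d * a \<le> d * a * Suc d ^ p" "2 \<le> 2 * Suc d ^ p" using X by simp_all
  moreover have "(a + b + 2) * Suc d ^ Suc p =
      d * a * Suc d ^ p + d * b * Suc d ^ p + 2 * (d * Suc d ^ p) + (a + b) * Suc d ^ p + 2 * Suc d ^ p"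
    by (simp add: algebra_simps)
  moreover have "2 + d * (a + b * Suc d ^ p) = 2 + d * a + d * b * Suc d ^ p" by (simp add: algebra_simps)
  ultimately show ?thesis unfolding assms(2) using assms(1) by linarith
qed

lemma loop_rg:
  assumes "t \<le> 2 + (\<Sum>i=st u..<en u. a + b * Suc dm ^ p)" "u < n"
  shows "t \<le> (a + b + 2) * Suc dm ^ Suc p"
  using loop_bound[OF _ refl, of t dm a b p] sum_ran_le[OF assms(2), of "a + b * Suc dm ^ p"] assms(1)
  by linarith

lemma runs_label_j:
  assumes s: "env s" "vars s 20 = k" "vars s 21 = k2" "vars s 23 = i"
    and u: "u < n" "k \<in> rg u" "k2 \<in> rg u" "k2 \<noteq> k" "i \<in> rg (lo k)"
    and fd: "found u k lab0 P (arrs s 2)"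
  shows "runs label_j s (\<lambda>t s'. t \<le> 6 * Suc dm \<and> found u k lab0 (P \<union> {k2} \<times> {i} \<times> rg (lo k2)) (arrs s' 2))"
proof -
  have w: "lo k2 < n" using lo_lt u by blast
  have "runs label_j s (\<lambda>t s'. t \<le> 2 + (\<Sum>j=st (lo k2)..<en (lo k2). 2 + 2) \<and>
    found u k lab0 (P \<union> {k2} \<times> {i} \<times> {st (lo k2)..<en (lo k2)}) (arrs s' 2) \<and> vars s' 24 = en (lo k2))"
    unfolding label_j_def
  proof (rule runs_For[where I = "\<lambda>j s'. found u k lab0 (P \<union> {k2} \<times> {i} \<times> {st (lo k2)..<j}) (arrs s' 2)"], goal_cases)
    case 1 show ?case using s by (simp add: env_def)
  next
    case 2 show ?case using rg(1)[OF w] .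
  next
    case 3 show ?case using fd by simp
  next
    case (4 j s')
    then have "env s'" "vars s' 21 = k2" using env_frame[OF 4(5)] frame_vars[OF 4(5), of 21] s by auto
    then show ?case by (simp add: env_def)
  next
    case (5 j s')
    then have e: "env s'" "vars s' 20 = k" "vars s' 21 = k2" "vars s' 23 = i"
      using env_frame[OF 5(5)] frame_vars[OF 5(5)] s by auto
    obtain v where v: "arrs s' 2 = lab0(ie k := v)"
      "v = ie k \<and> (P \<union> {k2} \<times> {i} \<times> {st (lo k2)..<j}) \<inter> matches u k = {} \<or> (\<exists>(k2, i, j) \<in> matches u k. v = lab0 (ie j))"
      using 5(3) by (auto simp: found_def)
    have P: "P \<union> {k2} \<times> {i} \<times> {st (lo k2)..<Suc j} = insert (k2, i, j) (P \<union> {k2} \<times> {i} \<times> {st (lo k2)..<j})"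
      using 5(1) by auto
    show ?case
    proof (cases "lo i = lo j")
      case True
      then have mt: "(k2, i, j) \<in> matches u k" using u 5(1,2) by (auto simp: matches_def)
      then have "ie j \<noteq> ie k" using ie_match u by blast
      then have "found u k lab0 (P \<union> {k2} \<times> {i} \<times> {st (lo k2)..<Suc j}) ((arrs s' 2)(ie k := arrs s' 2 (ie j)))"
        unfolding found_def v(1) using mt by (intro exI[of _ "lab0 (ie j)"]) auto
      then show ?thesis using True e 5(4) by (simp add: env_def)
    next
      case False
      then have "(k2, i, j) \<notin> matches u k" by (auto simp: matches_def)
      then have "found u k lab0 (P \<union> {k2} \<times> {i} \<times> {st (lo k2)..<Suc j}) (arrs s' 2)"
        unfolding found_def P using v by auto
      then show ?thesis using False e 5(4) by (simp add: env_def)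
    qed
  qed
  then show ?thesis
    by (rule runs_cons) (use sum_ran_le[OF w, of 4] in auto)
qed

lemma runs_label_i:
  assumes s: "env s" "vars s 20 = k" "vars s 21 = k2"
    and u: "u < n" "k \<in> rg u" "k2 \<in> rg u" "k2 \<noteq> k"
    and fd: "found u k lab0 P (arrs s 2)"
  shows "runs label_i s (\<lambda>t s'. t \<le> 10 * Suc dm ^ 2 \<and> found u k lab0 (P \<union> {k2} \<times> rg (lo k) \<times> rg (lo k2)) (arrs s' 2))"
proof -
  have w: "lo k < n" using lo_lt u by blast
  have "runs label_i s (\<lambda>t s'. t \<le> 2 + (\<Sum>i=st (lo k)..<en (lo k). 2 + 6 * Suc dm) \<and>
    found u k lab0 (P \<union> {k2} \<times> {st (lo k)..<en (lo k)} \<times> rg (lo k2)) (arrs s' 2) \<and> vars s' 23 = en (lo k))"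
    unfolding label_i_def
  proof (rule runs_For[where I = "\<lambda>i s'. found u k lab0 (P \<union> {k2} \<times> {st (lo k)..<i} \<times> rg (lo k2)) (arrs s' 2)"], goal_cases)
    case 1 show ?case using s by (simp add: env_def)
  next
    case 2 show ?case using rg(1)[OF w] .
  next
    case 3 show ?case using fd by simp
  next
    case (4 i s')
    then have "env s'" "vars s' 20 = k" using env_frame[OF 4(5)] frame_vars[OF 4(5), of 20] s by auto
    then show ?case by (simp add: env_def)
  next
    case (5 i s')
    then have e: "env s'" "vars s' 20 = k" "vars s' 21 = k2" "vars s' 23 = i"
      using env_frame[OF 5(5)] frame_vars[OF 5(5)] s by auto
    have i: "i \<in> rg (lo k)" using 5(1,2) by simp
    have P: "P \<union> {k2} \<times> {st (lo k)..<Suc i} \<times> rg (lo k2) = P \<union> {k2} \<times> {st (lo k)..<i} \<times> rg (lo k2) \<union> {k2} \<times> {i} \<times> rg (lo k2)"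
      using 5(1) by auto
    show ?case
      by (rule runs_cons[OF runs_label_j[OF e u i 5(3)]]) (use e(4) in \<open>auto simp: P dest: frame_vars[of _ _ _ 23]\<close>)
  qed
  then show ?thesis
  proof (rule runs_cons, goal_cases)
    case (1 t s')
    then have "t \<le> (2 + 6 + 2) * Suc dm ^ Suc 1" by (intro loop_rg[OF _ w]) simp
    then show ?case using 1 by (simp add: numeral_2_eq_2)
  qed
qed

lemma runs_label_k2:
  assumes s: "env s" "vars s 20 = k" "vars s 7 = u"
    and u: "u < n" "k \<in> rg u"
    and fd: "found u k lab0 {} (arrs s 2)"
  shows "runs label_k2 s (\<lambda>t s'. t \<le> 15 * Suc dm ^ 3 \<and> found u k lab0 (matches u k) (arrs s' 2))"
proof -
  define R where "R z = {(k2, i, j). k2 \<in> {st u..<z} \<and> k2 \<noteq> k \<and> i \<in> rg (lo k) \<and> j \<in> rg (lo k2)}" for z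
  have main: "runs label_k2 s (\<lambda>t s'. t \<le> 2 + (\<Sum>i=st u..<en u. 2 + Suc (10 * Suc dm ^ 2)) \<and>
    found u k lab0 (R (en u)) (arrs s' 2) \<and> vars s' 21 = en u)"
    unfolding label_k2_def
  proof (rule runs_For[where I = "\<lambda>z s'. found u k lab0 (R z) (arrs s' 2)"], goal_cases)
    case 1 show ?case using s by (simp add: env_def)
  next
    case 2 show ?case using rg(1)[OF u(1)] .
  next
    case 3
    have "R (st u) = {}" by (auto simp: R_def)
    then show ?case using fd by simp
  next
    case (4 i s')
    then have "env s'" "vars s' 7 = u" using env_frame[OF 4(5)] frame_vars[OF 4(5), of 7] s by auto
    then show ?case by (simp add: env_def)
  next
    case (5 i s')
    then have e: "env s'" "vars s' 20 = k" "vars s' 21 = i"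
      using env_frame[OF 5(5)] frame_vars[OF 5(5)] s by auto
    have i: "i \<in> rg u" using 5(1,2) by simp
    show ?case
    proof (cases "i = k")
      case True
      then have "R (Suc i) = R i" by (auto simp: R_def)
      then show ?thesis using e True 5(3) by simp
    next
      case False
      have P: "R (Suc i) = R i \<union> {i} \<times> rg (lo k) \<times> rg (lo i)"
        using 5(1) False unfolding R_def less_Suc_eq atLeastLessThan_iff by auto
      show ?thesis
        using False e
        by (simp add: P) (rule runs_cons[OF runs_label_i[OF e u i False 5(3)]], auto dest: frame_vars[of _ _ _ 21])
    qed
  qed
  \<comment> \<open>\<open>R\<close> omits the condition \<open>lo i = lo j\<close> and is larger
    than \<open>matches\<close>; \<open>found\<close> looks only at the intersection.\<close>
  have "R (en u) \<inter> matches u k = matches u k" by (auto simp: R_def matches_def)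
  then have conv: "found u k lab0 (R (en u)) lab \<Longrightarrow> found u k lab0 (matches u k) lab" for lab by (simp add: found_def)
  show ?thesis
  proof (rule runs_cons[OF main], goal_cases)
    case (1 t s')
    then have "t \<le> 2 + (\<Sum>i=st u..<en u. 3 + 10 * Suc dm ^ 2)"
      by (simp only: numeral_3_eq_3 add_2_eq_Suc add_Suc add_0)
    then have "t \<le> (3 + 10 + 2) * Suc dm ^ Suc 2" by (rule loop_rg[OF _ u(1)])
    then have "t \<le> 15 * Suc dm ^ 3" by (simp only: Suc_numeral semiring_norm)
    then show ?case using 1 conv by blast
  qed
qed

text \<open>The local rule as a property of labels alone. It persists as long as the entries it
  mentions do, and \<open>labk_class_naming\<close> shows that it suffices.\<close>

definition labk :: "nat \<Rightarrow> nat \<Rightarrow> (nat \<Rightarrow> nat) \<Rightarrow> bool" where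
  "labk u k lab \<longleftrightarrow> matches u k = {} \<and> lab (ie k) = ie k \<or> (\<exists>(k2, i, j) \<in> matches u k. lab (ie k) = lab (ie j))"

lemma labk_cong:
  assumes "labk u k lab" "lab' (ie k) = lab (ie k)" "\<And>k2 i j. (k2, i, j) \<in> matches u k \<Longrightarrow> lab' (ie j) = lab (ie j)"
  shows "labk u k lab'"
  using assms unfolding labk_def by fastforce

lemma runs_label_k:
  assumes s: "env s" "vars s 7 = u" and u: "u < n"
  shows "runs label_k s (\<lambda>t s'. t \<le> 20 * Suc dm ^ 4 \<and>
    (\<forall>k \<in> rg u. labk u k (arrs s' 2)) \<and> (\<forall>e. e \<notin> ie ` rg u \<longrightarrow> arrs s' 2 e = arrs s 2 e))"
proof -
  define I where "I z s' \<longleftrightarrow> (\<forall>k \<in> {st u..<z}. labk u k (arrs s' 2)) \<and>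
     (\<forall>e. e \<notin> ie ` rg u \<longrightarrow> arrs s' 2 e = arrs s 2 e)" for z and s' :: state
  have "runs label_k s (\<lambda>t s'. t \<le> 2 + (\<Sum>i=st u..<en u. 2 + Suc (15 * Suc dm ^ 3)) \<and> I (en u) s' \<and> vars s' 20 = en u)"
    unfolding label_k_def
  proof (rule runs_For[where I = I], goal_cases)
    case 1 show ?case using s by (simp add: env_def)
  next
    case 2 show ?case using rg(1)[OF u(1)] .
  next
    case 3 show ?case by (simp add: I_def)
  next
    case (4 k s')
    then have "env s'" "vars s' 7 = u" using env_frame[OF 4(5)] frame_vars[OF 4(5), of 7] s by auto
    then show ?case by (simp add: env_def)
  next
    case (5 k s')
    then have e: "env s'" "vars s' 20 = k" "vars s' 7 = u"
      using env_frame[OF 5(5)] frame_vars[OF 5(5)] s by auto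
    have k: "k \<in> rg u" using 5(1,2) by simp
    let ?s1 = "s'\<lparr>arrs := (arrs s')(2 := (arrs s' 2)(ie k := ie k))\<rparr>"
    have e1: "env ?s1" "vars ?s1 20 = k" "vars ?s1 7 = u" using e by (simp_all add: env_def)
    have f1: "found u k (arrs s' 2) {} (arrs ?s1 2)" by (auto simp: found_def)
    \<comment> \<open>Only the entry of \<open>ie k\<close> changes; no earlier edge of the block
      and no edge opposite to one of the block is stored there.\<close>
    have post: "I (Suc k) (s2\<lparr>vars := v\<rparr>)" if fd: "found u k (arrs s' 2) (matches u k) (arrs s2 2)" for s2 v
    proof -
      obtain v where v: "arrs s2 2 = (arrs s' 2)(ie k := v)"
        "v = ie k \<and> matches u k = {} \<or> (\<exists>(k2, i, j) \<in> matches u k. v = arrs s' 2 (ie j))"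
        using fd by (auto simp: found_def)
      have j: "arrs s2 2 (ie j) = arrs s' 2 (ie j)" if "k' \<in> rg u" "(k2, i, j) \<in> matches u k'" for k2 i j k'
        using ie_match[OF u k that] v(1) by simp
      have "labk u k (arrs s2 2)"
        using v(2)
      proof
        assume "v = ie k \<and> matches u k = {}"
        then show ?thesis using v(1) by (simp add: labk_def)
      next
        assume "\<exists>(k2, i, j) \<in> matches u k. v = arrs s' 2 (ie j)"
        then obtain k2 i j' where mt: "(k2, i, j') \<in> matches u k" "v = arrs s' 2 (ie j')" by blast
        then have "arrs s2 2 (ie k) = arrs s2 2 (ie j')" using j[OF k mt(1)] v(1) by simp
        then show ?thesis using mt(1) unfolding labk_def by blast
      qed
      moreover have "labk u k' (arrs s2 2)" if "k' \<in> {st u..<k}" for k'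
      proof -
        have k': "k' \<in> rg u" "k' \<noteq> k" using that k by simp_all
        have "ie k' \<noteq> ie k" using inj_onD[OF ie_inj[OF u] _ k'(1) k] k'(2) by blast
        then have "arrs s2 2 (ie k') = arrs s' 2 (ie k')" using v(1) by simp
        moreover have "labk u k' (arrs s' 2)" using 5(3) that by (simp add: I_def)
        ultimately show ?thesis using labk_cong j[OF k'(1)] by metis
      qed
      ultimately show ?thesis using 5(3) v(1) k by (auto simp: I_def less_Suc_eq)
    qed
    have "runs label_k2 ?s1 (\<lambda>t s2. 1 + t \<le> Suc (15 * Suc dm ^ 3) \<and> vars s2 20 = k \<and>
        I (Suc k) (s2\<lparr>vars := (vars s2)(20 := Suc k)\<rparr>))"
    proof (rule runs_cons[OF runs_label_k2[OF e1 u k f1]], goal_cases)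
      case (1 t s2)
      then show ?case using post frame_vars[OF 1(2), of 20] e(2) by simp
    qed
    then show ?case using e by (simp add: env_def)
  qed
  then show ?thesis
  proof (rule runs_cons, goal_cases)
    case (1 t s')
    then have "t \<le> 2 + (\<Sum>i=st u..<en u. 3 + 15 * Suc dm ^ 3)"
      by (simp only: numeral_3_eq_3 add_2_eq_Suc add_Suc add_0)
    then have "t \<le> (3 + 15 + 2) * Suc dm ^ Suc 3" by (rule loop_rg[OF _ u(1)])
    then have "t \<le> 20 * Suc dm ^ 4" by (simp only: Suc_numeral semiring_norm)
    then show ?case using 1 by (simp add: I_def)
  qed
qed

text \<open>Level order keeps the rule stable: at a processed vertex it refers to edges whose top is
  this vertex or a strictly lower one, and neither is the vertex processed now.\<close>

lemma runs_label_edges: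
  assumes s: "env s" "vars s 0 = n" and Q: "\<And>h. h < n \<Longrightarrow> arrs s 9 h = ord ! h"
  shows "runs label_edges s (\<lambda>t s'. t \<le> 2 + n * (25 * Suc dm ^ 4) \<and> (\<forall>u<n. \<forall>k \<in> rg u. labk u k (arrs s' 2)))"
proof -
  define I where "I h s' \<longleftrightarrow> (\<forall>h'<h. \<forall>k \<in> rg (ord ! h'). labk (ord ! h') k (arrs s' 2))" for h and s' :: state
  have "runs label_edges s (\<lambda>t s'. t \<le> 2 + (\<Sum>h=0..<n. 2 + Suc (20 * Suc dm ^ 4)) \<and> I n s' \<and> vars s' 5 = n)"
    unfolding label_edges_def
  proof (rule runs_For[where I = I], goal_cases)
    case 3 show ?case by (simp add: I_def)
  next
    case (4 i s')
    then show ?case using frame_vars[OF 4(5), of 0] s by simp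
  next
    case (5 h s')
    let ?u = "ord ! h"
    have u: "?u < n" using nth_mem[of h ord] ord(2,3) 5(2) by simp
    let ?s1 = "s'\<lparr>vars := (vars s')(7 := ?u)\<rparr>"
    have e: "env s'" "arrs s' 9 h = ?u" using env_frame[OF 5(5)] frame_arrs[OF 5(5), of 9] s Q 5(2) by auto
    then have e1: "env ?s1" "vars ?s1 7 = ?u" by (simp_all add: env_def)
    have post: "I (Suc h) (s2\<lparr>vars := v\<rparr>)"
      if l: "\<forall>k \<in> rg ?u. labk ?u k (arrs s2 2)" and out: "\<forall>e. e \<notin> ie ` rg ?u \<longrightarrow> arrs s2 2 e = arrs s' 2 e" for s2 v
    proof -
      have "labk (ord ! h') k (arrs s2 2)" if h': "h' < h" and k: "k \<in> rg (ord ! h')" for h' k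
      proof -
        let ?x = "ord ! h'"
        have x: "?x < n" "?x \<noteq> ?u" "lev ?x \<le> lev ?u"
          using ord 5(2) h' nth_mem[of h' ord] nth_eq_iff_index_eq[of ord h' h] sorted_nth_mono[of "map lev ord" h' h] by auto
        have same: "arrs s2 2 (ie j) = arrs s' 2 (ie j)" if "w < n" "w \<noteq> ?u" "j \<in> rg w" for j w
          using ie_top[OF that(1) u that(3)] that(2) out by (metis imageE)
        have "arrs s2 2 (ie j) = arrs s' 2 (ie j)" if "(k2, i, j) \<in> matches ?x k" for k2 i j
        proof -
          have k2: "k2 \<in> rg ?x" "j \<in> rg (lo k2)" using that by (auto simp: matches_def)
          have "lev (lo k2) < lev ?x" using rg(4)[OF x(1) k2(1)] by (simp add: lower_def)
          then have "lo k2 \<noteq> ?u" using x(3) by auto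
          then show ?thesis using same lo_lt[OF x(1) k2(1)] k2(2) by blast
        qed
        moreover have "labk ?x k (arrs s' 2)" using 5(3) h' k by (simp add: I_def)
        ultimately show ?thesis using same[OF x(1,2) k] labk_cong by blast
      qed
      then show ?thesis using l by (auto simp: I_def less_Suc_eq)
    qed
    show ?case
      using e 5(4)
      by simp (rule runs_cons[OF runs_label_k[OF e1 u]], use post in \<open>auto dest: frame_vars[of _ _ _ 5]\<close>)
  qed simp_all
  then show ?thesis
  proof (rule runs_cons, goal_cases)
    case (1 t s')
    have "\<forall>u<n. \<forall>k \<in> rg u. labk u k (arrs s' 2)"
    proof (intro allI impI)
      fix u assume "u < n"
      then obtain h where "h < n" "u = ord ! h" using ord(2,3) by (metis in_set_conv_nth lessThan_iff)
      then show "\<forall>k \<in> rg u. labk u k (arrs s' 2)" using 1 by (simp add: I_def)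
    qed
    moreover have "t \<le> 2 + n * (25 * Suc dm ^ 4)"
    proof -
      have "1 \<le> Suc dm ^ 4" by simp
      then have "3 + 20 * Suc dm ^ 4 \<le> 25 * Suc dm ^ 4" by linarith
      then have "n * (3 + 20 * Suc dm ^ 4) \<le> n * (25 * Suc dm ^ 4)" by (rule mult_le_mono2)
      moreover have "(\<Sum>h=0..<n. 2 + Suc (20 * Suc dm ^ 4)) = n * (3 + 20 * Suc dm ^ 4)"
        by (simp add: distrib_left)
      ultimately show ?thesis using 1 by linarith
    qed
    ultimately show ?case by blast
  qed
qed

section \<open>From the local rule to the classes\<close>

lemma edge_ie:
  assumes "e < m" obtains u k where "u < n" "k \<in> rg u" "e = ie k"
proof -
  obtain w u where wu: "lower w u" "edge e = {w, u}"
    using lower_cases[OF edge_adj[OF assms]] by (metis insert_commute)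
  then have u: "u < n" using lower_lt by blast
  then obtain k where k: "k \<in> rg u" "lo k = w" using rg(7) wu by blast
  then have "e = ie k" using edge_inj[OF assms rg(5)[OF u k(1)]] rg(6)[OF u k(1)] wu by simp
  then show thesis using that u k by blast
qed

text \<open>A label travels only through squares, so by induction on levels it is the index of an
  edge of the same class, and equal labels imply equal classes. The converse is
  \<open>label_Theta\<close>: by \<open>lower_quadrangle\<close>, an edge without a match is the
  only one below its top.\<close>

lemma labk_class_naming:
  assumes lab: "\<And>u k. u < n \<Longrightarrow> k \<in> rg u \<Longrightarrow> labk u k lab"
  shows "class_naming G es lab"
proof -
  have sound: "lab (ie k) < m \<and> cls (edge (lab (ie k))) = cls (edge (ie k))" if "u < n" "k \<in> rg u" for u k
    using that
  proof (induction "lev u" arbitrary: u k rule: less_induct)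
    case less
    show ?case using lab[OF less.prems] unfolding labk_def
    proof
      assume "matches u k = {} \<and> lab (ie k) = ie k"
      then show ?case using rg(5) less.prems by auto
    next
      assume "\<exists>(k2, i, j) \<in> matches u k. lab (ie k) = lab (ie j)"
      then obtain k2 i j where mt: "(k2, i, j) \<in> matches u k" "lab (ie k) = lab (ie j)" by blast
      then have *: "k2 \<in> rg u" "k2 \<noteq> k" "i \<in> rg (lo k)" "j \<in> rg (lo k2)" "lo i = lo j"
        by (auto simp: matches_def)
      note r = rg(4)[OF less.prems] rg(4)[OF less.prems(1) *(1)] rg(4)[OF lo_lt[OF less.prems] *(3)]
        rg(4)[OF lo_lt[OF less.prems(1) *(1)] *(4)]
      have ne: "lo k \<noteq> lo k2" using inj_onD[OF rg(3)[OF less.prems(1)]] * less.prems(2) by metis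
      have "cls {lo k, u} = cls {lo j, lo k2}"
        using lower_square(2)[OF r(1,2) ne _ r(4)] r(3) *(5) by simp
      moreover have "lab (ie j) < m \<and> cls (edge (lab (ie j))) = cls (edge (ie j))"
        using less.hyps[OF _ lo_lt[OF less.prems(1) *(1)] *(4)] r(2) by (simp add: lower_def)
      ultimately show ?case
        using rg(6)[OF less.prems] rg(6)[OF lo_lt[OF less.prems(1) *(1)] *(4)] mt(2) by simp
    qed
  qed
  have sound': "cls (edge (lab e)) = cls (edge e)" if e: "e < m" for e
  proof -
    obtain u k where "u < n" "k \<in> rg u" "e = ie k" using edge_ie[OF e] by blast
    then show ?thesis using sound by simp
  qed
  \<comment> \<open>Labels are attached to indices whereas \<open>label_Theta\<close> speaks of
    edges; the listing is injective, so the index can be recovered.\<close>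
  define f where "f E = lab (THE e. e < m \<and> edge e = E)" for E
  have f: "f (edge e) = lab e" if "e < m" for e
  proof -
    have "(THE e'. e' < m \<and> edge e' = edge e) = e" using that edge_inj by (intro the_equality) auto
    then show ?thesis by (simp add: f_def)
  qed
  have f_ie: "f {lo k, u} = lab (ie k)" if "u < n" "k \<in> rg u" for u k
    using f[OF rg(5)[OF that]] rg(6)[OF that] by simp
  have rule: "(\<forall>r. lower r t \<longrightarrow> r = w) \<or>
      (\<exists>r b. lower r t \<and> r \<noteq> w \<and> lower b w \<and> lower b r \<and> f {w, t} = f {b, r})" if wt: "lower w t" for t w
  proof -
    have t: "t < n" using lower_lt wt by blast
    obtain k where k: "k \<in> rg t" "lo k = w" using rg(7)[OF t wt] by blast
    have wn: "w < n" using lower_lt wt by blast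
    show ?thesis using lab[OF t k(1)] unfolding labk_def
    proof
      assume no: "matches t k = {} \<and> lab (ie k) = ie k"
      have "r = w" if r: "lower r t" for r
      proof (rule ccontr)
        assume ne: "r \<noteq> w"
        obtain k2 where k2: "k2 \<in> rg t" "lo k2 = r" using rg(7)[OF t r] by blast
        obtain b where b: "lower b w" "lower b r" using lower_quadrangle[OF wt r] ne by blast
        obtain i where i: "i \<in> rg w" "lo i = b" using rg(7)[OF wn b(1)] by blast
        obtain j where j: "j \<in> rg r" "lo j = b" using rg(7)[OF _ b(2)] lower_lt r by blast
        have "(k2, i, j) \<in> matches t k" using k k2 i j ne by (auto simp: matches_def)
        then show False using no by blast
      qed
      then show ?thesis by blast
    next
      assume "\<exists>(k2, i, j) \<in> matches t k. lab (ie k) = lab (ie j)"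
      then obtain k2 i j where mt: "(k2, i, j) \<in> matches t k" "lab (ie k) = lab (ie j)" by blast
      then have *: "k2 \<in> rg t" "k2 \<noteq> k" "i \<in> rg (lo k)" "j \<in> rg (lo k2)" "lo i = lo j"
        by (auto simp: matches_def)
      have "lo k2 \<noteq> w" using inj_onD[OF rg(3)[OF t]] * k by metis
      moreover have "lower (lo k2) t" using rg(4)[OF t *(1)] .
      moreover have "lower (lo j) w" using rg(4)[of w i] wn * k by simp
      moreover have "lower (lo j) (lo k2)" using rg(4)[OF lo_lt[OF t *(1)] *(4)] .
      moreover have "f {w, t} = f {lo j, lo k2}"
        using f_ie[OF t k(1)] f_ie[OF lo_lt[OF t *(1)] *(4)] mt(2) k by simp
      ultimately show ?thesis by blast
    qed
  qed
  show ?thesis unfolding class_naming_def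
  proof (intro allI impI iffI)
    fix i j assume ij: "i < m" "j < m"
    {
      assume "lab i = lab j"
      moreover have "cls (edge (lab i)) = cls (edge i)" "cls (edge (lab j)) = cls (edge j)"
        using sound' ij by blast+
      ultimately have "cls (edge i) = cls (edge j)" by simp
      then show "(edge i, edge j) \<in> (Theta0 G)\<^sup>*" using cls_eq_iff by blast
    next
      assume "(edge i, edge j) \<in> (Theta0 G)\<^sup>*"
      with rule have "f (edge i) = f (edge j)" by (rule label_Theta)
      then show "lab i = lab j" using f ij by simp
    }
  qed
qed

end

section \<open>Enumerating the cubes\<close>

text \<open>
  A cube is stored as a pair of its top vertex and a set of classes incoming into the top. It arises
  from its parent by adding one class. The pairs \<open>(L, u)\<close> of the output are the cubes with top \<open>u\<close>,
  and the POFs outgoing from \<open>u\<close> are the cubes with bottom \<open>u\<close>.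
\<close>

definition new_cube :: "nat \<Rightarrow> exp \<Rightarrow> exp \<Rightarrow> exp \<Rightarrow> com" where
  "new_cube x p l z = inc 11 ;; Store 14 (Var 11) (Var 7) ;; Store 15 (Var 11) (Var x) ;; Store 16 (Var 11) p ;;
     Store 17 (Var 11) l ;; Store 18 (Var 11) z ;; Store 20 (Var 11) (Arr 19 (Var x)) ;; Store 19 (Var x) (Var 11)"

definition find_down :: com where
  "find_down = For 23 (Arr 10 (Var 16)) (Arr 11 (Var 16))
     (If (Bin Equal (Arr 2 (Arr 13 (Var 23))) (Var 13)) (Assign 22 (Arr 12 (Var 23))) Skip)"

definition extend_cube :: com where
  "extend_cube = Assign 16 (Arr 15 (Var 15)) ;; find_down ;;
     new_cube 22 (Var 15) (Var 13) (Bin Plus (Arr 18 (Var 15)) (Num 1))"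

definition extend_cubes :: com where
  "extend_cubes = For 15 (Var 12) (Var 14) extend_cube"

text \<open>Variable 14 freezes the end of the list before a class is added:
  \<open>extend_cubes\<close> creates new cubes meanwhile, and only the old ones are to be extended
  by this class.\<close>

definition cubes_below :: com where
  "cubes_below = For 20 (Arr 10 (Var 7)) (Arr 11 (Var 7)) (Assign 13 (Arr 2 (Arr 13 (Var 20))) ;;
     Assign 14 (Bin Plus (Var 11) (Num 1)) ;; extend_cubes)"

definition cubes :: com where
  "cubes = For 7 (Num 0) (Var 0) (new_cube 7 (Num 0) (Num 0) (Num 0) ;; Assign 12 (Var 11) ;; cubes_below)"

lemma wvars_cubes [simp]:
  "wvars (new_cube x p l z) = {11}" "wvars find_down = {22, 23}" "wvars extend_cube = {11, 16, 22, 23}"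
  "wvars extend_cubes = {11, 15, 16, 22, 23}" "wvars cubes_below = {11, 13, 14, 15, 16, 20, 22, 23}"
  "wvars cubes = {7, 11, 12, 13, 14, 15, 16, 20, 22, 23}"
  by (auto simp: new_cube_def find_down_def extend_cube_def extend_cubes_def cubes_below_def cubes_def)

lemma warrs_cubes [simp]:
  "warrs (new_cube x p l z) = {14, 15, 16, 17, 18, 19, 20}" "warrs find_down = {}"
  "warrs extend_cube = {14, 15, 16, 17, 18, 19, 20}" "warrs extend_cubes = {14, 15, 16, 17, 18, 19, 20}"
  "warrs cubes_below = {14, 15, 16, 17, 18, 19, 20}" "warrs cubes = {14, 15, 16, 17, 18, 19, 20}"
  by (auto simp: new_cube_def find_down_def extend_cube_def extend_cubes_def cubes_below_def cubes_def)

section \<open>Subsets in the order of enumeration\<close>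

text \<open>Each new class appends copies of all previous sublists, extended at the front. So the
  parent of a cube is the tail of its list.\<close>

definition subs :: "nat list \<Rightarrow> nat list list" where
  "subs = foldl (\<lambda>cs l. cs @ map (Cons l) cs) [[]]"

lemma subs_simps [simp]: "subs [] = [[]]" "subs (ls @ [l]) = subs ls @ map (Cons l) (subs ls)"
  by (simp_all add: subs_def)

lemma length_subs: "length (subs ls) = 2 ^ length ls"
  by (induction ls rule: rev_induct) auto

lemma subs_set: "S \<in> set (subs ls) \<Longrightarrow> set S \<subseteq> set ls"
  by (induction ls arbitrary: S rule: rev_induct) fastforce+

lemma subs_distinct: "distinct ls \<Longrightarrow> S \<in> set (subs ls) \<Longrightarrow> distinct S"
proof (induction ls arbitrary: S rule: rev_induct)
  case (snoc l ls)
  then show ?case by (auto dest: subsetD[OF subs_set])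
qed simp

lemma subs_Pow: "set (map set (subs ls)) = Pow (set ls)"
proof (induction ls rule: rev_induct)
  case (snoc l ls)
  have "set (map set (subs (ls @ [l]))) = Pow (set ls) \<union> insert l ` Pow (set ls)"
    unfolding snoc[symmetric] by (simp add: image_image image_Un)
  then show ?case by (simp add: Pow_insert)
qed simp

lemma distinct_subs: "distinct ls \<Longrightarrow> distinct (map set (subs ls))"
proof (induction ls rule: rev_induct)
  case (snoc l ls)
  have l: "l \<notin> set ls" and d: "distinct (map set (subs ls))" using snoc by auto
  have "inj_on (insert l) (set (map set (subs ls)))"
    unfolding subs_Pow using l by (intro inj_onI) (metis PowD insert_ident subset_iff)
  then have "distinct (map (insert l) (map set (subs ls)))"
    unfolding distinct_map[of "insert l"] using d by blast
  moreover have "set (map set (subs ls)) \<inter> set (map (insert l) (map set (subs ls))) = {}"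
    unfolding set_map[of "insert l"] subs_Pow using l by auto
  moreover have "map set (subs (ls @ [l])) = map set (subs ls) @ map (insert l) (map set (subs ls))"
    by simp
  ultimately show ?case using d by (simp only: distinct_append simp_thms)
qed simp

locale labelled = in_listing +
  fixes lab :: "nat \<Rightarrow> nat"
  assumes naming: "class_naming G es lab"
begin

section \<open>Class labels and bottoms of cubes\<close>

definition ilab :: "nat \<Rightarrow> nat list" where
  "ilab u = map (\<lambda>k. lab (ie k)) [st u..<en u]"

abbreviation cl :: "nat \<Rightarrow> nat set set" where
  "cl \<equiv> named_class es lab"

lemma cl_lab:
  assumes "e < m" shows "cl (lab e) = cls (edge e)"
proof -
  have eq: "lab i = lab e \<longleftrightarrow> (edge e, edge i) \<in> (Theta0 G)\<^sup>*" if "i < m" for i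
    using naming assms that unfolding class_naming_def by metis
  show ?thesis
  proof (intro set_eqI iffI)
    fix E assume "E \<in> cl (lab e)"
    then obtain i where "i < m" "lab i = lab e" "E = edge i" by (auto simp: named_class_def)
    then show "E \<in> cls (edge e)" using eq by simp
  next
    fix E assume E: "E \<in> cls (edge e)"
    have "edge e \<in> uedges G" using edge_adj[OF assms] unfolding uedges_def by blast
    then have "E \<in> uedges G" using E Theta_uedges[of "edge e" E] by simp
    then obtain u v where "E = {u, v}" "u \<sim> v" by (auto simp: uedges_def)
    then obtain i where "i < m" "edge i = E" using edge_exists by metis
    then show "E \<in> cl (lab e)" using eq E by (auto simp: named_class_def)
  qed
qed

text \<open>Injectivity is restricted to the labels that occur, since every other number names the
  empty set.\<close>

lemma cl_inj: "inj_on cl (lab ` {..<m})"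
proof (rule inj_onI, clarsimp)
  fix e e' assume *: "e < m" "e' < m" "cl (lab e) = cl (lab e')"
  then have "cls (edge e) = cls (edge e')" using cl_lab by simp
  then have "(edge e, edge e') \<in> (Theta0 G)\<^sup>*" unfolding cls_eq_iff .
  then show "lab e = lab e'" using naming * unfolding class_naming_def by metis
qed

lemma cl_ie: "u < n \<Longrightarrow> k \<in> rg u \<Longrightarrow> cl (lab (ie k)) = cls {lo k, u}"
  using cl_lab[OF rg(5)] rg(6) by simp

lemma ilab_sub: "u < n \<Longrightarrow> set (ilab u) \<subseteq> lab ` {..<m}"
  using rg(5) by (auto simp: ilab_def)

lemma cl_ilab: "u < n \<Longrightarrow> cl ` set (ilab u) = In u"
proof (intro set_eqI iffI)
  fix E assume u: "u < n"
  {
    assume "E \<in> cl ` set (ilab u)"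
    then obtain k where "k \<in> rg u" "E = cl (lab (ie k))" by (auto simp: ilab_def)
    then show "E \<in> In u" using cl_ie[OF u] rg(4)[OF u] by (auto simp: In_def)
  next
    assume "E \<in> In u"
    then obtain w where w: "lower w u" "E = cls {w, u}" by (auto simp: In_def)
    then obtain k where "k \<in> rg u" "lo k = w" using rg(7)[OF u] by blast
    then have "k \<in> rg u" "E = cl (lab (ie k))" using cl_ie[OF u] w by simp_all
    then show "E \<in> cl ` set (ilab u)" by (simp add: ilab_def image_image)
  }
qed

lemma distinct_ilab:
  assumes u: "u < n" shows "distinct (ilab u)"
proof -
  have "inj_on (\<lambda>k. lab (ie k)) (rg u)"
  proof (rule inj_onI)
    fix k j assume *: "k \<in> rg u" "j \<in> rg u" "lab (ie k) = lab (ie j)"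
    then have "cls {lo k, u} = cls {lo j, u}" using cl_ie[OF u] by metis
    then have "lo k = lo j" using lower_inj rg(4)[OF u] * by blast
    then show "k = j" using inj_onD[OF rg(3)[OF u]] * by blast
  qed
  then show ?thesis by (simp add: ilab_def distinct_map)
qed

lemma length_ilab: "u < n \<Longrightarrow> length (ilab u) \<le> dm"
  using rg(2) by (simp add: ilab_def)

text \<open>\<open>bt u S\<close> is the bottom of the cube with top \<open>u\<close> and class labels \<open>S\<close>.\<close>

definition bt :: "nat \<Rightarrow> nat list \<Rightarrow> nat" where
  "bt u S = (THE w. w \<in> V \<and> X w = X u - cl ` set S)"

lemma bt_eqI: "w \<in> V \<Longrightarrow> X w = X u - cl ` set S \<Longrightarrow> bt u S = w"
  unfolding bt_def using X_inj by (intro the_equality) auto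

lemma bt:
  assumes "u < n" "set S \<subseteq> set (ilab u)"
  shows "bt u S \<in> V" "X (bt u S) = X u - cl ` set S" "bt u S < n"
proof -
  have "cl ` set S \<subseteq> In u" using cl_ilab assms by blast
  then obtain w where w: "w \<in> V" "X w = X u - cl ` set S"
    using down[of "cl ` set S" u] assms verts by auto
  then show "bt u S \<in> V" "X (bt u S) = X u - cl ` set S" "bt u S < n" using bt_eqI verts by auto
qed

lemma bt_Nil: "u < n \<Longrightarrow> bt u [] = u"
  using verts by (intro bt_eqI) auto

text \<open>Adding \<open>l\<close> moves the bottom one step down across the class of
  \<open>l\<close>. The two parts say that scanning the block of the old bottom for \<open>l\<close>
  succeeds and that every hit leads to the new bottom.\<close>

lemma bt_Cons:
  assumes u: "u < n" and S: "set (l # S) \<subseteq> set (ilab u)" "l \<notin> set S"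
  shows "\<exists>k \<in> rg (bt u S). lab (ie k) = l"
    and "k \<in> rg (bt u S) \<Longrightarrow> lab (ie k) = l \<Longrightarrow> lo k = bt u (l # S)"
proof -
  let ?x = "bt u S" and ?w = "bt u (l # S)"
  have S': "set S \<subseteq> set (ilab u)" using S by simp
  note x = bt[OF u S'] and w = bt[OF u S(1)]
  have lm: "l \<in> lab ` {..<m}" "set S \<subseteq> lab ` {..<m}" using ilab_sub[OF u] S by auto
  have ln: "cl l \<notin> cl ` set S" using inj_on_image_mem_iff[OF cl_inj lm] S(2) by simp
  have lX: "cl l \<in> X u" using cl_ilab[OF u] In_sub S(1) by fastforce
  have wx: "X ?w = X ?x - {cl l}" using w(2) x(2) by auto
  have lx: "cl l \<in> X ?x" using ln lX x(2) by simp
  have low: "lower ?w ?x" by (rule lower_if_X[OF x(1) w(1) wx lx])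
  have cw: "cls {?w, ?x} = cl l"
    using X_lower[OF low] wx lx by blast
  obtain k where k: "k \<in> rg ?x" "lo k = ?w" using rg(7)[OF x(3) low] by blast
  have lab_iff: "lab (ie j) = l \<longleftrightarrow> cl (lab (ie j)) = cl l" if "j \<in> rg ?x" for j
    using inj_on_eq_iff[OF cl_inj _ lm(1)] rg(5)[OF x(3) that] by blast
  show "\<exists>k \<in> rg ?x. lab (ie k) = l"
    using lab_iff[OF k(1)] cl_ie[OF x(3) k(1)] cw k by auto
  show "lo k = ?w" if "k \<in> rg ?x" "lab (ie k) = l" for k
  proof -
    have "cls {lo k, ?x} = cls {?w, ?x}" using cl_ie[OF x(3) that(1)] that(2) cw by simp
    then show ?thesis using lower_inj[OF rg(4)[OF x(3) that(1)] low] by blast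
  qed
qed

text \<open>Cubes are numbered from 1 and pushed at the front of their list, whence
  \<open>c - 1\<close> and \<open>rev\<close>.\<close>

definition bl :: "(nat \<times> nat list) list \<Rightarrow> nat \<Rightarrow> nat list" where
  "bl cs w = rev (filter (\<lambda>c. case_prod bt (cs ! (c - 1)) = w) [1..<Suc (length cs)])"

lemma bl_snoc: "bl (cs @ [(u, S)]) = (bl cs)(bt u S := Suc (length cs) # bl cs (bt u S))"
proof
  fix w
  have "filter (\<lambda>c. case_prod bt ((cs @ [(u, S)]) ! (c - 1)) = w) [1..<Suc (length cs)] =
    filter (\<lambda>c. case_prod bt (cs ! (c - 1)) = w) [1..<Suc (length cs)]"
    by (rule filter_cong) (auto simp: nth_append)
  then show "bl (cs @ [(u, S)]) w = ((bl cs)(bt u S := Suc (length cs) # bl cs (bt u S))) w"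
    by (auto simp: bl_def)
qed

section \<open>Representation and creation of cubes\<close>

text \<open>A cell keeps only the class added last and a link to the parent \<open>tl S\<close>, so
  that a cube takes constant space and is created without copying its list.\<close>

definition cube_at :: "(nat \<times> nat list) list \<Rightarrow> state \<Rightarrow> nat \<Rightarrow> nat \<Rightarrow> nat list \<Rightarrow> bool" where
  "cube_at cs s c u S \<longleftrightarrow> arrs s 14 (Suc c) = u \<and> arrs s 15 (Suc c) = bt u S \<and> arrs s 18 (Suc c) = length S \<and>
     (S \<noteq> [] \<longrightarrow> arrs s 17 (Suc c) = hd S \<and> (\<exists>c'<c. arrs s 16 (Suc c) = Suc c' \<and> cs ! c' = (u, tl S)))"

definition cube_st :: "(nat \<times> nat list) list \<Rightarrow> state \<Rightarrow> bool" where
  "cube_st cs s \<longleftrightarrow> vars s 11 = length cs \<and> (\<forall>c<length cs. case_prod (cube_at cs s c) (cs ! c)) \<and>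
     lists (arrs s 19) (arrs s 20) id (length cs) (bl cs)"

lemma cube_st_cong:
  "cube_st cs s \<Longrightarrow> vars s' 11 = vars s 11 \<Longrightarrow> (\<And>a. a \<in> {14, 15, 16, 17, 18, 19, 20} \<Longrightarrow> arrs s' a = arrs s a) \<Longrightarrow> cube_st cs s'"
  unfolding cube_st_def cube_at_def by simp

lemma cube_st_vars: "x \<noteq> 11 \<Longrightarrow> cube_st cs s \<Longrightarrow> cube_st cs (s\<lparr>vars := (vars s)(x := v)\<rparr>)"
  by (erule cube_st_cong) auto

text \<open>\<open>vals\<close> quantifies over states because the arguments are evaluated after the
  counter has advanced and some arrays have been written; they may depend on the variables and on
  array 18.\<close>

lemma runs_new_cube:
  assumes cs: "cube_st cs s" and x: "x \<noteq> 11" "vars s x = bt u S" and u: "vars s 7 = u"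
    and vals: "\<And>s'. vars s' = (vars s)(11 := Suc (length cs)) \<Longrightarrow> arrs s' 18 = arrs s 18 \<Longrightarrow>
      exp_val p s' = pv \<and> exp_val l s' = lv \<and> exp_val z s' = length S"
    and S: "S \<noteq> [] \<Longrightarrow> lv = hd S \<and> (\<exists>c'<length cs. pv = Suc c' \<and> cs ! c' = (u, tl S))"
  shows "runs (new_cube x p l z) s (\<lambda>t s'. t = 8 \<and> cube_st (cs @ [(u, S)]) s')"
proof -
  let ?N = "length cs"
  have N: "vars s 11 = ?N" using cs by (simp add: cube_st_def)
  define s' where "s' = s\<lparr>arrs := (arrs s)(14 := (arrs s 14)(Suc ?N := u), 15 := (arrs s 15)(Suc ?N := bt u S),
    16 := (arrs s 16)(Suc ?N := pv), 17 := (arrs s 17)(Suc ?N := lv), 18 := (arrs s 18)(Suc ?N := length S),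
    20 := (arrs s 20)(Suc ?N := arrs s 19 (bt u S)), 19 := (arrs s 19)(bt u S := Suc ?N)), vars := (vars s)(11 := Suc ?N)\<rparr>"
  have run: "runs (new_cube x p l z) s (\<lambda>t s''. t = 8 \<and> s'' = s')"
    unfolding new_cube_def using N x u vals by (simp add: s'_def)
  have old: "cube_at (cs @ [(u, S)]) s' c a T" if "c < ?N" "cs ! c = (a, T)" for c a T
  proof -
    have at: "cube_at cs s c a T" using cs that by (auto simp: cube_st_def)
    have same: "arrs s' 14 (Suc c) = arrs s 14 (Suc c)" "arrs s' 15 (Suc c) = arrs s 15 (Suc c)"
      "arrs s' 16 (Suc c) = arrs s 16 (Suc c)" "arrs s' 17 (Suc c) = arrs s 17 (Suc c)"
      "arrs s' 18 (Suc c) = arrs s 18 (Suc c)" using that(1) by (simp_all add: s'_def)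
    have nth: "(cs @ [(u, S)]) ! c' = cs ! c'" if "c' < c" for c'
      using that \<open>c < ?N\<close> by (simp add: nth_append)
    show ?thesis using at nth unfolding cube_at_def same by metis
  qed
  have new: "cube_at (cs @ [(u, S)]) s' ?N u S"
    using S by (auto simp: cube_at_def s'_def nth_append)
  have "lists (arrs s' 19) (arrs s' 20) id (Suc ?N) (bl (cs @ [(u, S)]))"
    unfolding bl_snoc using lists_push[of "arrs s 19" "arrs s 20" id ?N "bl cs" id "Suc ?N" "bt u S"] cs
    by (simp add: s'_def cube_st_def)
  moreover have "case_prod (cube_at (cs @ [(u, S)]) s' c) ((cs @ [(u, S)]) ! c)" if "c < Suc ?N" for c
    using old[of c "fst (cs ! c)" "snd (cs ! c)"] new that by (cases "c = ?N") (auto simp: nth_append case_prod_beta)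
  moreover have "vars s' 11 = Suc ?N" by (simp add: s'_def)
  ultimately have "cube_st (cs @ [(u, S)]) s'" by (simp add: cube_st_def)
  then show ?thesis by (intro runs_cons[OF run]) simp
qed

definition envl :: "state \<Rightarrow> bool" where
  "envl s \<longleftrightarrow> env s \<and> arrs s 2 = lab"

lemma envl_frame: "frame c s s' \<Longrightarrow> {2, 10, 11, 12, 13} \<inter> warrs c = {} \<Longrightarrow> envl s \<Longrightarrow> envl s'"
  using env_frame[of c s s'] frame_arrs[of c s s' 2] by (auto simp: envl_def)

lemma runs_find_down:
  assumes s: "envl s" "vars s 16 = x" "vars s 13 = l" and x: "x < n"
    and k: "\<exists>k \<in> rg x. lab (ie k) = l" "\<And>k. k \<in> rg x \<Longrightarrow> lab (ie k) = l \<Longrightarrow> lo k = w"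
  shows "runs find_down s (\<lambda>t s'. t \<le> 6 * Suc dm \<and> vars s' 22 = w)"
proof -
  have "runs find_down s (\<lambda>t s'. t \<le> 2 + (\<Sum>i=st x..<en x. 2 + 2) \<and>
    ((\<exists>k \<in> {st x..<en x}. lab (ie k) = l) \<longrightarrow> vars s' 22 = w) \<and> vars s' 23 = en x)"
    unfolding find_down_def
  proof (rule runs_For[where I = "\<lambda>i s'. (\<exists>k \<in> {st x..<i}. lab (ie k) = l) \<longrightarrow> vars s' 22 = w"], goal_cases)
    case 1 show ?case using s by (simp add: envl_def env_def)
  next
    case 2 show ?case using rg(1)[OF x] .
  next
    case (4 i s')
    then have "envl s'" "vars s' 16 = x" using envl_frame[OF 4(5)] frame_vars[OF 4(5), of 16] s by auto
    then show ?case by (simp add: envl_def env_def)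
  next
    case (5 i s')
    then have e: "envl s'" "vars s' 13 = l" "vars s' 23 = i"
      using envl_frame[OF 5(5)] frame_vars[OF 5(5), of 13] s by auto
    have i: "i \<in> rg x" using 5(1,2) by simp
    have set: "{st x..<Suc i} = insert i {st x..<i}" using 5(1) by auto
    show ?case
      using e 5(3) k(2)[OF i] unfolding set by (simp add: envl_def env_def)
  qed simp
  then show ?thesis
    by (rule runs_cons) (use sum_ran_le[OF x, of 4] k(1) in auto)
qed

lemma runs_extend_cube:
  assumes s: "envl s" "cube_st cs s" "vars s 15 = Suc c" "vars s 7 = u" "vars s 13 = l"
    and c: "c < length cs" "cs ! c = (u, S)" and u: "u < n" "set (l # S) \<subseteq> set (ilab u)" "l \<notin> set S"
  shows "runs extend_cube s (\<lambda>t s'. t \<le> 15 * Suc dm \<and> cube_st (cs @ [(u, l # S)]) s')"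
proof -
  have at: "arrs s 15 (Suc c) = bt u S" "arrs s 18 (Suc c) = length S"
    using s(2) c unfolding cube_st_def cube_at_def by force+
  have S': "set S \<subseteq> set (ilab u)" using u by simp
  let ?s1 = "s\<lparr>vars := (vars s)(16 := bt u S)\<rparr>"
  have s1: "envl ?s1" "vars ?s1 16 = bt u S" "vars ?s1 13 = l" using s by (auto simp: envl_def env_def)
  have "runs find_down ?s1 (\<lambda>t1 s2. runs (new_cube 22 (Var 15) (Var 13) (Bin Plus (Arr 18 (Var 15)) (Num 1))) s2
    (\<lambda>t2 s3. 1 + (t1 + t2) \<le> 15 * Suc dm \<and> cube_st (cs @ [(u, l # S)]) s3))"
  proof (rule runs_cons[OF runs_find_down[OF s1 bt(3)[OF u(1) S'] bt_Cons[OF u]]], goal_cases)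
    case (3 t1 s2)
    have v: "vars s2 7 = u" "vars s2 13 = l" "vars s2 15 = Suc c" "arrs s2 18 = arrs s 18"
      using frame_vars[OF 3(2)] frame_arrs[OF 3(2)] s by auto
    have cs2: "cube_st cs s2"
      by (rule cube_st_cong[OF s(2)]) (use frame_vars[OF 3(2), of 11] frame_arrs[OF 3(2)] in auto)
    show ?case
      by (rule runs_cons[OF runs_new_cube[OF cs2 _ _ v(1), of 22 "l # S" _ "Suc c" _ l]])
        (use 3 v at c in auto)
  qed auto
  then show ?thesis using s at by (simp add: extend_cube_def)
qed

lemma runs_extend_cubes:
  assumes s: "envl s" "cube_st (cs0 @ map (Pair u) (subs ls)) s" "vars s 12 = Suc (length cs0)"
      "vars s 14 = Suc (length cs0 + length (subs ls))" "vars s 7 = u" "vars s 13 = l"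
    and u: "u < n" "set (ls @ [l]) \<subseteq> set (ilab u)" "l \<notin> set ls"
  shows "runs extend_cubes s (\<lambda>t s'. t \<le> 20 * (Suc dm * length (subs ls)) \<and>
    cube_st (cs0 @ map (Pair u) (subs (ls @ [l]))) s')"
proof -
  let ?z = "Suc (length cs0 + length (subs ls))"
  \<comment> \<open>The cubes of \<open>u\<close> start at cell \<open>Suc (length cs0)\<close>; all
    those before cell \<open>i\<close> have been extended by \<open>l\<close>.\<close>
  define I where "I i s' \<longleftrightarrow> cube_st (cs0 @ map (Pair u) (subs ls @ map (Cons l) (take (i - Suc (length cs0)) (subs ls)))) s'" for i s'
  have "runs extend_cubes s (\<lambda>t s'. t \<le> 2 + (\<Sum>i=Suc (length cs0)..<?z. 2 + 15 * Suc dm) \<and> I ?z s' \<and> vars s' 15 = ?z)"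
    unfolding extend_cubes_def
  proof (rule runs_For[where I = I], goal_cases)
    case 1 show ?case using s by simp
  next
    case 2 show ?case by simp
  next
    case 3 show ?case using cube_st_vars[OF _ s(2)] by (simp add: I_def)
  next
    case (4 i s')
    then show ?case using frame_vars[OF 4(5), of 14] s by simp
  next
    case (5 i s')
    let ?j = "i - Suc (length cs0)"
    let ?S = "subs ls ! ?j"
    let ?cs = "cs0 @ map (Pair u) (subs ls @ map (Cons l) (take ?j (subs ls)))"
    have e: "envl s'" "vars s' 7 = u" "vars s' 13 = l" "vars s' 15 = Suc (length cs0 + ?j)"
      using envl_frame[OF 5(5)] frame_vars[OF 5(5)] s 5 by auto
    have j: "?j < length (subs ls)" using 5(1,2) by simp
    have sub: "set ?S \<subseteq> set ls" using subs_set nth_mem[OF j] by blast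
    have nth: "length cs0 + ?j < length ?cs" "?cs ! (length cs0 + ?j) = (u, ?S)"
      using j by (auto simp: nth_append)
    have t: "?cs @ [(u, l # ?S)] = cs0 @ map (Pair u) (subs ls @ map (Cons l) (take (Suc i - Suc (length cs0)) (subs ls)))"
    proof -
      have "Suc i - Suc (length cs0) = Suc ?j" using 5(1) by simp
      then show ?thesis using take_Suc_conv_app_nth[OF j] by simp
    qed
    have S: "set (l # ?S) \<subseteq> set (ilab u)" "l \<notin> set ?S" using sub u by auto
    show ?case
    proof (rule runs_cons[OF runs_extend_cube[OF e(1) 5(3)[unfolded I_def] e(4) e(2,3) nth u(1) S]], goal_cases)
      case (1 t' s2)
      then show ?case using frame_vars[OF 1(2), of 15] 5(4) cube_st_vars unfolding I_def t by simp
    qed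
  qed
  then show ?thesis
  proof (rule runs_cons, goal_cases)
    case (1 t s')
    have "1 \<le> length (subs ls)" by (simp add: length_subs)
    then have "2 + length (subs ls) * (2 + 15 * Suc dm) \<le> 20 * (Suc dm * length (subs ls))"
      by (simp add: algebra_simps)
    then show ?case using 1 by (simp add: I_def)
  qed
qed

text \<open>At most \<open>dm\<close> rounds, each extending at most \<open>2 ^ dm\<close> cubes by
  a scan of one block. This crude product is enough, because
  \<open>2 ^ dm \<le> 4 ^ dm\<close>.\<close>

lemma runs_cubes_below:
  assumes s: "envl s" "cube_st (cs0 @ [(u, [])]) s" "vars s 12 = Suc (length cs0)" "vars s 7 = u" and u: "u < n"
  shows "runs cubes_below s (\<lambda>t s'. t \<le> 30 * (Suc dm ^ 2 * 2 ^ dm) \<and>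
    cube_st (cs0 @ map (Pair u) (subs (ilab u))) s')"
proof -
  define f where "f k = lab (ie k)" for k
  define I where "I i s' \<longleftrightarrow> cube_st (cs0 @ map (Pair u) (subs (map f [st u..<i]))) s'" for i s'
  have il: "ilab u = map f [st u..<en u]" by (simp add: ilab_def f_def)
  have "runs cubes_below s (\<lambda>t s'. t \<le> 2 + (\<Sum>i=st u..<en u. 2 + (2 + 20 * (Suc dm * 2 ^ dm))) \<and> I (en u) s' \<and> vars s' 20 = en u)"
    unfolding cubes_below_def
  proof (rule runs_For[where I = I], goal_cases)
    case 1 show ?case using s by (simp add: envl_def env_def)
  next
    case 2 show ?case using rg(1)[OF u] .
  next
    case 3 show ?case using cube_st_vars[OF _ s(2)] by (simp add: I_def)
  next
    case (4 i s')
    then have "envl s'" "vars s' 7 = u" using envl_frame[OF 4(5)] frame_vars[OF 4(5), of 7] s by auto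
    then show ?case by (simp add: envl_def env_def)
  next
    case (5 i s')
    let ?ls = "map f [st u..<i]"
    let ?s1 = "s'\<lparr>vars := (vars s')(13 := f i, 14 := Suc (length cs0 + length (subs ?ls)))\<rparr>"
    have e: "envl s'" "vars s' 7 = u" "vars s' 12 = Suc (length cs0)" "vars s' 20 = i"
      using envl_frame[OF 5(5)] frame_vars[OF 5(5)] s 5 by auto
    have cs: "cube_st (cs0 @ map (Pair u) (subs ?ls)) s'" using 5(3) by (simp add: I_def)
    have N: "vars s' 11 = length cs0 + length (subs ?ls)" using cs by (simp add: cube_st_def)
    have app: "?ls @ [f i] = map f [st u..<Suc i]" using 5(1) by simp
    have "[st u..<en u] = [st u..<Suc i] @ [Suc i..<en u]" using 5(1,2) upt_add_eq_append[of "st u" "Suc i" "en u - Suc i"] by simp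
    then have il': "ilab u = ?ls @ f i # map f [Suc i..<en u]" unfolding il using 5(1) by simp
    then have ls: "set (?ls @ [f i]) \<subseteq> set (ilab u)" "f i \<notin> set ?ls" using distinct_ilab[OF u] by auto
    have "length ?ls \<le> dm" using length_ilab[OF u] il' by simp
    then have len: "length (subs ?ls) \<le> 2 ^ dm" unfolding length_subs by (simp add: power_increasing)
    have e1: "envl ?s1" "cube_st (cs0 @ map (Pair u) (subs ?ls)) ?s1" "vars ?s1 12 = Suc (length cs0)"
      "vars ?s1 14 = Suc (length cs0 + length (subs ?ls))" "vars ?s1 7 = u" "vars ?s1 13 = f i"
      using e cube_st_cong[OF cs, of ?s1] by (simp_all add: envl_def env_def)
    have "runs extend_cubes ?s1 (\<lambda>t s2. 2 + t \<le> 2 + 20 * (Suc dm * 2 ^ dm) \<and> vars s2 20 = i \<and>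
        I (Suc i) (s2\<lparr>vars := (vars s2)(20 := Suc i)\<rparr>))"
    proof (rule runs_cons[OF runs_extend_cubes[OF e1 u ls]], goal_cases)
      case (1 t s2)
      have "Suc dm * length (subs ?ls) \<le> Suc dm * 2 ^ dm" using len by (rule mult_le_mono2)
      then show ?case using 1 frame_vars[OF 1(2), of 20] e(4) cube_st_vars[of 20] unfolding I_def app by simp
    qed
    then show ?case using e N by (simp add: cubes_below_def envl_def env_def f_def)
  qed
  then show ?thesis
  proof (rule runs_cons, goal_cases)
    case (1 t s')
    define Y :: nat where "Y = Suc dm * 2 ^ dm"
    have "0 < Y" by (simp add: Y_def)
    then have Y: "1 \<le> Y" by simp
    have "t \<le> 2 + dm * (2 + (2 + 20 * Y))"
      using 1 sum_ran_le[OF u, of "2 + (2 + 20 * Y)"] unfolding Y_def by (meson add_left_mono le_trans)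
    also have "\<dots> = 2 + dm * (4 + 20 * Y)" by (simp add: distrib_left)
    also have "\<dots> \<le> 2 * Y + dm * (24 * Y)" using Y by (intro add_mono mult_le_mono2) simp_all
    also have "\<dots> \<le> 30 * (Suc dm * Y)" by (simp add: algebra_simps)
    also have "Suc dm * Y = Suc dm ^ 2 * 2 ^ dm" by (simp only: Y_def power2_eq_square mult.assoc)
    finally show ?case using 1 by (simp only: I_def il)
  qed
qed

definition CL :: "nat \<Rightarrow> (nat \<times> nat list) list" where
  "CL i = concat (map (\<lambda>u. map (Pair u) (subs (ilab u))) [0..<i])"

lemma runs_cubes:
  assumes s: "envl s" "vars s 0 = n" "vars s 11 = 0" "arrs s 19 = (\<lambda>_. 0)"
  shows "runs cubes s (\<lambda>t s'. t \<le> 2 + n * (50 * (Suc dm ^ 2 * 2 ^ dm)) \<and> cube_st (CL n) s')"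
proof -
  have "runs cubes s (\<lambda>t s'. t \<le> 2 + (\<Sum>i=0..<n. 2 + (9 + 30 * (Suc dm ^ 2 * 2 ^ dm))) \<and> cube_st (CL n) s' \<and> vars s' 7 = n)"
    unfolding cubes_def
  proof (rule runs_For[where I = "\<lambda>i s'. cube_st (CL i) s'"], goal_cases)
    case 3
    have "lists (\<lambda>_. 0) nx id 0 (bl [])" for nx
      unfolding lists_def by (intro allI exI[of _ "[]"]) (simp add: bl_def)
    then show ?case using s by (simp add: cube_st_def CL_def)
  next
    case (4 i s')
    then show ?case using frame_vars[OF 4(5), of 0] s by simp
  next
    case (5 u s')
    have e: "envl s'" "vars s' 7 = u" using envl_frame[OF 5(5)] s 5 by auto
    have "runs (new_cube 7 (Num 0) (Num 0) (Num 0)) s' (\<lambda>t1 s1. runs cubes_below (s1\<lparr>vars := (vars s1)(12 := vars s1 11)\<rparr>)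
      (\<lambda>t2 s2. t1 + (1 + t2) \<le> 9 + 30 * (Suc dm ^ 2 * 2 ^ dm) \<and> vars s2 7 = u \<and> cube_st (CL (Suc u)) (s2\<lparr>vars := (vars s2)(7 := Suc u)\<rparr>)))"
    proof (rule runs_cons[OF runs_new_cube[OF 5(3), of 7 u "[]" _ 0 _ 0]], goal_cases)
      case (6 t1 s1)
      let ?s1 = "s1\<lparr>vars := (vars s1)(12 := vars s1 11)\<rparr>"
      have "envl s1" "vars s1 7 = u" using envl_frame[OF 6(2)] frame_vars[OF 6(2), of 7] e by auto
      moreover have "cube_st (CL u @ [(u, [])]) s1" using 6 by simp
      then have "cube_st (CL u @ [(u, [])]) ?s1" "vars s1 11 = Suc (length (CL u))"
        using cube_st_vars[of 12] by (simp_all add: cube_st_def)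
      ultimately have e1: "envl ?s1" "cube_st (CL u @ [(u, [])]) ?s1" "vars ?s1 12 = Suc (length (CL u))" "vars ?s1 7 = u"
        by (auto simp: envl_def env_def)
      show ?case
      proof (rule runs_cons[OF runs_cubes_below[OF e1 5(2)]], goal_cases)
        case (1 t2 s2)
        then show ?case using 6 frame_vars[OF 1(2), of 7] e1(4) cube_st_vars[of 7] by (simp add: CL_def)
      qed
    qed (use e bt_Nil[OF 5(2)] in auto)
    then show ?case by simp
  qed auto
  then show ?thesis
  proof (rule runs_cons, goal_cases)
    case (1 t s')
    define Y :: nat where "Y = Suc dm ^ 2 * 2 ^ dm"
    have "0 < Y" by (simp add: Y_def)
    then have Y: "1 \<le> Y" by simp
    have "t \<le> 2 + n * (11 + 30 * Y)" using 1 by (simp add: Y_def algebra_simps)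
    also have "\<dots> \<le> 2 + n * (50 * Y)" using Y by (intro add_mono mult_le_mono2) simp_all
    finally show ?case using 1 by (simp add: Y_def)
  qed
qed

end

section \<open>Writing the table\<close>

definition put :: "exp \<Rightarrow> com" where
  "put e = Store 3 (Var 17) e ;; inc 17"

definition emit :: "nat \<Rightarrow> com" where
  "emit x = put (Arr 18 (Var x)) ;; Assign 6 (Var x) ;;
     While (Arr 18 (Var 6)) (put (Arr 17 (Var 6)) ;; Assign 6 (Arr 16 (Var 6)))"

definition has_label :: com where
  "has_label = For 23 (Arr 10 (Var 16)) (Arr 11 (Var 16))
     (If (Bin Equal (Arr 2 (Arr 13 (Var 23))) (Arr 17 (Var 6))) (Assign 21 (Num 1)) Skip)"

text \<open>Variable 8 is a one-dimensional cube, that is, an edge going up from the current vertex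
  to some \<open>x\<close>. The flag of its class records whether all classes of the cube in
  variable 15 are incoming into \<open>x\<close>.\<close>

definition check :: com where
  "check = Assign 16 (Arr 14 (Var 8)) ;; Assign 20 (Num 1) ;; Assign 6 (Var 15) ;;
     While (Arr 18 (Var 6)) ((Assign 21 (Num 0) ;; has_label ;; If (Var 21) Skip (Assign 20 (Num 0))) ;;
       Assign 6 (Arr 16 (Var 6))) ;;
     Store 21 (Arr 17 (Var 8)) (Var 20)"

definition flag_up :: com where
  "flag_up = Assign 8 (Arr 19 (Var 7)) ;;
     While (Var 8) (If (Bin Equal (Arr 18 (Var 8)) (Num 1)) check Skip ;; Assign 8 (Arr 20 (Var 8)))"

definition try_emit :: com where
  "try_emit = Assign 22 (Num 1) ;; Assign 6 (Var 8) ;;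
     While (Arr 18 (Var 6)) (If (Arr 21 (Arr 17 (Var 6))) (Assign 22 (Num 0)) Skip ;; Assign 6 (Arr 16 (Var 6))) ;;
     If (Var 22) (inc 19 ;; emit 8) Skip"

definition emit_up :: com where
  "emit_up = Assign 8 (Arr 19 (Var 7)) ;; While (Var 8) (try_emit ;; Assign 8 (Arr 20 (Var 8)))"

text \<open>The number of lists is known only after they have been written, so variable 18 remembers
  a skipped position that is filled at the end.\<close>

definition emit_entry :: com where
  "emit_entry = Assign 7 (Arr 14 (Var 15)) ;; put (Var 7) ;; emit 15 ;; Assign 18 (Var 17) ;; inc 17 ;;
     Assign 19 (Num 0) ;; flag_up ;; emit_up ;; Store 3 (Var 18) (Var 19)"

definition emit_table :: com where
  "emit_table = Assign 17 (Num 1) ;; For 15 (Num 1) (Bin Plus (Var 11) (Num 1)) emit_entry ;; Store 3 (Num 0) (Var 11)"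

lemma wvars_emit [simp]:
  "wvars (put e) = {17}" "wvars (emit x) = {6, 17}" "wvars has_label = {21, 23}" "wvars check = {6, 16, 20, 21, 23}"
  "wvars flag_up = {6, 8, 16, 20, 21, 23}" "wvars try_emit = {6, 17, 19, 22}" "wvars emit_up = {6, 8, 17, 19, 22}"
  "wvars emit_entry = {6, 7, 8, 16, 17, 18, 19, 20, 21, 22, 23}"
  "wvars emit_table = {6, 7, 8, 15, 16, 17, 18, 19, 20, 21, 22, 23}"
  by (auto simp: put_def emit_def has_label_def check_def flag_up_def try_emit_def emit_up_def emit_entry_def emit_table_def)

lemma warrs_emit [simp]:
  "warrs (put e) = {3}" "warrs (emit x) = {3}" "warrs has_label = {}" "warrs check = {21}"
  "warrs flag_up = {21}" "warrs try_emit = {3}" "warrs emit_up = {3}"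
  "warrs emit_entry = {3, 21}" "warrs emit_table = {3, 21}"
  by (auto simp: put_def emit_def has_label_def check_def flag_up_def try_emit_def emit_up_def emit_entry_def emit_table_def)

section \<open>The output and walks along parent links\<close>

text \<open>Position 0 is reserved for the number of entries, hence the shift by one.\<close>

definition out_st :: "nat list \<Rightarrow> state \<Rightarrow> bool" where
  "out_st xs s \<longleftrightarrow> vars s 17 = Suc (length xs) \<and> (\<forall>i<length xs. arrs s 3 (Suc i) = xs ! i)"

lemma out_st_cong: "out_st xs s \<Longrightarrow> vars s' 17 = vars s 17 \<Longrightarrow> arrs s' 3 = arrs s 3 \<Longrightarrow> out_st xs s'"
  by (simp add: out_st_def)

lemma out_st_vars: "x \<noteq> 17 \<Longrightarrow> out_st xs s \<Longrightarrow> out_st xs (s\<lparr>vars := (vars s)(x := v)\<rparr>)"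
  by (simp add: out_st_def)

lemma runs_put: "out_st xs s \<Longrightarrow> runs (put e) s (\<lambda>t s'. t = 2 \<and> out_st (xs @ [exp_val e s]) s')"
  by (auto simp: put_def out_st_def nth_append)

context labelled
begin

text \<open>Parent links visit the classes of a cube from the head of its list to the end, and
  dimension 0 stops the walk. The invariant must ignore the cursor, variable 6.\<close>

lemma runs_walk:
  assumes cs: "cube_st cs s0" and c: "vars s0 6 = Suc c" "c < length cs" "cs ! c = (u, S)"
    and wr: "6 \<notin> wvars b" "{16, 17, 18} \<inter> warrs b = {}"
    and init: "I 0 s0" and stable: "\<And>j s v. I j s \<Longrightarrow> I j (s\<lparr>vars := (vars s)(6 := v)\<rparr>)"
    and body: "\<And>j s. j < length S \<Longrightarrow> I j s \<Longrightarrow> arrs s 17 (vars s 6) = S ! j \<Longrightarrow>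
      frame (While (Arr 18 (Var 6)) (b ;; Assign 6 (Arr 16 (Var 6)))) s0 s \<Longrightarrow>
      runs b s (\<lambda>t s'. t \<le> T \<and> I (Suc j) s')"
  shows "runs (While (Arr 18 (Var 6)) (b ;; Assign 6 (Arr 16 (Var 6)))) s0
    (\<lambda>t s'. t \<le> Suc (length S * (T + 2)) \<and> I (length S) s')"
proof -
  let ?w = "While (Arr 18 (Var 6)) (b ;; Assign 6 (Arr 16 (Var 6)))"
  have same: "arrs s 16 = arrs s0 16" "arrs s 17 = arrs s0 17" "arrs s 18 = arrs s0 18" if "frame ?w s0 s" for s
    using that wr(2) by (auto simp: frame_def)
  have cell: "arrs s0 18 (Suc c) = length R" "R \<noteq> [] \<Longrightarrow> arrs s0 17 (Suc c) = hd R"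
    "R \<noteq> [] \<Longrightarrow> \<exists>c'<length cs. arrs s0 16 (Suc c) = Suc c' \<and> cs ! c' = (u, tl R)"
    if "c < length cs" "cs ! c = (u, R)" for c R
  proof -
    have "cube_at cs s0 c u R" using cs that by (auto simp: cube_st_def)
    then show "arrs s0 18 (Suc c) = length R" "R \<noteq> [] \<Longrightarrow> arrs s0 17 (Suc c) = hd R"
      "R \<noteq> [] \<Longrightarrow> \<exists>c'<length cs. arrs s0 16 (Suc c) = Suc c' \<and> cs ! c' = (u, tl R)"
      unfolding cube_at_def using that(1) less_trans by blast+
  qed
  have "runs ?w s0 (\<lambda>t s'. t \<le> Suc (\<Sum>i<length S. Suc (T + 1)) \<and>
    (I (length S) s' \<and> (\<exists>c<length cs. vars s' 6 = Suc c \<and> cs ! c = (u, drop (length S) S))))"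
  proof (rule runs_while, goal_cases)
    case 1 show ?case using init c by auto
  next
    case (2 j s)
    then obtain c where c: "c < length cs" "vars s 6 = Suc c" "cs ! c = (u, drop j S)" by blast
    have ne: "drop j S \<noteq> []" using 2(1) by simp
    note cell = cell[OF c(1,3)] and sm = same[OF 2(3)]
    obtain c' where c': "c' < length cs" "arrs s0 16 (Suc c) = Suc c'" "cs ! c' = (u, tl (drop j S))"
      using cell(3)[OF ne] by blast
    have hd: "arrs s 17 (vars s 6) = S ! j" using cell(2)[OF ne] c sm 2(1) by (simp add: hd_drop_conv_nth)
    have "runs b s (\<lambda>t s'. t + 1 \<le> T + 1 \<and> (I (Suc j) (s'\<lparr>vars := (vars s')(6 := arrs s' 16 (vars s' 6))\<rparr>) \<and>
       (\<exists>c<length cs. arrs s' 16 (vars s' 6) = Suc c \<and> cs ! c = (u, drop (Suc j) S))))"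
    proof (rule runs_cons[OF body[OF 2(1) _ hd 2(3)]], goal_cases)
      case (2 t s')
      have "vars s' 6 = Suc c" "arrs s' 16 = arrs s0 16"
        using frame_vars[OF 2(2) wr(1)] frame_arrs[OF 2(2), of 16] wr(2) c sm by auto
      then show ?case using 2(1) stable c' by (auto simp: drop_Suc tl_drop)
    qed (use 2 in simp)
    then show ?case using cell(1) ne sm c by simp
  next
    case (3 s)
    then obtain c where "c < length cs" "vars s 6 = Suc c" "cs ! c = (u, [])" by auto
    then show ?case using cell(1)[of c "[]"] same[OF 3(2)] by simp
  qed
  then show ?thesis by (rule runs_cons) (auto simp: mult.commute)
qed

lemma runs_emit:
  assumes cs: "cube_st cs s" and c: "vars s x = Suc c" "c < length cs" "cs ! c = (u, S)" and o: "out_st xs s" and x: "x \<noteq> 17" "x \<noteq> 6"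
  shows "runs (emit x) s (\<lambda>t s'. t \<le> 4 + 4 * length S \<and> out_st (xs @ enc_list S) s')"
proof -
  have sz: "arrs s 18 (Suc c) = length S" using cs c(2,3) by (auto simp: cube_st_def cube_at_def)
  let ?w = "While (Arr 18 (Var 6)) (put (Arr 17 (Var 6)) ;; Assign 6 (Arr 16 (Var 6)))"
  have "runs (put (Arr 18 (Var x))) s (\<lambda>t1 s1. runs ?w (s1\<lparr>vars := (vars s1)(6 := vars s1 x)\<rparr>) (\<lambda>t2 s2.
    t1 + (1 + t2) \<le> 4 + 4 * length S \<and> out_st (xs @ enc_list S) s2))"
  proof (rule runs_cons[OF runs_put[OF o]], goal_cases)
    case (1 t1 s1)
    let ?s1 = "s1\<lparr>vars := (vars s1)(6 := vars s1 x)\<rparr>"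
    have cs1: "cube_st cs ?s1"
      by (rule cube_st_cong[OF cs]) (use frame_vars[OF 1(2), of 11] frame_arrs[OF 1(2)] in auto)
    have c1: "vars ?s1 6 = Suc c" using frame_vars[OF 1(2), of x] c x by simp
    have o1: "out_st (xs @ length S # take 0 S) ?s1" using 1 sz c out_st_vars[of 6] by simp
    have "runs ?w ?s1 (\<lambda>t s'. t \<le> Suc (length S * (2 + 2)) \<and> out_st (xs @ length S # take (length S) S) s')"
    proof (rule runs_walk[OF cs1 c1 c(2,3), where I = "\<lambda>j. out_st (xs @ length S # take j S)"], goal_cases)
      case (5 j s')
      show ?case
        by (rule runs_cons[OF runs_put[OF 5(2)]]) (use 5 in \<open>auto simp: take_Suc_conv_app_nth\<close>)
    qed (use o1 out_st_vars[of 6] in auto)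
    then show ?case by (rule runs_cons) (use 1 in \<open>auto simp: enc_list_def\<close>)
  qed
  then show ?thesis by (simp add: emit_def)
qed

lemma runs_has_label:
  assumes s: "envl s" "vars s 16 = x" "arrs s 17 (vars s 6) = l" "vars s 21 = 0" and x: "x < n"
  shows "runs has_label s (\<lambda>t s'. t \<le> 6 * Suc dm \<and> vars s' 21 = (if l \<in> set (ilab x) then 1 else 0))"
proof -
  have "runs has_label s (\<lambda>t s'. t \<le> 2 + (\<Sum>i=st x..<en x. 2 + 2) \<and>
    vars s' 21 = (if \<exists>k \<in> {st x..<en x}. lab (ie k) = l then 1 else 0) \<and> vars s' 23 = en x)"
    unfolding has_label_def
  proof (rule runs_For[where I = "\<lambda>i s'. vars s' 21 = (if \<exists>k \<in> {st x..<i}. lab (ie k) = l then 1 else 0)"], goal_cases)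
    case 1 show ?case using s by (simp add: envl_def env_def)
  next
    case 2 show ?case using rg(1)[OF x] .
  next
    case 3 show ?case using s by simp
  next
    case (4 i s')
    then have "envl s'" "vars s' 16 = x" using envl_frame[OF 4(5)] frame_vars[OF 4(5), of 16] s by auto
    then show ?case by (simp add: envl_def env_def)
  next
    case (5 i s')
    then have e: "envl s'" "arrs s' 17 (vars s' 6) = l" "vars s' 23 = i"
      using envl_frame[OF 5(5)] frame_vars[OF 5(5), of 6] frame_arrs[OF 5(5), of 17] s by auto
    have set: "{st x..<Suc i} = insert i {st x..<i}" using 5(1) by auto
    show ?case
      using e 5(3) unfolding set by (simp add: envl_def env_def)
  qed
  moreover have "(\<exists>k \<in> {st x..<en x}. lab (ie k) = l) \<longleftrightarrow> l \<in> set (ilab x)" by (auto simp: ilab_def)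
  ultimately have "runs has_label s (\<lambda>t s'. t \<le> 2 + (\<Sum>i=st x..<en x. 2 + 2) \<and>
    vars s' 21 = (if l \<in> set (ilab x) then 1 else 0) \<and> vars s' 23 = en x)" by simp
  then show ?thesis
    by (rule runs_cons) (use sum_ran_le[OF x, of 4] in auto)
qed

lemma runs_check:
  assumes s: "envl s" "cube_st cs s" "vars s 15 = Suc c" "vars s 8 = Suc c'"
    and c: "c < length cs" "cs ! c = (u, S)" "c' < length cs" "cs ! c' = (x, [l])" and x: "x < n" and S: "length S \<le> dm"
  shows "runs check s (\<lambda>t s'. t \<le> 20 * Suc dm ^ 2 \<and>
    arrs s' 21 = (arrs s 21)(l := if set S \<subseteq> set (ilab x) then 1 else 0))"
proof -
  have at: "arrs s 14 (Suc c') = x" "arrs s 17 (Suc c') = l" using s(2) c(3,4) by (auto simp: cube_st_def cube_at_def)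
  let ?s1 = "s\<lparr>vars := (vars s)(16 := x, 20 := 1, 6 := Suc c)\<rparr>"
  let ?b = "Assign 21 (Num 0) ;; has_label ;; If (Var 21) Skip (Assign 20 (Num 0))"
  let ?w = "While (Arr 18 (Var 6)) (?b ;; Assign 6 (Arr 16 (Var 6)))"
  let ?I = "\<lambda>j s'. vars s' 20 = (if set (take j S) \<subseteq> set (ilab x) then 1 else 0)"
  have cs1: "cube_st cs ?s1" by (rule cube_st_cong[OF s(2)]) auto
  have e1: "envl ?s1" using s(1) by (simp add: envl_def env_def)
  have W: "runs ?w ?s1 (\<lambda>t s'. t \<le> Suc (length S * ((3 + 6 * Suc dm) + 2)) \<and> ?I (length S) s')"
  proof (rule runs_walk[OF cs1 _ c(1,2), where I = ?I], goal_cases)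
    case (6 j s')
    let ?s2 = "s'\<lparr>vars := (vars s')(21 := 0)\<rparr>"
    have e: "envl ?s2" "vars ?s2 16 = x" "arrs ?s2 17 (vars ?s2 6) = S ! j" "vars ?s2 21 = 0"
      using envl_frame[OF 6(4) _ e1] frame_vars[OF 6(4), of 16] 6(3) by (auto simp: envl_def env_def)
    have t: "set (take (Suc j) S) = insert (S ! j) (set (take j S))" using 6(1) by (simp add: take_Suc_conv_app_nth)
    have "runs has_label ?s2 (\<lambda>t s3. runs (If (Var 21) Skip (Assign 20 (Num 0))) s3 (\<lambda>t2 s4. 1 + (t + t2) \<le> 3 + 6 * Suc dm \<and> ?I (Suc j) s4))"
    proof (rule runs_cons[OF runs_has_label[OF e x]], goal_cases)
      case (1 t s3)
      have "vars s3 20 = vars s' 20" using frame_vars[OF 1(2), of 20] by simp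
      then show ?case using 1(1) 6(2) unfolding t by (auto split: if_splits)
    qed
    then show ?case by (simp only: runs_simps(2,4) exp_val.simps)
  qed (auto split: if_splits)
  have "runs ?w ?s1 (\<lambda>t s'. Suc (Suc (Suc (t + 1))) \<le> 20 * Suc dm ^ 2 \<and>
    (arrs s' 21)(arrs s' 17 (vars s' 8) := vars s' 20) = (arrs s 21)(l := if set S \<subseteq> set (ilab x) then 1 else 0))"
  proof (rule runs_cons[OF W], goal_cases)
    case (1 t s')
    have "vars s' 8 = Suc c'" "arrs s' 21 = arrs s 21" "arrs s' 17 = arrs s 17"
      using frame_vars[OF 1(2), of 8] frame_arrs[OF 1(2), of 21] frame_arrs[OF 1(2), of 17] s by auto
    moreover have "length S * (3 + 6 * Suc dm + 2) \<le> dm * (3 + 6 * Suc dm + 2)" using S by (rule mult_le_mono1)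
    then have "t \<le> Suc (dm * (3 + 6 * Suc dm + 2))" using 1 by linarith
    then have "Suc (Suc (Suc (t + 1))) \<le> 20 * Suc dm ^ 2" by (simp add: power2_eq_square algebra_simps)
    ultimately show ?case using 1 at by simp
  qed
  then show ?thesis using s at by (simp add: check_def)
qed

section \<open>Flags for the classes going up from a vertex\<close>

lemma in_CL: "(u, S) \<in> set (CL n) \<longleftrightarrow> u < n \<and> S \<in> set (subs (ilab u))"
  by (auto simp: CL_def)

abbreviation cs :: "(nat \<times> nat list) list" where "cs \<equiv> CL n"

lemma cs_nth:
  assumes "c < length cs" "cs ! c = (u, S)"
  shows "u < n" "S \<in> set (subs (ilab u))" "set S \<subseteq> set (ilab u)" "length S \<le> dm" "distinct S"
proof -
  have "(u, S) \<in> set cs" using assms nth_mem by metis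
  then show *: "u < n" "S \<in> set (subs (ilab u))" using in_CL by auto
  show **: "set S \<subseteq> set (ilab u)" using subs_set * by blast
  show d: "distinct S" using subs_distinct[OF distinct_ilab] * by blast
  have "length S \<le> length (ilab u)"
    using card_mono[OF _ **] distinct_card[OF d] distinct_card[OF distinct_ilab[OF *(1)]] by simp
  then show "length S \<le> dm" using length_ilab[OF *(1)] by simp
qed

lemma bl_mem: "c \<in> set (bl cs w) \<longleftrightarrow> (\<exists>c'<length cs. c = Suc c' \<and> case_prod bt (cs ! c') = w)"
proof -
  have "c \<in> set (bl cs w) \<longleftrightarrow> 1 \<le> c \<and> c < Suc (length cs) \<and> case_prod bt (cs ! (c - 1)) = w"
    by (auto simp: bl_def)
  then show ?thesis by (cases c) auto
qed

text \<open>The upper end of an edge leaving \<open>u\<close> is determined by \<open>X u\<close>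
  and the class, so one flag per class is enough.\<close>

lemma bt_single_inj:
  assumes "x < n" "y < n" "l \<in> set (ilab x)" "l \<in> set (ilab y)" "bt x [l] = bt y [l]"
  shows "x = y"
proof -
  have "X x - {cl l} = X y - {cl l}" using bt(2)[of x "[l]"] bt(2)[of y "[l]"] assms by simp
  moreover have "cl l \<in> X x" "cl l \<in> X y" using cl_ilab In_sub assms by blast+
  ultimately have "X x = X y" by blast
  then show ?thesis using X_inj assms verts by auto
qed

text \<open>The intended value of the flag of \<open>l\<close>; \<open>POF_cl_iff\<close> identifies
  it with the condition that adding the class keeps a POF.\<close>

definition compat :: "nat \<Rightarrow> nat list \<Rightarrow> nat \<Rightarrow> bool" where
  "compat u S l \<longleftrightarrow> (\<exists>x<n. l \<in> set (ilab x) \<and> bt x [l] = u \<and> set S \<subseteq> set (ilab x))"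

text \<open>Removing all classes of \<open>T\<close> but \<open>l\<close> from the top leads to the
  upper end of an edge of class \<open>l\<close> with lower end \<open>u\<close>. So every flag
  consulted for a cube with bottom \<open>u\<close> has been set for \<open>u\<close>.\<close>

lemma single_below:
  assumes "t < n" "set T \<subseteq> set (ilab t)" "bt t T = u" "l \<in> set T"
  shows "\<exists>x<n. l \<in> set (ilab x) \<and> bt x [l] = u"
proof -
  have fin: "finite (cl ` (set T - {l}))" by simp
  have In: "cl ` (set T - {l}) \<subseteq> In t" "cl l \<in> In t" using cl_ilab[OF assms(1)] assms by blast+
  obtain x where x: "x \<in> V" "X x = X t - cl ` (set T - {l})" using down[OF fin In(1)] assms(1) verts by auto
  have u: "u \<in> V" "X u = X t - cl ` set T" using bt(1,2)[OF assms(1,2)] assms(3) by auto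
  have lm: "l \<in> lab ` {..<m}" "set T - {l} \<subseteq> lab ` {..<m}" using ilab_sub[OF assms(1)] assms by auto
  have lx: "cl l \<in> X x" using x In(2) In_sub inj_on_image_mem_iff[OF cl_inj lm] by blast
  have "cl ` set T = insert (cl l) (cl ` (set T - {l}))" using assms(4) by blast
  then have ux: "X u = X x - {cl l}" using u x by auto
  have "cl l \<in> In x" by (rule InI[OF lx u(1) ux x(1)])
  then obtain l' where l': "l' \<in> set (ilab x)" "cl l' = cl l" using cl_ilab[of x] x verts by (metis imageE lessThan_iff)
  have xn: "x < n" using x verts by simp
  have "l' = l" using inj_onD[OF cl_inj l'(2)] ilab_sub[OF xn] l'(1) lm by blast
  then show ?thesis using bt_eqI[OF u(1)] ux l' xn by (intro exI[of _ x]) auto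
qed

lemma single_cube: "x < n \<Longrightarrow> l \<in> set (ilab x) \<Longrightarrow> (x, [l]) \<in> set cs"
proof -
  assume x: "x < n" "l \<in> set (ilab x)"
  then have "{l} \<in> set (map set (subs (ilab x)))" unfolding subs_Pow by simp
  then obtain S where S: "S \<in> set (subs (ilab x))" "set S = {l}" by auto
  then have "distinct S" using subs_distinct distinct_ilab x by blast
  then have "S = [l]" using S(2) by (metis card.empty card_insert_disjoint distinct_card empty_iff finite.emptyI length_0_conv length_Suc_conv list.set_intros(1) singletonD)
  then show ?thesis using in_CL x S by blast
qed

text \<open>Array 21 is never cleared and may hold stale flags. The claim is confined to classes
  outgoing from \<open>u\<close>; each of them is a one-dimensional cube in the list of
  \<open>u\<close>, so its flag is written afresh.\<close>

lemma runs_flag_up: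
  assumes s: "envl s" "cube_st cs s" "vars s 15 = Suc c" "vars s 7 = u" and c: "c < length cs" "cs ! c = (u, S)"
  shows "runs flag_up s (\<lambda>t s'. t \<le> 2 + length (bl cs u) * (23 * Suc dm ^ 2) \<and>
    (\<forall>x<n. \<forall>l \<in> set (ilab x). bt x [l] = u \<longrightarrow> arrs s' 21 l = (if set S \<subseteq> set (ilab x) then 1 else 0)))"
proof -
  let ?s1 = "s\<lparr>vars := (vars s)(8 := arrs s 19 u)\<rparr>"
  let ?w = "While (Var 8) (If (Bin Equal (Arr 18 (Var 8)) (Num 1)) check Skip ;; Assign 8 (Arr 20 (Var 8)))"
  obtain ps where ps: "chain (arrs s 20) (arrs s 19 u) ps" "ps = bl cs u"
    using s(2) unfolding cube_st_def lists_def by auto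
  define I where "I j s' \<longleftrightarrow> (\<forall>x<n. \<forall>l \<in> set (ilab x). bt x [l] = u \<longrightarrow> (\<exists>p \<in> set (take j ps). cs ! (p - 1) = (x, [l])) \<longrightarrow>
    arrs s' 21 l = (if set S \<subseteq> set (ilab x) then 1 else 0))" for j and s' :: state
  have "runs ?w ?s1 (\<lambda>t s'. t \<le> Suc (\<Sum>i<length ps. 2 + (1 + 20 * Suc dm ^ 2)) \<and> I (length ps) s')"
  proof (rule runs_chain[where nx = "arrs s 20"], goal_cases)
    case 1 show ?case using ps by simp
  next
    case 2 show ?case by (simp add: I_def)
  next
    case (3 i s') show ?case using frame_arrs[OF 3(2), of 20] by simp
  next
    case (4 i s')
    let ?p = "ps ! i"
    obtain c' where c': "c' < length cs" "?p = Suc c'" "case_prod bt (cs ! c') = u"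
      using nth_mem[OF 4(1)] unfolding ps(2) bl_mem by blast
    obtain x T where xT: "cs ! c' = (x, T)" by fastforce
    have e: "envl s'" "vars s' 15 = Suc c" "vars s' 8 = Suc c'" "arrs s' 20 = arrs s 20"
      using envl_frame[OF 4(5)] frame_vars[OF 4(5), of 15] frame_arrs[OF 4(5), of 20] s c' 4(3) by (auto simp: envl_def env_def)
    have cs': "cube_st cs s'"
      by (rule cube_st_cong[OF s(2)]) (use frame_vars[OF 4(5), of 11] frame_arrs[OF 4(5)] in auto)
    have sz: "arrs s' 18 (Suc c') = length T" using cs' c'(1) xT by (auto simp: cube_st_def cube_at_def)
    have I_step: "I (Suc i) s2" if "\<And>y l. y < n \<Longrightarrow> l \<in> set (ilab y) \<Longrightarrow> bt y [l] = u \<Longrightarrow> (y, [l]) = (x, T) \<Longrightarrow>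
        arrs s2 21 l = (if set S \<subseteq> set (ilab y) then 1 else 0)"
      "\<And>y l. y < n \<Longrightarrow> l \<in> set (ilab y) \<Longrightarrow> bt y [l] = u \<Longrightarrow> (y, [l]) \<noteq> (x, T) \<Longrightarrow> arrs s2 21 l = arrs s' 21 l" for s2
      unfolding I_def
    proof (intro allI ballI impI, goal_cases)
      case (1 y l)
      then show ?case
      proof (cases "(y, [l]) = (x, T)")
        case False
        then have "\<exists>p \<in> set (take i ps). cs ! (p - 1) = (y, [l])"
          using 1(4) 4(1) c' xT by (auto simp: take_Suc_conv_app_nth)
        then show ?thesis using that(2)[OF 1(1,2,3) False] 4(2) 1 unfolding I_def by simp
      qed (use that(1) 1 in blast)
    qed
    show ?case
    proof (cases "length T = 1")
      case True
      then obtain l where T: "T = [l]" by (auto simp: length_Suc_conv)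
      note x = cs_nth[OF c'(1) xT[unfolded T]]
      have "runs check s' (\<lambda>t s2. Suc t \<le> 1 + 20 * Suc dm ^ 2 \<and> vars s2 8 = vars s' 8 \<and> arrs s2 20 = arrs s 20 \<and>
        I (Suc i) (s2\<lparr>vars := (vars s2)(8 := arrs s 20 ?p)\<rparr>))"
      proof (rule runs_cons[OF runs_check[OF e(1) cs' e(2,3) c c'(1) xT[unfolded T] x(1) cs_nth(4)[OF c]]], goal_cases)
        case (1 t s2)
        have "I (Suc i) (s2\<lparr>vars := (vars s2)(8 := arrs s 20 ?p)\<rparr>)"
        proof (rule I_step, goal_cases)
          case (1 y l')
          then show ?case using \<open>t \<le> _ \<and> _\<close> T by simp
        next
          case (2 y l')
          \<comment> \<open>Different edges going up from \<open>u\<close> have different classes,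
            so no flag is overwritten.\<close>
          have "l' \<noteq> l"
          proof
            assume "l' = l"
            then have "y = x" using bt_single_inj[of y x l] 2 x c'(3) xT T by auto
            then show False using 2 T \<open>l' = l\<close> by simp
          qed
          then show ?case using \<open>t \<le> _ \<and> _\<close> by simp
        qed
        then show ?case using 1 frame_vars[OF 1(2), of 8] frame_arrs[OF 1(2), of 20] e by simp
      qed
      then show ?thesis using sz True e by simp
    next
      case False
      have "I (Suc i) (s'\<lparr>vars := (vars s')(8 := arrs s 20 ?p)\<rparr>)"
        by (rule I_step) (use False in auto)
      then show ?thesis using sz False e by simp
    qed
  qed
  then have "runs ?w ?s1 (\<lambda>t s'. Suc t \<le> 2 + length (bl cs u) * (23 * Suc dm ^ 2) \<and>
    (\<forall>x<n. \<forall>l \<in> set (ilab x). bt x [l] = u \<longrightarrow> arrs s' 21 l = (if set S \<subseteq> set (ilab x) then 1 else 0)))"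
  proof (rule runs_cons, goal_cases)
    case (1 t s')
    have "1 \<le> Suc dm ^ 2" by simp
    then have "3 + 20 * Suc dm ^ 2 \<le> 23 * Suc dm ^ 2" by linarith
    then have "length ps * (3 + 20 * Suc dm ^ 2) \<le> length ps * (23 * Suc dm ^ 2)" by (rule mult_le_mono2)
    moreover have "(\<Sum>i<length ps. 2 + (1 + 20 * Suc dm ^ 2)) = length ps * (3 + 20 * Suc dm ^ 2)" by (simp add: distrib_left)
    ultimately have "Suc t \<le> 2 + length (bl cs u) * (23 * Suc dm ^ 2)" using 1 unfolding ps(2) by linarith
    moreover have "arrs s' 21 l = (if set S \<subseteq> set (ilab x) then 1 else 0)" if x: "x < n" "l \<in> set (ilab x)" "bt x [l] = u" for x l
    proof -
      obtain c' where c': "c' < length cs" "cs ! c' = (x, [l])" using single_cube[OF x(1,2)] by (metis in_set_conv_nth)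
      then have "Suc c' \<in> set ps" unfolding ps(2) bl_mem using x by auto
      then show ?thesis using conjunct2[OF 1(1)] x c' unfolding I_def by (metis diff_Suc_1 take_all order_refl)
    qed
    ultimately show ?case by blast
  qed
  then show ?thesis using s by (simp add: flag_up_def)
qed

end

text \<open>The skipped position counts as output with whatever it contains, until
  \<open>out_st_fill\<close> overwrites it.\<close>

lemma out_st_hole:
  assumes "out_st ys s" "arrs s' 3 = arrs s 3" "vars s' 17 = Suc (vars s 17)"
  shows "out_st (ys @ [arrs s 3 (Suc (length ys))]) s'"
  using assms by (auto simp: out_st_def nth_append less_Suc_eq)

lemma out_st_fill:
  assumes "out_st (ys @ h # zs) s"
  shows "out_st (ys @ v # zs) (s\<lparr>arrs := (arrs s)(3 := (arrs s 3)(Suc (length ys) := v))\<rparr>)"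
  using assms by (auto simp: out_st_def nth_append nth_Cons split: nat.splits)

context labelled
begin

lemma runs_try_emit:
  assumes s: "cube_st cs s" "vars s 8 = Suc c" "out_st xs s" and c: "c < length cs" "cs ! c = (t, T)"
  shows "runs try_emit s (\<lambda>k s'. k \<le> 10 + 8 * dm \<and>
    (if \<forall>l \<in> set T. arrs s 21 l = 0 then out_st (xs @ enc_list T) s' \<and> vars s' 19 = Suc (vars s 19)
     else out_st xs s' \<and> vars s' 19 = vars s 19))"
proof -
  let ?s1 = "s\<lparr>vars := (vars s)(22 := 1, 6 := Suc c)\<rparr>"
  let ?b = "If (Arr 21 (Arr 17 (Var 6))) (Assign 22 (Num 0)) Skip"
  let ?w = "While (Arr 18 (Var 6)) (?b ;; Assign 6 (Arr 16 (Var 6)))"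
  let ?I = "\<lambda>j s'. vars s' 22 = (if \<forall>l \<in> set (take j T). arrs s 21 l = 0 then 1 else 0)"
  have cs1: "cube_st cs ?s1" by (rule cube_st_cong[OF s(1)]) auto
  note T = cs_nth(4)[OF c]
  have W: "runs ?w ?s1 (\<lambda>k s'. k \<le> Suc (length T * (2 + 2)) \<and> ?I (length T) s')"
  proof (rule runs_walk[OF cs1 _ c, where I = ?I], goal_cases)
    case (6 j s')
    have F: "arrs s' 21 = arrs s 21" using frame_arrs[OF 6(4), of 21] by simp
    have t: "set (take (Suc j) T) = insert (T ! j) (set (take j T))" using 6(1) by (simp add: take_Suc_conv_app_nth)
    show ?case unfolding t using 6(2,3) F by (auto split: if_splits)
  qed auto
  have "runs ?w ?s1 (\<lambda>k s2. runs (If (Var 22) (inc 19 ;; emit 8) Skip) s2 (\<lambda>k2 s'. Suc (Suc (k + k2)) \<le> 10 + 8 * dm \<and>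
    (if \<forall>l \<in> set T. arrs s 21 l = 0 then out_st (xs @ enc_list T) s' \<and> vars s' 19 = Suc (vars s 19)
     else out_st xs s' \<and> vars s' 19 = vars s 19)))"
  proof (rule runs_cons[OF W], goal_cases)
    case (1 k s2)
    have k: "k \<le> Suc (4 * dm)" using 1(1) T by simp
    have o: "out_st xs s2" by (rule out_st_cong[OF s(3)]) (use frame_vars[OF 1(2), of 17] frame_arrs[OF 1(2), of 3] in auto)
    have v: "vars s2 8 = Suc c" "vars s2 19 = vars s 19" using frame_vars[OF 1(2)] s by auto
    show ?case
    proof (cases "\<forall>l \<in> set T. arrs s 21 l = 0")
      case True
      let ?s3 = "s2\<lparr>vars := (vars s2)(19 := Suc (vars s2 19))\<rparr>"
      have cs3: "cube_st cs ?s3"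
        by (rule cube_st_cong[OF s(1)]) (use frame_vars[OF 1(2), of 11] frame_arrs[OF 1(2)] in auto)
      have "runs (emit 8) ?s3 (\<lambda>k2 s'. Suc (Suc (k + Suc (1 + k2))) \<le> 10 + 8 * dm \<and> out_st (xs @ enc_list T) s' \<and> vars s' 19 = Suc (vars s 19))"
      proof (rule runs_cons[OF runs_emit[OF cs3 _ c out_st_vars[OF _ o]]], goal_cases)
        case (5 k2 s')
        then show ?case using k T v frame_vars[OF 5(2), of 19] by simp
      qed (use v in auto)
      then show ?thesis using 1 True by simp
    next
      case False
      then have "vars s2 22 = 0" using 1 by simp
      then show ?thesis using False o v k by simp
    qed
  qed
  then show ?thesis using s by (simp add: try_emit_def del: runs_simps(5))
qed

lemma runs_emit_up:
  assumes s: "cube_st cs s" "vars s 7 = u" "out_st xs s" "vars s 19 = 0"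
    and Ps: "Ps = filter (\<lambda>T. \<forall>l \<in> set T. arrs s 21 l = 0) (map (\<lambda>c. snd (cs ! (c - 1))) (bl cs u))"
  shows "runs emit_up s (\<lambda>k s'. k \<le> 2 + length (bl cs u) * (12 + 8 * dm) \<and>
    out_st (xs @ concat (map enc_list Ps)) s' \<and> vars s' 19 = length Ps)"
proof -
  let ?s1 = "s\<lparr>vars := (vars s)(8 := arrs s 19 u)\<rparr>"
  let ?w = "While (Var 8) (try_emit ;; Assign 8 (Arr 20 (Var 8)))"
  obtain ps where ps: "chain (arrs s 20) (arrs s 19 u) ps" "ps = bl cs u"
    using s(1) unfolding cube_st_def lists_def by auto
  define P where "P j = filter (\<lambda>T. \<forall>l \<in> set T. arrs s 21 l = 0) (map (\<lambda>c. snd (cs ! (c - 1))) (take j ps))" for j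
  define I where "I j s' \<longleftrightarrow> out_st (xs @ concat (map enc_list (P j))) s' \<and> vars s' 19 = length (P j)" for j and s' :: state
  have "runs ?w ?s1 (\<lambda>k s'. k \<le> Suc (\<Sum>i<length ps. 2 + (10 + 8 * dm)) \<and> I (length ps) s')"
  proof (rule runs_chain[where nx = "arrs s 20"], goal_cases)
    case 1 show ?case using ps by simp
  next
    case 2 show ?case using s out_st_vars[of 8] by (simp add: I_def P_def)
  next
    case (3 i s') show ?case using frame_arrs[OF 3(2), of 20] by simp
  next
    case (4 i s')
    let ?p = "ps ! i"
    obtain c' where c': "c' < length cs" "?p = Suc c'"
      using nth_mem[OF 4(1)] unfolding ps(2) bl_mem by blast
    obtain x T where xT: "cs ! c' = (x, T)" by fastforce
    have e: "vars s' 8 = Suc c'" "arrs s' 20 = arrs s 20" "arrs s' 21 = arrs s 21"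
      using frame_arrs[OF 4(5), of 20] frame_arrs[OF 4(5), of 21] c' 4(3) by auto
    have cs': "cube_st cs s'"
      by (rule cube_st_cong[OF s(1)]) (use frame_vars[OF 4(5), of 11] frame_arrs[OF 4(5)] in auto)
    have PS: "P (Suc i) = P i @ (if \<forall>l \<in> set T. arrs s 21 l = 0 then [T] else [])"
      using 4(1) c' xT by (simp add: P_def take_Suc_conv_app_nth)
    show ?case
    proof (rule runs_cons[OF runs_try_emit[OF cs' e(1) conjunct1[OF 4(2)[unfolded I_def]] c'(1) xT]], goal_cases)
      case (1 k s2)
      then show ?case
        using frame_vars[OF 1(2), of 8] frame_arrs[OF 1(2), of 20] e 4(2) PS
        by (auto simp: I_def out_st_def split: if_splits)
    qed
  qed
  then have "runs ?w ?s1 (\<lambda>k s'. Suc k \<le> 2 + length (bl cs u) * (12 + 8 * dm) \<and>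
    out_st (xs @ concat (map enc_list Ps)) s' \<and> vars s' 19 = length Ps)"
    by (rule runs_cons) (auto simp: I_def P_def Ps ps(2) distrib_left)
  then show ?thesis using s by (simp add: emit_up_def)
qed

definition Ps :: "nat \<Rightarrow> nat list \<Rightarrow> nat list list" where
  "Ps u S = filter (\<lambda>T. \<forall>l \<in> set T. \<not> compat u S l) (map (\<lambda>c. snd (cs ! (c - 1))) (bl cs u))"

lemma bl_cubes:
  "T \<in> set (map (\<lambda>c. snd (cs ! (c - 1))) (bl cs u)) \<longleftrightarrow> (\<exists>t. (t, T) \<in> set cs \<and> bt t T = u)"
proof -
  have "T \<in> set (map (\<lambda>c. snd (cs ! (c - 1))) (bl cs u)) \<longleftrightarrow> (\<exists>c<length cs. case_prod bt (cs ! c) = u \<and> T = snd (cs ! c))"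
    unfolding set_map image_iff Bex_def bl_mem by auto
  also have "\<dots> \<longleftrightarrow> (\<exists>x \<in> set cs. case_prod bt x = u \<and> T = snd x)" by (metis in_set_conv_nth)
  finally show ?thesis by force
qed

lemma cl_sub_X: "u < n \<Longrightarrow> set S \<subseteq> set (ilab u) \<Longrightarrow> cl ` set S \<subseteq> X u"
  using cl_ilab[of u] In_sub[of u] image_mono[of "set S" "set (ilab u)" cl] by simp

lemma runs_emit_entry:
  assumes s: "envl s" "cube_st cs s" "vars s 15 = Suc c" "out_st xs s" and c: "c < length cs" "cs ! c = (u, S)"
  shows "runs emit_entry s (\<lambda>k s'. k \<le> 60 * (Suc dm ^ 2 * (1 + length (bl cs u))) \<and> out_st (xs @ enc_entry (u, S, Ps u S)) s')"
proof -
  let ?s1 = "s\<lparr>vars := (vars s)(7 := u)\<rparr>"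
  have top: "arrs s 14 (Suc c) = u" using s(2) c by (auto simp: cube_st_def cube_at_def)
  let ?ys = "xs @ u # enc_list S"
  let ?Q = "\<lambda>k s'. k \<le> 60 * (Suc dm ^ 2 * (1 + length (bl cs u))) \<and> out_st (xs @ enc_entry (u, S, Ps u S)) s'"
  let ?rest = "emit 15 ;; Assign 18 (Var 17) ;; inc 17 ;; Assign 19 (Num 0) ;; flag_up ;; emit_up ;; Store 3 (Var 18) (Var 19)"
  have "runs (put (Var 7)) ?s1 (\<lambda>k1 s2. runs ?rest s2 (\<lambda>k2. ?Q (1 + (k1 + k2))))"
  proof (rule runs_cons[OF runs_put[OF out_st_vars[OF _ s(4)]]], goal_cases)
    case (2 k1 s2)
    have cs2: "cube_st cs s2" by (rule cube_st_cong[OF s(2)]) (use frame_vars[OF 2(2), of 11] frame_arrs[OF 2(2)] in auto)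
    have v2: "vars s2 15 = Suc c" "vars s2 7 = u" using frame_vars[OF 2(2)] s by auto
    have o2: "out_st (xs @ [u]) s2" using 2 by simp
    have en2: "envl s2" using envl_frame[OF 2(2)] s(1) by (simp add: envl_def env_def)
    show ?case unfolding runs_simps(4)[of "emit 15"]
    proof (rule runs_cons[OF runs_emit[OF cs2 v2(1) c o2]], goal_cases)
      case (3 k3 s3)
      let ?s4 = "s3\<lparr>vars := (vars s3)(18 := vars s3 17, 17 := Suc (vars s3 17), 19 := 0)\<rparr>"
      \<comment> \<open>The arbitrary content of the position reserved for the number of
        lists.\<close>
      let ?h = "arrs s3 3 (Suc (length ?ys))"
      have o3: "out_st ?ys s3" using 3 by simp
      then have v18: "vars s3 17 = Suc (length ?ys)" by (simp add: out_st_def)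
      have o4: "out_st (?ys @ [?h]) ?s4" by (rule out_st_hole[OF o3]) simp_all
      have v3: "vars s3 7 = u" "vars s3 15 = Suc c" using frame_vars[OF 3(2)] v2 by auto
      have cs4: "cube_st cs ?s4" by (rule cube_st_cong[OF cs2]) (use frame_vars[OF 3(2), of 11] frame_arrs[OF 3(2)] in auto)
      have en4: "envl ?s4" using envl_frame[OF 3(2)] en2 by (simp add: envl_def env_def)
      have "runs flag_up ?s4 (\<lambda>k5 s5. runs emit_up s5 (\<lambda>k6 s6. runs (Store 3 (Var 18) (Var 19)) s6
         (\<lambda>k7. ?Q (1 + (k1 + (k3 + (1 + (1 + (1 + (k5 + (k6 + k7)))))))))))"
      proof (rule runs_cons[OF runs_flag_up[OF en4 cs4 _ _ c]], goal_cases)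
        case (3 k5 s5)
        have cs5: "cube_st cs s5" by (rule cube_st_cong[OF cs4]) (use frame_vars[OF 3(2), of 11] frame_arrs[OF 3(2)] in auto)
        have v5: "vars s5 7 = u" "vars s5 18 = Suc (length ?ys)" "vars s5 19 = 0"
          using frame_vars[OF 3(2)] v3 v18 by auto
        have o5: "out_st (?ys @ [?h]) s5"
          by (rule out_st_cong[OF o4]) (use frame_vars[OF 3(2), of 17] frame_arrs[OF 3(2), of 3] in auto)
        \<comment> \<open>The vertex \<open>x\<close> is unique by \<open>bt_single_inj\<close>, so
          the flag computed for it decides \<open>compat\<close>.\<close>
        have flags: "arrs s5 21 l = 0 \<longleftrightarrow> \<not> compat u S l" if "x < n" "l \<in> set (ilab x)" "bt x [l] = u" for x l
        proof -
          have "arrs s5 21 l = (if set S \<subseteq> set (ilab x) then 1 else 0)" using 3(1) that by blast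
          moreover have "compat u S l \<longleftrightarrow> set S \<subseteq> set (ilab x)"
            unfolding compat_def using that bt_single_inj by metis
          ultimately show ?thesis by simp
        qed
        have "(\<forall>l \<in> set T. \<not> compat u S l) \<longleftrightarrow> (\<forall>l \<in> set T. arrs s5 21 l = 0)"
          if Tm: "T \<in> set (map (\<lambda>c. snd (cs ! (c - 1))) (bl cs u))" for T
        proof -
          obtain t where t: "(t, T) \<in> set cs" "bt t T = u" using Tm bl_cubes by blast
          then obtain c' where c': "c' < length cs" "cs ! c' = (t, T)" "bt t T = u"
            by (metis in_set_conv_nth)
          note T = cs_nth[OF c'(1,2)]
          have "\<exists>x<n. l \<in> set (ilab x) \<and> bt x [l] = u" if "l \<in> set T" for l
            using single_below[OF T(1,3) c'(3) that] .
          then show ?thesis using flags by blast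
        qed
        then have Ps: "Ps u S = filter (\<lambda>T. \<forall>l \<in> set T. arrs s5 21 l = 0) (map (\<lambda>c. snd (cs ! (c - 1))) (bl cs u))"
          unfolding Ps_def by (intro filter_cong) auto
        show ?case
        proof (rule runs_cons[OF runs_emit_up[OF cs5 v5(1) o5 v5(3) Ps]], goal_cases)
          case (1 k6 s6)
          have v6: "vars s6 18 = Suc (length ?ys)" "vars s6 19 = length (Ps u S)"
            using frame_vars[OF 1(2), of 18] v5 1 by auto
          let ?tl = "concat (map enc_list (Ps u S))"
          have o6: "out_st (?ys @ ?h # ?tl) s6" using 1 by simp
          have "out_st (?ys @ length (Ps u S) # ?tl) (s6\<lparr>arrs := (arrs s6)(3 := (arrs s6 3)(Suc (length ?ys) := length (Ps u S)))\<rparr>)"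
            by (rule out_st_fill[OF o6])
          moreover have "?ys @ length (Ps u S) # ?tl = xs @ enc_entry (u, S, Ps u S)" by (simp add: enc_entry_def)
          ultimately have o7: "out_st (xs @ enc_entry (u, S, Ps u S)) (s6\<lparr>arrs := (arrs s6)(3 := (arrs s6 3)(Suc (length ?ys) := length (Ps u S)))\<rparr>)"
            by simp
          have D: "1 \<le> Suc dm ^ 2" "Suc dm \<le> Suc dm ^ 2" by (simp_all add: power2_eq_square)
          have S: "length S \<le> dm" using cs_nth(4)[OF c] .
          let ?L = "length (bl cs u)"
          have "k1 = 2" "k3 \<le> 4 + 4 * dm" "k5 \<le> 2 + ?L * (23 * Suc dm ^ 2)" "k6 \<le> 2 + ?L * (12 + 8 * dm)"
            using \<open>k1 = 2 \<and> _\<close> \<open>k3 \<le> _ \<and> _\<close> 3(1) 1(1) S by auto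
          moreover have "12 + 8 * dm \<le> 20 * Suc dm ^ 2" using D by linarith
          then have "?L * (12 + 8 * dm) \<le> ?L * (20 * Suc dm ^ 2)" by (rule mult_le_mono2)
          moreover have "60 * (Suc dm ^ 2 * (1 + ?L)) = 60 * Suc dm ^ 2 + 60 * (?L * Suc dm ^ 2)" "?L * (20 * Suc dm ^ 2) = 20 * (?L * Suc dm ^ 2)"
            "?L * (23 * Suc dm ^ 2) = 23 * (?L * Suc dm ^ 2)" by (simp_all only: distrib_left mult.commute mult.left_commute mult_1_right)
          ultimately have "1 + (k1 + (k3 + (1 + (1 + (1 + (k5 + (k6 + 1))))))) \<le> 60 * (Suc dm ^ 2 * (1 + ?L))"
            using D by linarith
          then show ?case using o7 v6 by (simp only: runs_simps exp_val.simps)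
        qed
      qed (use v3 in auto)
      then show ?case by (simp only: runs_simps(2,4) exp_val.simps binop_val.simps state.simps fun_upd_same fun_upd_other fun_upd_apply) simp
    qed auto
  qed auto
  then show ?thesis using top s(3) by (simp add: emit_entry_def del: runs_simps(3) fun_upd_apply add: fun_upd_same)
qed

definition table :: "entry list" where
  "table = map (\<lambda>(u, S). (u, S, Ps u S)) cs"

lemma runs_emit_table:
  assumes s: "envl s" "cube_st cs s"
  shows "runs emit_table s (\<lambda>k s'. k \<le> 4 + (\<Sum>c<length cs. 62 * (Suc dm ^ 2 * (1 + length (bl cs (fst (cs ! c)))))) \<and>
    (\<forall>i<length (enc_table table). arrs s' 3 i = enc_table table ! i))"
proof -
  let ?s1 = "s\<lparr>vars := (vars s)(17 := 1)\<rparr>"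
  define f where "f c = 60 * (Suc dm ^ 2 * (1 + length (bl cs (fst (cs ! c)))))" for c
  let ?for = "For 15 (Num 1) (Bin Plus (Var 11) (Num 1)) emit_entry"
  define I where "I i s' \<longleftrightarrow> out_st (concat (map enc_entry (take (i - 1) table))) s'" for i and s' :: state
  have N: "vars s 11 = length cs" using s(2) by (simp add: cube_st_def)
  have "runs ?for ?s1 (\<lambda>k s'. k \<le> 2 + (\<Sum>i=1..<Suc (length cs). 2 + f (i - 1)) \<and> I (Suc (length cs)) s' \<and> vars s' 15 = Suc (length cs))"
  proof (rule runs_For[where I = I], goal_cases)
    case 3 show ?case by (simp add: I_def out_st_def)
  next
    case (4 i s')
    show ?case using frame_vars[OF 4(5), of 11] N by simp
  next
    case (5 i s')
    then obtain c where c: "i = Suc c" "c < length cs" by (cases i) auto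
    obtain u S where uS: "cs ! c = (u, S)" by fastforce
    have en: "envl s'" using envl_frame[OF 5(5)] s(1) by (simp add: envl_def env_def)
    have cs': "cube_st cs s'" by (rule cube_st_cong[OF s(2)]) (use frame_vars[OF 5(5), of 11] frame_arrs[OF 5(5)] in auto)
    have v: "vars s' 15 = Suc c" using 5 c by simp
    have o: "out_st (concat (map enc_entry (take c table))) s'" using 5(3) c by (simp add: I_def)
    have t: "concat (map enc_entry (take (Suc c) table)) = concat (map enc_entry (take c table)) @ enc_entry (u, S, Ps u S)"
      using c uS by (simp add: table_def take_Suc_conv_app_nth)
    show ?case
    proof (rule runs_cons[OF runs_emit_entry[OF en cs' v o c(2) uS]], goal_cases)
      case (1 k s2)
      then show ?case using frame_vars[OF 1(2), of 15] 5(4) c uS t out_st_vars[of 15] by (simp add: I_def f_def)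
    qed
  qed auto
  then have "runs ?for ?s1 (\<lambda>k s'. 1 + (k + 1) \<le> 4 + (\<Sum>c<length cs. 62 * (Suc dm ^ 2 * (1 + length (bl cs (fst (cs ! c)))))) \<and>
    (\<forall>i<length (enc_table table). ((arrs s' 3)(0 := vars s' 11)) i = enc_table table ! i))"
  proof (rule runs_cons, goal_cases)
    case (1 k s')
    have tl: "length table = length cs" by (simp add: table_def)
    have "(\<Sum>i=1..<Suc (length cs). 2 + f (i - 1)) = (\<Sum>c<length cs. 2 + f c)"
      using sum.shift_bounds_Suc_ivl[of "\<lambda>i. 2 + f (i - 1)" 0 "length cs"] by (simp add: lessThan_atLeast0)
    also have "\<dots> \<le> (\<Sum>c<length cs. 62 * (Suc dm ^ 2 * (1 + length (bl cs (fst (cs ! c))))))"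
    proof (rule sum_mono)
      fix c
      have "0 < Suc dm ^ 2 * (1 + length (bl cs (fst (cs ! c))))" by simp
      then show "2 + f c \<le> 62 * (Suc dm ^ 2 * (1 + length (bl cs (fst (cs ! c)))))" unfolding f_def by linarith
    qed
    finally have k: "1 + (k + 1) \<le> 4 + (\<Sum>c<length cs. 62 * (Suc dm ^ 2 * (1 + length (bl cs (fst (cs ! c))))))"
      using 1(1) by linarith
    have "out_st (concat (map enc_entry table)) s'" using 1 tl by (simp add: I_def)
    moreover have "vars s' 11 = length cs" using frame_vars[OF 1(2), of 11] N by simp
    ultimately show ?case using k tl by (auto simp: enc_table_def out_st_def nth_Cons split: nat.splits)
  qed
  then show ?thesis by (simp add: emit_table_def)
qed

section \<open>Counting pairs of cubes\<close>

lemma CL_Suc: "CL (Suc i) = CL i @ map (Pair i) (subs (ilab i))"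
  by (simp add: CL_def)

lemma length_CL: "i \<le> n \<Longrightarrow> length (CL i) \<le> i * 2 ^ dm"
proof (induction i)
  case (Suc i)
  have "(2 :: nat) ^ length (ilab i) \<le> 2 ^ dm" using length_ilab[of i] Suc.prems by (simp add: power_increasing)
  moreover have "length (CL i) \<le> i * 2 ^ dm" using Suc by simp
  ultimately show ?case by (simp only: CL_Suc length_append length_map length_subs mult_Suc)
qed (simp add: CL_def)

lemma sum_top: "i \<le> n \<Longrightarrow> (\<Sum>x\<leftarrow>CL i. g (fst x)) \<le> 2 ^ dm * (\<Sum>u<i. g u :: nat)"
proof (induction i)
  case (Suc i)
  have "(2 :: nat) ^ length (ilab i) \<le> 2 ^ dm" using length_ilab[of i] Suc.prems by (simp add: power_increasing)
  then have "2 ^ length (ilab i) * g i \<le> 2 ^ dm * g i" by (rule mult_le_mono1)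
  moreover have "(\<Sum>x\<leftarrow>map (Pair i) (subs (ilab i)). g (fst x)) = 2 ^ length (ilab i) * g i"
    by (simp add: comp_def sum_list_triv length_subs)
  moreover have "(\<Sum>x\<leftarrow>CL i. g (fst x)) \<le> 2 ^ dm * (\<Sum>u<i. g u)" using Suc by simp
  ultimately show ?case
    by (simp only: CL_Suc map_append sum_list_append sum.lessThan_Suc distrib_left)
qed (simp add: CL_def)

lemma sum_length_filter: "(\<Sum>u<(n::nat). length (filter (\<lambda>c. f c = u) xs)) \<le> length xs"
proof (induction xs)
  case (Cons x xs)
  have "(\<Sum>u<n. length (filter (\<lambda>c. f c = u) (x # xs))) =
    (\<Sum>u<n. (if f x = u then 1 else 0) + length (filter (\<lambda>c. f c = u) xs))" by (rule sum.cong) auto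
  also have "\<dots> = (\<Sum>u<n. if f x = u then 1 else 0) + (\<Sum>u<n. length (filter (\<lambda>c. f c = u) xs))"
    by (rule sum.distrib)
  also have "(\<Sum>u<n. if f x = u then 1 else 0 :: nat) \<le> 1" by simp
  finally show ?case using Cons by simp
qed simp

text \<open>Grouping the cubes by their tops gives one factor \<open>2 ^ dm\<close>. The lists of
  cubes with a given bottom have total length at most the number of cubes, which is at most
  \<open>n * 2 ^ dm\<close>. The constant doubles from 62 to 124 to absorb the summand 1 of each
  cube.\<close>

lemma table_steps:
  "(\<Sum>c<length cs. 62 * (Suc dm ^ 2 * (1 + length (bl cs (fst (cs ! c)))))) \<le> 124 * (n * Suc dm ^ 2 * 4 ^ dm)"
proof -
  have "(\<Sum>c<length cs. length (bl cs (fst (cs ! c)))) = (\<Sum>x\<leftarrow>cs. length (bl cs (fst x)))"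
    by (simp add: sum_list_sum_nth lessThan_atLeast0)
  also have "\<dots> \<le> 2 ^ dm * (\<Sum>u<n. length (bl cs u))" by (rule sum_top) simp
  also have "(\<Sum>u<n. length (bl cs u)) \<le> length cs"
    using sum_length_filter[of "\<lambda>c. case_prod bt (cs ! (c - 1))" "[1..<Suc (length cs)]"]
    by (simp only: bl_def length_rev length_upt diff_Suc_1)
  finally have 1: "(\<Sum>c<length cs. length (bl cs (fst (cs ! c)))) \<le> 2 ^ dm * length cs" by simp
  have "(\<Sum>c<length cs. 62 * (Suc dm ^ 2 * (1 + length (bl cs (fst (cs ! c)))))) =
     62 * (Suc dm ^ 2 * (\<Sum>c<length cs. 1 + length (bl cs (fst (cs ! c)))))"
    by (simp only: sum_distrib_left)
  also have "(\<Sum>c<length cs. 1 + length (bl cs (fst (cs ! c)))) = length cs + (\<Sum>c<length cs. length (bl cs (fst (cs ! c))))"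
    by (simp only: sum.distrib) simp
  also have "62 * (Suc dm ^ 2 * (length cs + (\<Sum>c<length cs. length (bl cs (fst (cs ! c)))))) \<le>
     62 * (Suc dm ^ 2 * (2 ^ dm * length cs + 2 ^ dm * length cs))"
    using 1 by (intro mult_le_mono2 add_mono) simp_all
  also have "\<dots> = 124 * (Suc dm ^ 2 * (2 ^ dm * length cs))" by (simp add: algebra_simps)
  also have "\<dots> \<le> 124 * (Suc dm ^ 2 * (2 ^ dm * (n * 2 ^ dm)))"
    using length_CL[of n] by (intro mult_le_mono2) simp
  also have "\<dots> = 124 * (n * Suc dm ^ 2 * 4 ^ dm)"
  proof -
    have "(4 :: nat) ^ dm = 2 ^ dm * 2 ^ dm" by (simp add: power_mult_distrib[symmetric])
    then show ?thesis by (simp only: mult.assoc mult.left_commute mult.commute)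
  qed
  finally show ?thesis .
qed

section \<open>Correctness of the table\<close>

lemma dec_eq: "named_classes es lab S = cl ` set S"
  by (simp add: named_classes_def)

lemma cl_image_inj:
  assumes "set S \<subseteq> set (ilab u)" "set T \<subseteq> set (ilab u)" "u < n" "cl ` set S = cl ` set T"
  shows "set S = set T"
  using inj_on_image_eq_iff[OF cl_inj] ilab_sub[OF assms(3)] assms by (metis subset_trans)

lemma distinct_CL: "i \<le> n \<Longrightarrow> distinct (map (\<lambda>(u, S). (cl ` set S, u)) (CL i))"
proof (induction i)
  case (Suc i)
  have i: "i < n" using Suc by simp
  have d: "distinct (map set (subs (ilab i)))" by (rule distinct_subs[OF distinct_ilab[OF i]])
  have "inj_on (\<lambda>S. (cl ` set S, i)) (set (subs (ilab i)))"
  proof (rule inj_onI)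
    fix S T assume *: "S \<in> set (subs (ilab i))" "T \<in> set (subs (ilab i))" "(cl ` set S, i) = (cl ` set T, i)"
    then have "set S = set T" using cl_image_inj[OF subs_set subs_set i] by simp
    then show "S = T" using d * by (auto simp: distinct_map dest: inj_onD)
  qed
  then have "distinct (map (\<lambda>(u, S). (cl ` set S, u)) (map (Pair i) (subs (ilab i))))"
    using d by (simp add: distinct_map comp_def)
  moreover have "u < i" if "(u, S) \<in> set (CL i)" for u S using that by (auto simp: CL_def)
  ultimately show ?case using Suc by (fastforce simp: CL_Suc)
qed (simp add: CL_def)

text \<open>By \<open>single_below\<close> the class of \<open>l\<close> goes up from
  \<open>u\<close> along an edge, and \<open>POF_insert_iff\<close> applies to the upper end of this
  edge.\<close>

lemma POF_cl_iff:
  assumes S: "u < n" "set S \<subseteq> set (ilab u)" and T: "t < n" "set T \<subseteq> set (ilab t)" "bt t T = u" "l \<in> set T"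
  shows "POF G (insert (cl l) (cl ` set S)) \<longleftrightarrow> compat u S l"
proof -
  obtain x where x: "x < n" "l \<in> set (ilab x)" "bt x [l] = u" using single_below[OF T] by blast
  have Xu: "X u = X x - {cl l}" using bt(2)[of x "[l]"] x by simp
  have lx: "cl l \<in> X x" using cl_ilab[OF x(1)] In_sub x(2) by blast
  have "u \<in> V" "x \<in> V" "cl ` set S \<subseteq> In u" using S x cl_ilab verts by auto
  then have "POF G (insert (cl l) (cl ` set S)) \<longleftrightarrow> cl ` set S \<subseteq> In x"
    using Xu lx by (intro POF_insert_iff) auto
  also have "\<dots> \<longleftrightarrow> set S \<subseteq> set (ilab x)"
  proof -
    have "set S \<subseteq> lab ` {..<m}" "set (ilab x) \<subseteq> lab ` {..<m}" using ilab_sub S x by blast+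
    then have "cl a \<in> cl ` set (ilab x) \<longleftrightarrow> a \<in> set (ilab x)" if "a \<in> set S" for a
      using inj_on_image_mem_iff[OF cl_inj, of a "set (ilab x)"] that by blast
    then show ?thesis unfolding cl_ilab[OF x(1), symmetric] image_subset_iff by blast
  qed
  also have "\<dots> \<longleftrightarrow> compat u S l"
    unfolding compat_def using x bt_single_inj by metis
  finally show ?thesis .
qed

lemma bottom_cubes:
  assumes "u < n"
  shows "(\<exists>t \<in> V. L \<subseteq> In t \<and> X u = X t - L) \<longleftrightarrow> (\<exists>t T. (t, T) \<in> set cs \<and> bt t T = u \<and> L = cl ` set T)"
proof
  assume "\<exists>t \<in> V. L \<subseteq> In t \<and> X u = X t - L"
  then obtain t where t: "t < n" "L \<subseteq> In t" "X u = X t - L" using verts by auto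
  then obtain A where A: "A \<subseteq> set (ilab t)" "L = cl ` A" using cl_ilab[OF t(1)] by (metis subset_image_iff)
  then have "A \<in> set (map set (subs (ilab t)))" unfolding subs_Pow by simp
  then obtain T where "T \<in> set (subs (ilab t))" "set T = A" by auto
  then show "\<exists>t T. (t, T) \<in> set cs \<and> bt t T = u \<and> L = cl ` set T"
    using t A in_CL bt_eqI[of u t T] assms verts by auto
next
  assume "\<exists>t T. (t, T) \<in> set cs \<and> bt t T = u \<and> L = cl ` set T"
  then obtain t T where *: "(t, T) \<in> set cs" "bt t T = u" "L = cl ` set T" by blast
  then have t: "t < n" "set T \<subseteq> set (ilab t)" using in_CL subs_set by auto
  then show "\<exists>t \<in> V. L \<subseteq> In t \<and> X u = X t - L" using * bt(2)[OF t] cl_ilab[OF t(1)] verts by blast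
qed

lemma dec_Ps:
  assumes "u < n" "set S \<subseteq> set (ilab u)"
  shows "(\<lambda>P. cl ` set P) ` set (Ps u S) = parallel_POFs G v0 (cl ` set S) u"
proof -
  have "L \<in> (\<lambda>P. cl ` set P) ` set (Ps u S) \<longleftrightarrow> L \<in> parallel_POFs G v0 (cl ` set S) u" for L
  proof -
    have "L \<in> (\<lambda>P. cl ` set P) ` set (Ps u S) \<longleftrightarrow>
        (\<exists>t T. (t, T) \<in> set cs \<and> bt t T = u \<and> L = cl ` set T \<and> (\<forall>l \<in> set T. \<not> compat u S l))"
      unfolding Ps_def set_filter image_iff Bex_def mem_Collect_eq bl_cubes by blast
    also have "\<dots> \<longleftrightarrow> (\<exists>t T. (t, T) \<in> set cs \<and> bt t T = u \<and> L = cl ` set T \<and> (\<forall>E \<in> L. \<not> POF G (insert E (cl ` set S))))"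
    proof (intro ex_cong1 conj_cong refl)
      fix t T assume *: "(t, T) \<in> set cs" "bt t T = u" "L = cl ` set T"
      then have "t < n" "set T \<subseteq> set (ilab t)" using in_CL subs_set by auto
      then show "(\<forall>l \<in> set T. \<not> compat u S l) \<longleftrightarrow> (\<forall>E \<in> L. \<not> POF G (insert E (cl ` set S)))"
        using POF_cl_iff[OF assms, of t T] * by simp
    qed
    also have "\<dots> \<longleftrightarrow> (\<exists>t \<in> V. L \<subseteq> In t \<and> X u = X t - L) \<and> (\<forall>E \<in> L. \<not> POF G (insert E (cl ` set S)))"
      unfolding bottom_cubes[OF assms(1)] by blast
    also have "\<dots> \<longleftrightarrow> L \<in> parallel_POFs G v0 (cl ` set S) u"
      using outgoing_POF_iff[of u L] assms(1) verts by (auto simp: parallel_POFs_def)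
    finally show ?thesis .
  qed
  then show ?thesis by blast
qed

text \<open>Bottom and classes determine a cube: adding the classes back to \<open>X u\<close> gives
  the \<open>X\<close> of its top. So no POF is listed twice.\<close>

lemma distinct_dec_Ps: "distinct (map (\<lambda>P. cl ` set P) (Ps u S))"
proof -
  have d: "distinct (map (\<lambda>(u, S). (cl ` set S, u)) cs)" using distinct_CL[of n] by simp
  have "distinct (bl cs u)" by (simp add: bl_def)
  moreover have "inj_on (\<lambda>c. cl ` set (snd (cs ! (c - 1)))) (set (bl cs u))"
  proof (rule inj_onI)
    fix a b assume "a \<in> set (bl cs u)" "b \<in> set (bl cs u)"
      and eq: "cl ` set (snd (cs ! (a - 1))) = cl ` set (snd (cs ! (b - 1)))"
    then obtain i j where ij: "i < length cs" "a = Suc i" "case_prod bt (cs ! i) = u"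
      "j < length cs" "b = Suc j" "case_prod bt (cs ! j) = u" unfolding bl_mem by blast
    obtain t T where T: "cs ! i = (t, T)" by fastforce
    obtain t' T' where T': "cs ! j = (t', T')" by fastforce
    have cl: "cl ` set T = cl ` set T'" using eq ij T T' by simp
    have X: "X u = X t - cl ` set T" "X u = X t' - cl ` set T'"
      using bt(2)[OF cs_nth(1,3)[OF ij(1) T]] bt(2)[OF cs_nth(1,3)[OF ij(4) T']] ij T T' by auto
    have sub: "cl ` set T \<subseteq> X t" "cl ` set T' \<subseteq> X t'"
      using cl_sub_X[OF cs_nth(1,3)[OF ij(1) T]] cl_sub_X[OF cs_nth(1,3)[OF ij(4) T']] .
    have "X u \<union> cl ` set T = X t" by (subst X(1)) (use sub(1) in blast)
    moreover have "X u \<union> cl ` set T' = X t'" by (subst X(2)) (use sub(2) in blast)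
    ultimately have "X t = X t'" using cl by simp
    then have "t = t'" using X_inj cs_nth(1)[OF ij(1) T] cs_nth(1)[OF ij(4) T'] verts by auto
    then have "map (\<lambda>(u, S). (cl ` set S, u)) cs ! i = map (\<lambda>(u, S). (cl ` set S, u)) cs ! j"
      using ij T T' cl by simp
    then have "i = j" using d ij nth_eq_iff_index_eq[OF d] by simp
    then show "a = b" using ij by simp
  qed
  ultimately have "distinct (map (\<lambda>P. cl ` set P) (map (\<lambda>c. snd (cs ! (c - 1))) (bl cs u)))"
    by (simp add: distinct_map comp_def)
  then show ?thesis unfolding Ps_def by (rule distinct_map_filter)
qed

lemma table_correct: "parallel_table G v0 (named_classes es lab) table"
proof -
  let ?f = "\<lambda>(u, S). (cl ` set S, u)"
  have map: "map (\<lambda>(u, L, Ps). (named_classes es lab L, u)) table = map ?f cs"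
    by (simp add: table_def dec_eq case_prod_beta comp_def)
  have "set (map ?f cs) = {(L, u). u \<in> V \<and> POF G L \<and> incoming G v0 L u}"
  proof -
    have "(L, u) \<in> set (map ?f cs) \<longleftrightarrow> u < n \<and> L \<subseteq> In u" for L u
    proof -
      have "(L, u) \<in> set (map ?f cs) \<longleftrightarrow> (\<exists>S. (u, S) \<in> set cs \<and> L = cl ` set S)" by force
      also have "\<dots> \<longleftrightarrow> u < n \<and> L \<in> (\<lambda>A. cl ` A) ` set (map set (subs (ilab u)))" unfolding in_CL by auto
      also have "\<dots> \<longleftrightarrow> u < n \<and> L \<subseteq> cl ` set (ilab u)" unfolding subs_Pow by (auto simp: subset_image_iff)
      also have "\<dots> \<longleftrightarrow> u < n \<and> L \<subseteq> In u" using cl_ilab by (simp cong: conj_cong)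
      finally show ?thesis .
    qed
    then have "x \<in> set (map ?f cs) \<longleftrightarrow> x \<in> {(L, u). u \<in> V \<and> POF G L \<and> incoming G v0 L u}" for x
      by (cases x) (simp del: set_map add: incoming_iff verts)
    then show ?thesis by blast
  qed
  moreover have props: "distinct S \<and> (\<forall>P \<in> set (Ps u S). distinct P) \<and> distinct (map (named_classes es lab) (Ps u S)) \<and>
      set (map (named_classes es lab) (Ps u S)) = parallel_POFs G v0 (named_classes es lab S) u" if "(u, S) \<in> set cs" for u S
  proof -
    have u: "u < n" "S \<in> set (subs (ilab u))" using that in_CL by auto
    have "distinct P" if "P \<in> set (Ps u S)" for P
    proof -
      have "P \<in> set (map (\<lambda>c. snd (cs ! (c - 1))) (bl cs u))" using that by (simp add: Ps_def)
      then obtain t where "(t, P) \<in> set cs" unfolding bl_cubes by blast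
      then show ?thesis using in_CL subs_distinct distinct_ilab by blast
    qed
    moreover have "distinct S" using subs_distinct distinct_ilab u by blast
    moreover have "named_classes es lab = (\<lambda>P. cl ` set P)" using dec_eq by blast
    ultimately show ?thesis using distinct_dec_Ps dec_Ps[OF u(1) subs_set[OF u(2)]] by simp
  qed
  have "\<forall>(u, L, Qs) \<in> set table. distinct L \<and> (\<forall>P \<in> set Qs. distinct P) \<and>
      distinct (map (named_classes es lab) Qs) \<and>
      set (map (named_classes es lab) Qs) = parallel_POFs G v0 (named_classes es lab L) u"
  proof
    fix x assume "x \<in> set table"
    then obtain u S where "(u, S) \<in> set cs" "x = (u, S, Ps u S)" by (auto simp: table_def)
    then show "case x of (u, L, Qs) \<Rightarrow> distinct L \<and> (\<forall>P \<in> set Qs. distinct P) \<and>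
      distinct (map (named_classes es lab) Qs) \<and>
      set (map (named_classes es lab) Qs) = parallel_POFs G v0 (named_classes es lab L) u"
      using props[of u S] by (simp del: set_map)
  qed
  ultimately show ?thesis
    unfolding parallel_table_def map using distinct_CL[of n] by blast
qed

end

section \<open>The whole program and its running time\<close>

definition parallel_program :: com where
  "parallel_program = build_adjacency ;; search ;; in_lists ;; label_edges ;; cubes ;; emit_table"

lemma csimple_parallel_program: "csimple parallel_program"
  by (simp add: parallel_program_def build_adjacency_def push_half_def search_def expand_def visit_def
      in_lists_def in_list_def collect_def label_edges_def label_k_def label_k2_def label_i_def label_j_def
      cubes_def new_cube_def cubes_below_def extend_cubes_def extend_cube_def find_down_def
      emit_table_def emit_entry_def put_def emit_def flag_up_def check_def has_label_def emit_up_def try_emit_def For_def)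

context problem
begin

lemma sum_ord: "(\<Sum>h<n. f (ord ! h)) = (\<Sum>u<n. f u :: nat)"
proof -
  have "(\<Sum>h<n. f (ord ! h)) = sum_list (map f ord)"
    by (simp add: sum_list_sum_nth ord(3) lessThan_atLeast0)
  then show ?thesis using sum_list_distinct_conv_sum_set[OF ord(1), of f] ord(2) by simp
qed

text \<open>The phases add up to at most 269 multiples of \<open>n * Suc dm ^ 4 * 4 ^ dm\<close>,
  rounded up to 300. The exponent 4 stems from the labelling loops, the base 4 from the
  table.\<close>

lemma runs_parallel_program:
  "runs parallel_program (input_state n es v0)
    (\<lambda>k s. k \<le> 300 * (n * Suc dm ^ 4 * 4 ^ dm) \<and> returns_parallel_POFs G v0 es s)"
proof -
  define s0 where "s0 = input_state n es v0"
  have i0: "vars s0 0 = n" "vars s0 1 = m" "vars s0 2 = v0" "vars s0 11 = 0"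
    "arrs s0 0 = endA" "arrs s0 1 = endB" "arrs s0 8 = (\<lambda>_. 0)" "arrs s0 19 = (\<lambda>_. 0)" "arrs s0 4 = (\<lambda>_. 0)"
    by (simp_all add: s0_def input_state_def)
  have adj0: "adj_lists s0 (adjl 0)"
    unfolding adj_lists_def lists_def by (intro allI exI[of _ "[]"]) (simp add: i0)
  let ?Z = "n * Suc dm ^ 4 * 4 ^ dm"
  have "runs parallel_program s0 (\<lambda>k s. k \<le> 300 * ?Z \<and> returns_parallel_POFs G v0 es s)"
    unfolding parallel_program_def runs_simps(4)[of build_adjacency]
  proof (rule runs_cons[OF runs_build_adjacency[OF i0(2,5,6) adj0]], goal_cases)
    case (1 k1 s1)
    note f1 = frame_vars[OF 1(2)] frame_arrs[OF 1(2)]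
    have a1: "adj_lists s1 (adjl m)" using 1 by blast
    have i1: "vars s1 0 = n" "vars s1 2 = v0" "vars s1 11 = 0" "arrs s1 8 = (\<lambda>_. 0)" "arrs s1 19 = (\<lambda>_. 0)"
      using f1 i0 by auto
    show ?case unfolding runs_simps(4)[of search]
    proof (rule runs_cons[OF runs_search[OF a1 i1(1,2,4)]], goal_cases)
      case (1 k2 s2)
      note f2 = frame_vars[OF 1(2)] frame_arrs[OF 1(2)]
      have a2: "adj_lists s2 (adjl m)" using a1 f2 by (simp add: adj_lists_def)
      have i2: "vars s2 0 = n" "vars s2 11 = 0" "arrs s2 19 = (\<lambda>_. 0)" using f2 i1 by auto
      have D: "arrs s2 8 w = Suc (lev w)" if "w < n" for w
        using 1 that ord(2) by (simp add: bfs_state_def)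
      have Q: "arrs s2 9 h = ord ! h" if "h < n" for h
        using 1 that ord(3) by (simp add: bfs_state_def)
      show ?case unfolding runs_simps(4)[of in_lists]
      proof (rule runs_cons[OF runs_in_lists[OF a2 i2(1) D]], assumption, goal_cases)
        case (1 k3 s3)
        note f3 = frame_vars[OF 1(2)] frame_arrs[OF 1(2)]
        have i3: "vars s3 0 = n" "vars s3 11 = 0" "arrs s3 19 = (\<lambda>_. 0)" using f3 i2 by auto
        have Q3: "arrs s3 9 h = ord ! h" if "h < n" for h using f3 Q[OF that] by simp
        interpret I: in_listing G n es v0 "arrs s3 10" "arrs s3 11" "arrs s3 12" "arrs s3 13"
          using collected_in_ok 1 by unfold_locales blast
        have e3: "I.env s3" by (simp add: I.env_def)
        show ?case unfolding runs_simps(4)[of label_edges]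
        proof (rule runs_cons[OF I.runs_label_edges[OF e3 i3(1) Q3]], assumption, goal_cases)
          case (1 k4 s4)
          note f4 = frame_vars[OF 1(2)] frame_arrs[OF 1(2)]
          have i4: "vars s4 0 = n" "vars s4 11 = 0" "arrs s4 19 = (\<lambda>_. 0)" using f4 i3 by auto
          have nam: "class_naming G es (arrs s4 2)" using 1 I.labk_class_naming by blast
          interpret L: labelled G n es v0 "arrs s3 10" "arrs s3 11" "arrs s3 12" "arrs s3 13" "arrs s4 2"
            using nam by unfold_locales
          have e4: "L.envl s4" using I.env_frame[OF 1(2) _ e3] by (simp add: L.envl_def)
          show ?case unfolding runs_simps(4)[of cubes]
          proof (rule runs_cons[OF L.runs_cubes[OF e4 i4]], goal_cases)
            case (1 k5 s5)
            have e5: "L.envl s5" using L.envl_frame[OF 1(2) _ e4] by simp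
            have c5: "L.cube_st (L.CL n) s5" using 1 by blast
            show ?case
            proof (rule runs_cons[OF L.runs_emit_table[OF e5 c5]], goal_cases)
              case (1 k6 s6)
              have "arrs s6 2 = arrs s4 2" using frame_arrs[OF 1(2), of 2] e5 by (simp add: L.envl_def)
              then have ret: "returns_parallel_POFs G v0 es s6"
                unfolding returns_parallel_POFs_def using nam 1 L.table_correct by metis
              have n: "1 \<le> n" using v0_V verts by auto
              have Z: "m \<le> ?Z" "n \<le> ?Z" "1 \<le> ?Z" "n * Suc dm ^ 4 \<le> ?Z" "n * (Suc dm ^ 2 * 2 ^ dm) \<le> ?Z"
                "n * Suc dm ^ 2 * 4 ^ dm \<le> ?Z"
              proof -
                have 4: "1 \<le> (4 :: nat) ^ dm" "(2 :: nat) ^ dm \<le> 4 ^ dm" by (simp_all add: power_mono)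
                have D: "Suc dm ^ 2 \<le> Suc dm ^ 4" "Suc dm \<le> Suc dm ^ 4" "1 \<le> Suc dm ^ 4"
                  using power_increasing[of 2 4 "Suc dm"] power_increasing[of 1 4 "Suc dm"] by simp_all
                show a: "n * Suc dm ^ 4 \<le> ?Z" using mult_le_mono2[OF 4(1), of "n * Suc dm ^ 4"] by simp
                have "n * dm \<le> n * Suc dm ^ 4" using D(2) by (intro mult_le_mono2) linarith
                then show "m \<le> ?Z" using m_le a by linarith
                have "n * 1 \<le> n * Suc dm ^ 4" using D(3) by (rule mult_le_mono2)
                then show b: "n \<le> ?Z" using a by linarith
                then show "1 \<le> ?Z" using n by linarith
                show "n * (Suc dm ^ 2 * 2 ^ dm) \<le> ?Z"
                  unfolding mult.assoc by (intro mult_le_mono2 mult_le_mono D(1) 4(2))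
                show "n * Suc dm ^ 2 * 4 ^ dm \<le> ?Z"
                  by (intro mult_le_mono1 mult_le_mono2 D(1))
              qed
              have "(\<Sum>h<n. 5 + 8 * length (adjl m (ord ! h))) = 5 * n + 8 * (\<Sum>u<n. length (adjl m u))"
                using sum_ord[of "\<lambda>u. 5 + 8 * length (adjl m u)"] by (simp add: sum.distrib sum_distrib_left)
              then have k2: "k2 \<le> 5 + 5 * n + 16 * m" using \<open>k2 \<le> _ \<and> _\<close> sum_adjl[of m] by simp
              have "(\<Sum>u<n. 6 + 7 * length (adjl m u)) = 6 * n + 7 * (\<Sum>u<n. length (adjl m u))"
                by (simp add: sum.distrib sum_distrib_left)
              then have k3: "k3 \<le> 2 + 6 * n + 14 * m" using \<open>k3 \<le> _ \<and> _\<close> sum_adjl[of m] by simp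
              have k1: "k1 \<le> 2 + 12 * m" using \<open>k1 \<le> _ \<and> _\<close> by blast
              have k4: "k4 \<le> 2 + 25 * (n * Suc dm ^ 4)"
                using \<open>k4 \<le> _ \<and> _\<close> by (simp only: mult.left_commute[of n 25])
              have k5: "k5 \<le> 2 + 50 * (n * (Suc dm ^ 2 * 2 ^ dm))"
                using \<open>k5 \<le> _ \<and> _\<close> by (simp only: mult.left_commute[of n 50])
              have k6: "k6 \<le> 4 + 124 * (n * Suc dm ^ 2 * 4 ^ dm)"
                using \<open>k6 \<le> _ \<and> _\<close> L.table_steps by linarith
              have "k1 + (k2 + (k3 + (k4 + (k5 + k6)))) \<le> 300 * ?Z"
                using k1 k2 k3 k4 k5 k6 Z by linarith
              then show ?case using ret by blast
            qed
          qed
        qed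
      qed
    qed
  qed
  then show ?thesis by (simp only: s0_def)
qed

lemma bounded_input: "bounded (n + m) (input_state n es v0)"
proof -
  have "v0 < n" using v0_V verts by simp
  moreover have "fst (es ! i) \<le> n + m" "snd (es ! i) \<le> n + m" if "i < m" for i
    using edge_lt[OF that] by linarith+
  ultimately show ?thesis by (simp add: bounded_def input_state_def)
qed

lemma exec_parallel_program:
  defines "K \<equiv> cgrow parallel_program" and "B \<equiv> csize parallel_program"
  shows "\<exists>t s. exec parallel_program (input_state n es v0) t s \<and> returns_parallel_POFs G v0 es s \<and>
    real t \<le> 300 * (1 + real B * (8 + log 2 (1 + 300 * real K))) * 2 ^ (2 * dm) * real n * (1 + log 2 (real n)) ^ 5"
proof -
  let ?Z = "n * Suc dm ^ 4 * 4 ^ dm"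
  obtain k s where k: "steps parallel_program (input_state n es v0) k s" "k \<le> 300 * ?Z"
    and ret: "returns_parallel_POFs G v0 es s"
    using runs_parallel_program unfolding runs_def by blast
  \<comment> \<open>\<open>n ^ 7\<close> arises as \<open>n * n ^ 4 * n ^ 2\<close> from the step
    count and also dominates the numbers of the input; every step adds at most
    \<open>K\<close>.\<close>
  define R where "R = n ^ 7 * (1 + 300 * K)"
  have n: "1 \<le> n" using v0_V verts by auto
  have dn: "2 ^ dm \<le> n" using two_pow_dimension_le verts by simp
  have Dn: "Suc dm \<le> n" using dn less_exp[of dm] by linarith
  have "Suc dm ^ 4 \<le> n ^ 4" using Dn by (rule power_mono) simp
  moreover have "4 ^ dm \<le> n ^ 2"
    using power_mono[OF dn, of 2] by (simp add: power_mult[symmetric] power2_eq_square[of n] mult.commute[of dm] power_mult)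
  ultimately have "?Z \<le> n * n ^ 4 * n ^ 2" by (intro mult_le_mono order_refl)
  also have "n * n ^ 4 * n ^ 2 = n ^ 7" by (simp add: power_add[symmetric] flip: power_Suc)
  finally have Z7: "?Z \<le> n ^ 7" .
  have "n + m \<le> n * Suc dm" using m_le by simp
  also have "\<dots> \<le> n ^ 2" unfolding power2_eq_square by (rule mult_le_mono2[OF Dn])
  also have "\<dots> \<le> n ^ 7" using n by (intro power_increasing) auto
  finally have M7: "n + m \<le> n ^ 7" .
  have "k * K \<le> 300 * n ^ 7 * K" using k(2) Z7 by (intro mult_le_mono1) linarith
  moreover have "R = n ^ 7 + 300 * n ^ 7 * K" by (simp add: R_def algebra_simps)
  ultimately have "n + m + k * K \<le> R" using M7 by linarith
  then obtain t where t: "exec parallel_program (input_state n es v0) t s" "t \<le> k * Suc (B * bit_len R)"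
    using steps_exec[OF k(1) csimple_parallel_program bounded_input, of K B R] by (auto simp: K_def B_def)
  let ?l = "1 + log 2 (real n)"
  have l: "1 \<le> ?l" using n by simp
  define c where "c = log 2 (1 + 300 * real K)"
  have c: "0 \<le> c" by (simp add: c_def)
  have "0 < R" using n by (simp add: R_def)
  then have "2 ^ floor_log R \<le> R" by (rule floor_log_exp2_le)
  then have "real (floor_log R) \<le> log 2 (real R)" by (rule le_log2_of_power)
  also have "real R = real n ^ 7 * (1 + 300 * real K)" by (simp add: R_def distrib_left)
  also have "log 2 \<dots> = 7 * log 2 (real n) + c"
    using n by (subst log_mult) (auto simp: c_def log_nat_power add_pos_nonneg)
  finally have "real (bit_len R) \<le> 1 + 7 * log 2 (real n) + c" by (simp add: bit_len_def)
  \<comment> \<open>8 is the exponent 7 of \<open>n\<close> in \<open>R\<close> plus the leading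
    1.\<close>
  also have "\<dots> \<le> (8 + c) * ?l"
  proof -
    have "c * 1 \<le> c * ?l" using l c by (rule mult_left_mono)
    moreover have "0 \<le> log 2 (real n)" using n by simp
    ultimately show ?thesis by (simp add: algebra_simps)
  qed
  finally have bl: "real (bit_len R) \<le> (8 + c) * ?l" .
  have "real (Suc (B * bit_len R)) \<le> 1 + real B * ((8 + c) * ?l)"
    using mult_left_mono[OF bl, of "real B"] by simp
  also have "\<dots> \<le> (1 + real B * (8 + c)) * ?l" using l by (simp add: algebra_simps)
  finally have cost: "real (Suc (B * bit_len R)) \<le> (1 + real B * (8 + c)) * ?l" .
  have "real dm \<le> log 2 (real n)" using dn by (rule le_log2_of_power)
  then have "real (Suc dm) ^ 4 \<le> ?l ^ 4" by (intro power_mono) auto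
  then have "real n * real (Suc dm) ^ 4 * 4 ^ dm \<le> real n * ?l ^ 4 * 4 ^ dm"
    by (intro mult_right_mono mult_left_mono) auto
  moreover have "real k \<le> 300 * (real n * real (Suc dm) ^ 4 * 4 ^ dm)"
    using k(2) by (metis (mono_tags, lifting) of_nat_le_iff of_nat_mult of_nat_numeral of_nat_power)
  ultimately have steps: "real k \<le> 300 * (real n * ?l ^ 4 * 4 ^ dm)" by linarith
  have "real t \<le> real k * real (Suc (B * bit_len R))" using t(2) by (metis of_nat_le_iff of_nat_mult)
  also have "\<dots> \<le> 300 * (real n * ?l ^ 4 * 4 ^ dm) * ((1 + real B * (8 + c)) * ?l)"
    using steps cost by (intro mult_mono) (use l in auto)
  \<comment> \<open>Four of the five logarithmic factors replace \<open>Suc dm ^ 4\<close>, and the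
    fifth is the bit length.\<close>
  also have "\<dots> = 300 * (1 + real B * (8 + c)) * 2 ^ (2 * dm) * real n * ?l ^ 5"
  proof -
    have "(2 :: real) ^ (2 * dm) = 4 ^ dm" by (simp add: power_mult)
    moreover have "?l ^ 5 = ?l ^ 4 * ?l" using power_add[of ?l 4 1] by simp
    ultimately show ?thesis by (simp only: mult.assoc mult.commute mult.left_commute)
  qed
  finally show ?thesis using t(1) ret by (auto simp: c_def)
qed

end

theorem theorem6:
  shows "\<exists>(prog :: com) (C :: real) (k :: nat).
    \<forall>(G :: nat pair_pre_digraph) (n :: nat) (es :: (nat \<times> nat) list) (v0 :: nat).
      median_graph G \<and> pverts G = {..<n} \<and> edge_listing G es \<and> v0 \<in> pverts G \<longrightarrow>
      (\<exists>t s. exec prog (input_state n es v0) t s \<and>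
             returns_parallel_POFs G v0 es s \<and>
             real t \<le> C * 2 ^ (2 * dimension G) * real n * (1 + log 2 (real n)) ^ k)"
\<comment> \<open>The constant is left open and fixed by the last bound; it depends only on the text
  of the program, not on the graph.\<close>
proof (rule exI[of _ parallel_program], rule exI, rule exI[of _ 5], intro allI impI)
  fix G :: "nat pair_pre_digraph" and n es v0
  assume "median_graph G \<and> pverts G = {..<n} \<and> edge_listing G es \<and> v0 \<in> pverts G"
  then interpret problem G n es v0 by unfold_locales auto
  show "\<exists>t s. exec parallel_program (input_state n es v0) t s \<and> returns_parallel_POFs G v0 es s \<and>
      real t \<le> (300 * (1 + real (csize parallel_program) * (8 + log 2 (1 + 300 * real (cgrow parallel_program))))) *
        2 ^ (2 * dimension G) * real n * (1 + log 2 (real n)) ^ 5"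
    using exec_parallel_program .
qed

end
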